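(* Let $1\le k\le n$ be integers, let $R>0$, and let $B_R$ be the ball of radius $R$ centered at the origin in $\mathbb{C}^n$. Put $\gamma(k,n)=\frac{(n+1)k}{n-k}$ if $k<n$ and $\gamma(n,n)=\infty$. For $p>0$ consider the Dirichlet problem $$S_k(u_{i\bar j})=(-u)^p \ \text{ on } B_R,\qquad u=0\ \text{ on }\partial B_R. \qquad ( * )$$ Then: (i) If $p\ge \gamma(k,n)$, then $( * )$ has no nontrivial (i.e. not identically zero) nonpositive real-valued solution $u$ in $C^2(\bar B_R)\cap C^4(B_R)$. (ii) If $0<p<\gamma(k,n)$ and $p\neq k$, then $( * )$ admits a solution $u\in C^2(\bar B_R)$ which is negative in $B_R$ and radially symmetric.
   Context: For a real-valued $C^2$ function $u$ on a domain of $\mathbb{C}^n$, $u_{i\bar j}=\frac{\partial^2u}{\partial z^i\partial\bar z^j}$, and the complex $k$-Hessian operator is $$S_k(u_{i\bar j})=\frac{1}{k!}\sum_{1\le i_1,\dots,i_k,j_1,\dots,j_k\le n}\delta^{i_1\dots i_k}_{j_1\dots j_k}\,u_{i_1\bar j_1}\cdots u_{i_k\bar j_k},$$ where $\delta^{i_1\dots i_k}_{j_1\dots j_k}$ is the generalized Kronecker delta; i.e. $S_k(u_{i\bar j})$ is the $k$-th elementary symmetric function of the eigenvalues of the Hermitian matrix $(u_{i\bar j})$. When $\gamma(k,n)=\infty$, part (i) is vacuous and the condition $p<\gamma(k,n)$ in (ii) is no restriction. *)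

theory Defs
  imports "HOL-Analysis.Analysis"
begin

definition partial :: "'a \<Rightarrow> ('a::real_normed_vector \<Rightarrow> 'b::real_normed_vector) \<Rightarrow> 'a \<Rightarrow> 'b" where
  "partial v f x = vector_derivative (\<lambda>t::real. f (x + t *\<^sub>R v)) (at 0)"

definition iter_partial ::
    "'a list \<Rightarrow> ('a::real_normed_vector \<Rightarrow> 'b::real_normed_vector) \<Rightarrow> 'a \<Rightarrow> 'b" where
  "iter_partial vs f = foldr partial vs f"

text \<open>Intended for open \<open>S\<close>: all partial derivatives of order at most \<open>m\<close> (in every
  order of differentiation) exist and are continuous on \<open>S\<close>.\<close>

definition C_on :: "nat \<Rightarrow> 'a set \<Rightarrow> ('a::euclidean_space \<Rightarrow> 'b::real_normed_vector) \<Rightarrow> bool" where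
  "C_on m S f \<longleftrightarrow>
     (\<forall>bs. set bs \<subseteq> Basis \<longrightarrow>
        (length bs \<le> m \<longrightarrow> continuous_on S (iter_partial bs f)) \<and>
        (length bs < m \<longrightarrow>
           (\<forall>b\<in>Basis. \<forall>x\<in>S. (\<lambda>t::real. iter_partial bs f (x + t *\<^sub>R b)) differentiable (at 0))))"

text \<open>The space $C^m(\bar S)$ for open \<open>S\<close>: functions that are continuous on the closure and
  $C^m$ in \<open>S\<close>, all of whose partial derivatives of order at most \<open>m\<close> extend continuously
  from \<open>S\<close> to the closure.  Values of \<open>f\<close> outside the closure play no role.\<close>

definition C_closure :: "nat \<Rightarrow> 'a set \<Rightarrow> ('a::euclidean_space \<Rightarrow> 'b::real_normed_vector) \<Rightarrow> bool" where
  "C_closure m S f \<longleftrightarrow>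
     C_on m S f \<and> continuous_on (closure S) f \<and>
     (\<forall>bs. set bs \<subseteq> Basis \<and> length bs \<le> m \<longrightarrow>
        (\<exists>g. continuous_on (closure S) g \<and> (\<forall>x\<in>S. g x = iter_partial bs f x)))"

text \<open>Wirtinger derivatives: with $z^i = x^i + \mathrm{i}\,y^i$, the real coordinate directions
  of $x^i$ and $y^i$ are \<open>axis i 1\<close> and \<open>axis i \<i>\<close>.\<close>

definition d_z :: "'n \<Rightarrow> (complex ^ 'n \<Rightarrow> complex) \<Rightarrow> complex ^ 'n \<Rightarrow> complex" where
  "d_z i f z = (partial (axis i 1) f z - \<i> * partial (axis i \<i>) f z) / 2"

definition d_zbar :: "'n \<Rightarrow> (complex ^ 'n \<Rightarrow> complex) \<Rightarrow> complex ^ 'n \<Rightarrow> complex" where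
  "d_zbar i f z = (partial (axis i 1) f z + \<i> * partial (axis i \<i>) f z) / 2"

definition complex_Hessian :: "(complex ^ 'n \<Rightarrow> real) \<Rightarrow> complex ^ 'n \<Rightarrow> complex ^ 'n ^ 'n" where
  "complex_Hessian u z = (\<chi> i j. d_z i (d_zbar j (\<lambda>w. complex_of_real (u w))) z)"

text \<open>Generalized Kronecker delta, as the determinant of the \<open>k \<times> k\<close> matrix whose
  \<open>(a, b)\<close> entry is the ordinary Kronecker delta of \<open>I a\<close> and \<open>J b\<close>.
  Multi-indices are functions on \<open>{..<k}\<close>.\<close>

definition gen_kronecker :: "nat \<Rightarrow> (nat \<Rightarrow> 'n) \<Rightarrow> (nat \<Rightarrow> 'n) \<Rightarrow> int" where
  "gen_kronecker k I J =
     (\<Sum>\<sigma> | \<sigma> permutes {..<k}. sign \<sigma> * (\<Prod>a<k. if I a = J (\<sigma> a) then 1 else 0))"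

definition S_op :: "nat \<Rightarrow> complex ^ 'n ^ 'n \<Rightarrow> complex" where
  "S_op k A = 1 / fact k *
     (\<Sum>I \<in> {..<k} \<rightarrow>\<^sub>E UNIV. \<Sum>J \<in> {..<k} \<rightarrow>\<^sub>E UNIV.
        of_int (gen_kronecker k I J) * (\<Prod>a<k. A $ I a $ J a))"

definition crit_exp :: "nat \<Rightarrow> nat \<Rightarrow> ereal" where
  "crit_exp k n =
     (if k < n then ereal ((real n + 1) * real k / (real n - real k)) else \<infinity>)"

text \<open>Meant for nonpositive \<open>u\<close>; since \<open>0 powr p = 0\<close>, \<open>powr\<close> is then the usual power
  for \<open>p > 0\<close>, also at zeros of \<open>u\<close>.\<close>

definition solves_Dirichlet :: "nat \<Rightarrow> real \<Rightarrow> real \<Rightarrow> (complex ^ 'n \<Rightarrow> real) \<Rightarrow> bool" where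
  "solves_Dirichlet k p R u \<longleftrightarrow>
     (\<forall>z\<in>ball 0 R. S_op k (complex_Hessian u z) = complex_of_real ((- u z) powr p)) \<and>
     (\<forall>z\<in>sphere 0 R. u z = 0)"

definition radially_symmetric_on :: "'a set \<Rightarrow> ('a::real_normed_vector \<Rightarrow> 'b) \<Rightarrow> bool" where
  "radially_symmetric_on S u \<longleftrightarrow> (\<forall>z\<in>S. \<forall>w\<in>S. norm z = norm w \<longrightarrow> u z = u w)"

end

theory Submission
  imports Defs
begin

text \<open>
  Nonexistence: write $S_k$ through its polarization $S^{i\bar j}$, which is divergence free. Testing
  the equation against $\zeta u$ and $\zeta\,Xu$, with $X$ the Euler field and $\zeta$ a radial
  cutoff, gives an identity of Pohozaev type whose volume term has a favourable sign exactly when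
  $p \ge \gamma(k,n)$. On the sphere $u = 0$ forces the Hessian to be a multiple $\lambda \ge 0$ of the
  identity up to terms involving the normal, so the boundary term is a positive multiple of
  $\lambda^{k+1}$, while $\int (-u)^p$ is controlled by $\lambda^k$; letting $\zeta \to 1$ forces
  $\int (-u)^p = 0$.

  Existence: for $u = -\psi(|z|^2)$ the equation becomes, up to scaling (which uses $p \ne k$),
  $(s^n (-\psi')^k)' = n s^{n-1} \psi^p$. If $p < k$, a solution vanishing at $1$ is the limit of a
  monotone iteration. If $p > k$, the solution of the initial value problem must reach $0$: otherwise
  it decays like $s^{-k/(p-k)}$, which contradicts the growth of the one-dimensional Pohozaev
  functional for $p < \gamma(k,n)$.
\<close>

section \<open>Polarization of the complex Hessian operator\<close>

text \<open>The solution in (i) is not assumed admissible, so the mixed form \<open>polar_S\<close>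
  has no known sign inside the ball; a sign is available only on the sphere, where the outward
  derivative v is nonnegative. At the critical exponent the volume term vanishes, so the boundary
  term must give the contradiction alone, and no Hopf lemma bounds v away from 0. The remedy is to
  subtract \<eta> times the identity for the integral of (-u)^p: since (v - \<eta>) v^k is at least
  -\<eta>^(k+1), a fixed positive multiple of \<eta> is bounded by a multiple of \<eta>^(k+1), which
  fails for small \<eta>. Third derivatives of u may blow up at the sphere; hence all integrations
  by parts take place under a cutoff supported inside the ball, and boundary values enter only
  through the continuous extensions of derivatives of order at most two.

  In (ii) the two sides are homogeneous of degrees k and p in u, so multiplication by a constant
  adjusts the relative factor when p differs from k. This frees the radius at which the profile
  vanishes.\<close>

lemma gen_kronecker_swap_right:
  assumes "a < k" "b < k" "a \<noteq> b"
  shows "gen_kronecker k I (J \<circ> Transposition.transpose a b) = - gen_kronecker k I J"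
proof -
  let ?t = "Transposition.transpose a b"
  have t: "?t permutes {..<k}" using assms by (intro permutes_swap_id) auto
  have inv: "?t \<circ> (?t \<circ> s) = s" for s :: "nat \<Rightarrow> nat" by (simp add: fun_eq_iff)
  have sg: "sign (?t \<circ> s) = - sign s" if "s permutes {..<k}" for s
    using assms that permutation_permutes[of s]
    by (subst sign_compose) (auto simp: sign_swap_id permutation_swap_id)
  show ?thesis unfolding gen_kronecker_def sum_negf[symmetric]
    by (rule sum.reindex_bij_witness[where i = "\<lambda>s. ?t \<circ> s" and j = "\<lambda>s. ?t \<circ> s"])
      (auto simp: inv sg intro!: permutes_compose[OF _ t])
qed

lemma gen_kronecker_swap_left:
  assumes "a < k" "b < k" "a \<noteq> b"
  shows "gen_kronecker k (I \<circ> Transposition.transpose a b) J = - gen_kronecker k I J"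
proof -
  let ?t = "Transposition.transpose a b"
  have t: "?t permutes {..<k}" using assms by (intro permutes_swap_id) auto
  have inv: "s \<circ> ?t \<circ> ?t = s" for s :: "nat \<Rightarrow> nat" by (simp add: fun_eq_iff)
  have sg: "sign (s \<circ> ?t) = - sign s" if "s permutes {..<k}" for s
    using assms that permutation_permutes[of s]
    by (subst sign_compose) (auto simp: sign_swap_id permutation_swap_id)
  have pr: "(\<Prod>c<k. if I c = J (s (?t c)) then 1 else (0::int))
      = (\<Prod>c<k. if I (?t c) = J (s c) then 1 else 0)" for s
    by (rule prod.reindex_bij_witness[where i = ?t and j = ?t])
      (use permutes_in_image[OF t] in auto)
  show ?thesis unfolding gen_kronecker_def sum_negf[symmetric]
    by (rule sum.reindex_bij_witness[where i = "\<lambda>s. s \<circ> ?t" and j = "\<lambda>s. s \<circ> ?t"])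
      (auto simp: inv sg pr intro!: permutes_compose[OF t])
qed

lemma gen_kronecker_diag:
  assumes "inj_on I {..<k}"
  shows "gen_kronecker k I I = 1"
proof -
  have "(\<Prod>a<k. if I a = I (s a) then 1 else (0::int)) = (if s = id then 1 else 0)"
    if s: "s permutes {..<k}" for s
  proof (cases "s = id")
    case False
    then obtain a where a: "s a \<noteq> a" by (auto simp: fun_eq_iff)
    then have "a < k" "s a < k" using s permutes_not_in[OF s] permutes_in_image[OF s] by auto
    then have "I a \<noteq> I (s a)" using assms a by (auto simp: inj_on_def)
    then show ?thesis using \<open>a < k\<close> False by (auto intro!: prod_zero)
  qed simp
  then have "gen_kronecker k I I = (\<Sum>s | s permutes {..<k}. sign s * (if s = id then 1 else 0))"
    unfolding gen_kronecker_def by (intro sum.cong) auto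
  also have "\<dots> = (\<Sum>s\<in>{id :: nat \<Rightarrow> nat}. 1)"
    by (rule sum.mono_neutral_cong_right) (auto simp: finite_permutations permutes_id)
  finally show ?thesis by simp
qed

lemma gen_kronecker_not_inj:
  assumes "\<not> inj_on I {..<k}"
  shows "gen_kronecker k I I = 0"
proof -
  obtain a b where ab: "a < k" "b < k" "a \<noteq> b" "I a = I b"
    using assms by (auto simp: inj_on_def)
  then have "I \<circ> Transposition.transpose a b = I"
    by (auto simp: fun_eq_iff Transposition.transpose_def)
  then show ?thesis using gen_kronecker_swap_right[OF ab(1-3), of I I] by simp
qed

text \<open>A permutation contributing to the sum matches the entries of \<open>I\<close> with those
  of \<open>I(0 := j)\<close>, so both would take the value \<open>I 0\<close> equally often; but
  changing slot 0 lowers that count by one.\<close>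

lemma gen_kronecker_change_one:
  assumes "0 < k" "j \<noteq> I 0"
  shows "gen_kronecker k I (I(0 := j)) = 0"
proof -
  have "(\<Prod>a<k. if I a = (I(0 := j)) (s a) then 1 else (0::int)) = 0"
    if s: "s permutes {..<k}" for s
  proof (rule ccontr)
    assume "\<not> ?thesis"
    then have eq: "I a = (I(0 := j)) (s a)" if "a < k" for a
      using that by (auto simp: prod_zero_iff split: if_splits)
    let ?A = "{a. a < k \<and> I a = I 0}" and ?B = "{a. a < k \<and> (I(0 := j)) a = I 0}"
    have "bij_betw s ?A ?B"
      unfolding bij_betw_def
    proof
      show "inj_on s ?A" using permutes_inj[OF s] by (auto simp: inj_on_def)
      show "s ` ?A = ?B"
      proof (intro equalityI subsetI)
        fix y assume "y \<in> s ` ?A"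
        then show "y \<in> ?B" using eq permutes_in_image[OF s] by force
      next
        fix y assume y: "y \<in> ?B"
        then obtain a where "a < k" "y = s a"
          using permutes_image[OF s] by (metis (mono_tags, lifting) imageE lessThan_iff mem_Collect_eq)
        then show "y \<in> s ` ?A" using y eq by force
      qed
    qed
    then have "card ?A = card ?B" by (rule bij_betw_same_card)
    moreover have "?B \<subset> ?A" using assms by (auto split: if_splits)
    ultimately show False using psubset_card_mono[of ?A ?B] by auto
  qed
  then show ?thesis unfolding gen_kronecker_def by (auto intro!: sum.neutral)
qed

definition ksum :: "nat \<Rightarrow> ((nat \<Rightarrow> 'n::finite) \<Rightarrow> (nat \<Rightarrow> 'n) \<Rightarrow> complex) \<Rightarrow> complex" where
  "ksum k F = (\<Sum>I \<in> {..<k} \<rightarrow>\<^sub>E UNIV. \<Sum>J \<in> {..<k} \<rightarrow>\<^sub>E UNIV.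
     of_int (gen_kronecker k I J) * F I J)"

lemma ksum_add: "ksum k (\<lambda>I J. F I J + G I J) = ksum k F + ksum k G"
  by (simp add: ksum_def ring_distribs sum.distrib)

lemma ksum_cmult: "ksum k (\<lambda>I J. c * F I J) = c * ksum k F"
  by (simp add: ksum_def sum_distrib_left mult.left_commute)

lemma ksum_sum: "ksum k (\<lambda>I J. \<Sum>x\<in>A. F x I J) = (\<Sum>x\<in>A. ksum k (F x))"
proof (induction A rule: infinite_finite_induct)
  case (insert x A)
  then show ?case by (simp add: ksum_add)
qed (simp_all add: ksum_def)

text \<open>Multi-indices are extensional, so a relabelling of slots must preserve the complement of
  \<open>{..<k}\<close> too; hence the equivalence in the hypothesis.\<close>

lemma PiE_UNIV_comp:
  assumes "\<And>c. c < k \<longleftrightarrow> t c < k" "I \<in> {..<k} \<rightarrow>\<^sub>E UNIV"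
  shows "I \<circ> t \<in> {..<k} \<rightarrow>\<^sub>E (UNIV :: 'n set)"
  using assms by (auto simp: PiE_def extensional_def)

lemma transpose_less_iff:
  assumes "a < k" "b < (k::nat)"
  shows "c < k \<longleftrightarrow> Transposition.transpose a b c < k"
  using assms by (auto simp: Transposition.transpose_def)

lemma ksum_swap_right:
  fixes F :: "(nat \<Rightarrow> 'n::finite) \<Rightarrow> (nat \<Rightarrow> 'n) \<Rightarrow> complex"
  assumes "a < k" "b < k" "a \<noteq> b"
  shows "ksum k (\<lambda>I J. F I (J \<circ> Transposition.transpose a b)) = - ksum k F"
proof -
  let ?t = "Transposition.transpose a b"
  have inv: "J \<circ> ?t \<circ> ?t = J" for J :: "nat \<Rightarrow> 'n" by (simp add: fun_eq_iff)
  have "(\<Sum>J \<in> {..<k} \<rightarrow>\<^sub>E UNIV. of_int (gen_kronecker k I J) * F I (J \<circ> ?t))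
    = (\<Sum>J \<in> {..<k} \<rightarrow>\<^sub>E UNIV. - (of_int (gen_kronecker k I J) * F I J))" for I
    by (rule sum.reindex_bij_witness[where i = "\<lambda>J. J \<circ> ?t" and j = "\<lambda>J. J \<circ> ?t"])
      (use assms in \<open>auto simp: inv gen_kronecker_swap_right
        intro!: PiE_UNIV_comp[OF transpose_less_iff]\<close>)
  then show ?thesis by (simp add: ksum_def sum_negf)
qed

lemma ksum_swap_left:
  fixes F :: "(nat \<Rightarrow> 'n::finite) \<Rightarrow> (nat \<Rightarrow> 'n) \<Rightarrow> complex"
  assumes "a < k" "b < k" "a \<noteq> b"
  shows "ksum k (\<lambda>I J. F (I \<circ> Transposition.transpose a b) J) = - ksum k F"
proof -
  let ?t = "Transposition.transpose a b"
  have inv: "J \<circ> ?t \<circ> ?t = J" for J :: "nat \<Rightarrow> 'n" by (simp add: fun_eq_iff)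
  have "(\<Sum>I \<in> {..<k} \<rightarrow>\<^sub>E UNIV. \<Sum>J \<in> {..<k} \<rightarrow>\<^sub>E UNIV.
        of_int (gen_kronecker k I J) * F (I \<circ> ?t) J)
    = (\<Sum>I \<in> {..<k} \<rightarrow>\<^sub>E UNIV. - (\<Sum>J \<in> {..<k} \<rightarrow>\<^sub>E UNIV. of_int (gen_kronecker k I J) * F I J))"
    by (rule sum.reindex_bij_witness[where i = "\<lambda>J. J \<circ> ?t" and j = "\<lambda>J. J \<circ> ?t"])
      (use assms in \<open>auto simp: inv gen_kronecker_swap_left sum_negf
        intro!: PiE_UNIV_comp[OF transpose_less_iff]\<close>)
  then show ?thesis by (simp add: ksum_def sum_negf)
qed

text \<open>A summand invariant under an odd relabelling equals its own negative. This kills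
  repeated rank-one factors as well as the third derivatives in a divergence.\<close>

lemma ksum_eq_0_right:
  assumes "a < k" "b < k" "a \<noteq> b"
    and "\<And>I J. F I (J \<circ> Transposition.transpose a b) = F I J"
  shows "ksum k F = 0"
  using ksum_swap_right[OF assms(1-3), of F] by (simp add: assms(4))

lemma ksum_eq_0_left:
  assumes "a < k" "b < k" "a \<noteq> b"
    and "\<And>I J. F (I \<circ> Transposition.transpose a b) J = F I J"
  shows "ksum k F = 0"
  using ksum_swap_left[OF assms(1-3), of F] by (simp add: assms(4))

text \<open>\<open>polar_S k B A / fact (k - 1)\<close> is $S^{i\bar j}(A)\,B_{i\bar j}$, where
  $S^{i\bar j} = \partial S_k/\partial a_{i\bar j}$.\<close>

definition polar_S :: "nat \<Rightarrow> ('n::finite \<Rightarrow> 'n \<Rightarrow> complex) \<Rightarrow> ('n \<Rightarrow> 'n \<Rightarrow> complex) \<Rightarrow> complex" where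
  "polar_S k B A = ksum k (\<lambda>I J. B (I 0) (J 0) * (\<Prod>a\<in>{1..<k}. A (I a) (J a)))"

lemma lessThan_eq_insert_0: "0 < k \<Longrightarrow> {..<k} = insert 0 {1..<k}" for k :: nat
  by auto

lemma S_op_eq_polar_S:
  assumes "1 \<le> k"
  shows "S_op k A = polar_S k (\<lambda>i j. A $ i $ j) (\<lambda>i j. A $ i $ j) / fact k"
  using assms by (simp add: S_op_def polar_S_def ksum_def lessThan_eq_insert_0[of k])

lemma polar_S_add: "polar_S k (\<lambda>i j. B i j + C i j) A = polar_S k B A + polar_S k C A"
  by (simp add: polar_S_def ring_distribs ksum_add)

lemma polar_S_cmult: "polar_S k (\<lambda>i j. c * B i j) A = c * polar_S k B A"
  by (simp add: polar_S_def mult.assoc ksum_cmult)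

lemma polar_S_sum: "polar_S k (\<lambda>i j. \<Sum>x\<in>X. B x i j) A = (\<Sum>x\<in>X. polar_S k (B x) A)"
  by (simp add: polar_S_def sum_distrib_right ksum_sum)

lemma polar_S_scale: "polar_S k B (\<lambda>i j. c * A i j) = c ^ (k - 1) * polar_S k B A"
  by (simp add: polar_S_def prod.distrib ksum_cmult[symmetric] mult_ac)

text \<open>By antisymmetry the factor \<open>x\<close> cannot occupy two row slots, nor
  \<open>y\<close> two column slots. The proof exchanges the factors one slot at a time;
  \<open>T\<close> is the set of slots that already carry the perturbed matrix. This makes the
  boundary terms computable, since on the sphere the Hessian is known only modulo such
  matrices.\<close>

lemma polar_S_rank_one_absorb:
  "polar_S k (\<lambda>i j. x i * y j) (\<lambda>i j. A i j + x i * c j + d i * y j)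
    = polar_S k (\<lambda>i j. x i * y j) A"
proof -
  let ?A = "\<lambda>i j. A i j + x i * c j + d i * y j"
  let ?f = "\<lambda>T I J. x (I 0) * y (J 0) * ((\<Prod>a\<in>T. ?A (I a) (J a)) * (\<Prod>a\<in>{1..<k} - T. A (I a) (J a)))"
  have "ksum k (?f T) = ksum k (?f {})" if "T \<subseteq> {1..<k}" for T
    using finite_subset[OF that finite_atLeastLessThan] that
  proof (induction T rule: finite_induct)
    case (insert a T)
    let ?r = "\<lambda>I J. (\<Prod>a\<in>T. ?A (I a) (J a)) * (\<Prod>a\<in>{1..<k} - insert a T. A (I a) (J a))"
    let ?t = "Transposition.transpose 0 a"
    have a: "a < k" "0 < k" "0 \<noteq> a" using insert.prems by auto
    have tb: "?t b = b" if "b \<in> T \<or> b \<in> {1..<k} - insert a T" for b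
      using that insert by (auto simp: Transposition.transpose_def)
    have r: "?r (I \<circ> ?t) J = ?r I J" "?r I (J \<circ> ?t) = ?r I J" for I J
      by (intro arg_cong2[where f = "(*)"] prod.cong; use tb in force)+
    have eq: "{1..<k} - T = insert a ({1..<k} - insert a T)" using insert by auto
    \<comment> \<open>Splitting slot \<open>a\<close> leaves two error terms: in the first
      \<open>x\<close> occupies two row slots, in the second \<open>y\<close> occupies two column
      slots.\<close>
    have "?f (insert a T) I J = ?f T I J + x (I 0) * y (J 0) * x (I a) * c (J a) * ?r I J
        + x (I 0) * y (J 0) * d (I a) * y (J a) * ?r I J" for I J
      using insert.hyps by (subst eq) (simp add: algebra_simps)
    then have "ksum k (?f (insert a T)) = ksum k (?f T)
        + ksum k (\<lambda>I J. x (I 0) * y (J 0) * x (I a) * c (J a) * ?r I J)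
        + ksum k (\<lambda>I J. x (I 0) * y (J 0) * d (I a) * y (J a) * ?r I J)"
      by (simp add: ksum_add)
    also have "ksum k (\<lambda>I J. x (I 0) * y (J 0) * x (I a) * c (J a) * ?r I J) = 0"
      by (rule ksum_eq_0_left[OF a(2,1,3)], subst r) (simp add: mult_ac)
    also have "ksum k (\<lambda>I J. x (I 0) * y (J 0) * d (I a) * y (J a) * ?r I J) = 0"
      by (rule ksum_eq_0_right[OF a(2,1,3)], subst r) (simp add: mult_ac)
    finally show ?case using insert by simp
  qed simp
  from this[of "{1..<k}"] show ?thesis by (simp add: polar_S_def)
qed

text \<open>At the identity only \<open>J = I\<close> survives, so the coefficient of
  \<open>B i i\<close> counts the injective multi-indices with first entry \<open>i\<close>. The
  constant is (n-1)!/(n-k)!, positive because \<open>k\<close> is at most the dimension.\<close>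

lemma polar_S_mat1:
  assumes "1 \<le> k" "k \<le> CARD('n::finite)"
  shows "\<exists>c>0. \<forall>B :: 'n \<Rightarrow> 'n \<Rightarrow> complex.
    polar_S k B (\<lambda>i j. if i = j then 1 else 0) = of_real c * (\<Sum>i\<in>UNIV. B i i)"
proof -
  let ?N = "\<lambda>i. {I \<in> {..<k} \<rightarrow>\<^sub>E (UNIV::'n set). inj_on I {..<k} \<and> I 0 = i}"
  have fin: "finite ({..<k} \<rightarrow>\<^sub>E (UNIV::'n set))" by (intro finite_PiE) auto
  have k0: "0 < k" using assms by simp
  have 1: "polar_S k B (\<lambda>i j. if i = j then 1 else 0) = (\<Sum>i\<in>UNIV. of_nat (card (?N i)) * B i i)"
    for B :: "'n \<Rightarrow> 'n \<Rightarrow> complex"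
  proof -
    have inner: "(\<Sum>J \<in> {..<k} \<rightarrow>\<^sub>E UNIV. of_int (gen_kronecker k I J) *
         (B (I 0) (J 0) * (\<Prod>a\<in>{1..<k}. if I a = J a then 1 else 0)))
        = (if inj_on I {..<k} then B (I 0) (I 0) else 0)"
      if I: "I \<in> {..<k} \<rightarrow>\<^sub>E UNIV" for I
    proof -
      have "of_int (gen_kronecker k I J) *
         (B (I 0) (J 0) * (\<Prod>a\<in>{1..<k}. if I a = J a then 1 else 0)) = 0"
        if J: "J \<in> {..<k} \<rightarrow>\<^sub>E UNIV" "J \<noteq> I" for J
      proof (cases "\<forall>a\<in>{1..<k}. I a = J a")
        case True
        \<comment> \<open>Agreement in the slots 1 to \<open>k - 1\<close>, plus extensionality
          outside \<open>{..<k}\<close>, leaves slot 0 as the only difference.\<close>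
        have "J = I(0 := J 0)"
        proof
          fix a show "J a = (I(0 := J 0)) a"
            using True I J by (cases "a < k") (auto simp: PiE_def extensional_def)
        qed
        moreover from this have "J 0 \<noteq> I 0" using J(2) by auto
        ultimately have "gen_kronecker k I J = 0"
          using gen_kronecker_change_one[OF k0, of "J 0" I] by simp
        then show ?thesis by simp
      next
        case False
        then have "(\<Prod>a\<in>{1..<k}. if I a = J a then 1 else (0::complex)) = 0"
          by (intro prod_zero) auto
        then show ?thesis by simp
      qed
      then have "(\<Sum>J \<in> {..<k} \<rightarrow>\<^sub>E UNIV. of_int (gen_kronecker k I J) *
         (B (I 0) (J 0) * (\<Prod>a\<in>{1..<k}. if I a = J a then 1 else 0)))
        = (\<Sum>J \<in> {I}. of_int (gen_kronecker k I J) *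
         (B (I 0) (J 0) * (\<Prod>a\<in>{1..<k}. if I a = J a then 1 else 0)))"
        using I fin by (intro sum.mono_neutral_right) auto
      then show ?thesis by (simp add: gen_kronecker_diag gen_kronecker_not_inj)
    qed
    have "polar_S k B (\<lambda>i j. if i = j then 1 else 0)
      = (\<Sum>I \<in> {..<k} \<rightarrow>\<^sub>E UNIV. if inj_on I {..<k} then B (I 0) (I 0) else 0)"
      unfolding polar_S_def ksum_def by (intro sum.cong inner) auto
    also have "\<dots> = (\<Sum>I \<in> {..<k} \<rightarrow>\<^sub>E UNIV. \<Sum>i\<in>UNIV. if inj_on I {..<k} \<and> I 0 = i then B i i else 0)"
      by (intro sum.cong) auto
    also have "\<dots> = (\<Sum>i\<in>UNIV. \<Sum>I \<in> {..<k} \<rightarrow>\<^sub>E UNIV. if inj_on I {..<k} \<and> I 0 = i then B i i else 0)"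
      by (rule sum.swap)
    also have "\<dots> = (\<Sum>i\<in>UNIV. of_nat (card (?N i)) * B i i)"
      using fin by (intro sum.cong) (simp_all add: sum.If_cases Int_def)
    finally show ?thesis .
  qed
  \<comment> \<open>Transposing the values \<open>i\<close> and \<open>j\<close> turns multi-indices
    starting with \<open>i\<close> into those starting with \<open>j\<close>, so all the counts
    agree.\<close>
  have sw: "restrict (Transposition.transpose i j \<circ> I) {..<k} \<in> ?N j" if "I \<in> ?N i" for i j I
    using that k0 by (auto simp: inj_on_def dest: transpose_eq_imp_eq)
  have card_eq: "card (?N i) = card (?N j)" for i j
    by (rule bij_betw_same_card, rule bij_betwI[where g = "\<lambda>I. restrict (Transposition.transpose j i \<circ> I) {..<k}"
          and f = "\<lambda>I. restrict (Transposition.transpose i j \<circ> I) {..<k}"])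
      (use sw[of _ i j] sw[of _ j i] in \<open>auto simp: fun_eq_iff restrict_def PiE_def extensional_def
         Transposition.transpose_commute\<close>)
  obtain f where f: "inj_on f {..<k}" "f ` {..<k} \<subseteq> (UNIV::'n set)"
    using card_le_inj[of "{..<k}" "UNIV::'n set"] assms by auto
  let ?i = "f 0"
  have "restrict f {..<k} \<in> ?N ?i" using f k0 by (auto simp: inj_on_def)
  then have "?N ?i \<noteq> {}" by blast
  moreover have "finite (?N ?i)" using fin by simp
  ultimately have pos: "card (?N ?i) > 0" by (simp only: card_gt_0_iff simp_thms)
  have "polar_S k B (\<lambda>i j. if i = j then 1 else 0) = of_real (real (card (?N ?i))) * (\<Sum>i\<in>UNIV. B i i)"
    for B :: "'n \<Rightarrow> 'n \<Rightarrow> complex"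
    unfolding 1 sum_distrib_left
  proof (intro sum.cong refl)
    fix j show "of_nat (card (?N j)) * B j j = of_real (real (card (?N ?i))) * B j j"
      using card_eq[of j ?i] by (simp only: of_real_of_nat_eq)
  qed
  then show ?thesis using pos by (intro exI[of _ "real (card (?N ?i))"]) simp
qed

text \<open>The product rule yields one term per slot. Exchanging slot \<open>a\<close> with slot 0
  in both multi-indices changes the sign twice, so all \<open>k\<close> terms coincide.\<close>

lemma polar_S_has_vector_derivative:
  assumes k: "1 \<le> k"
    and A: "\<And>i j. ((\<lambda>t. A t i j) has_vector_derivative A' i j) (at t within S)"
  shows "((\<lambda>t. polar_S k (A t) (A t)) has_vector_derivative of_nat k * polar_S k A' (A t)) (at t within S)"
proof -
  have pr: "((\<lambda>t. \<Prod>a<k. A t (I a) (J a)) has_vector_derivative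
      (\<Sum>a<k. A' (I a) (J a) * (\<Prod>b\<in>{..<k} - {a}. A t (I b) (J b)))) (at t within S)" for I J
    unfolding has_vector_derivative_def
    by (rule has_derivative_eq_rhs, rule has_derivative_prod[OF A[unfolded has_vector_derivative_def]])
      (auto simp: fun_eq_iff scaleR_sum_right)
  have 1: "ksum k (\<lambda>I J. A' (I a) (J a) * (\<Prod>b\<in>{..<k} - {a}. A t (I b) (J b))) = polar_S k A' (A t)"
    if a: "a < k" for a
  proof (cases "a = 0")
    case True
    have "{..<k} - {0} = {1..<k}" by auto
    then show ?thesis using True by (simp add: polar_S_def)
  next
    case False
    let ?t = "Transposition.transpose 0 a"
    let ?F = "\<lambda>I J. A' (I a) (J a) * (\<Prod>b\<in>{..<k} - {a}. A t (I b) (J b))"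
    have "ksum k (\<lambda>I J. ?F (I \<circ> ?t) (J \<circ> ?t)) = ksum k ?F"
      using False a k ksum_swap_right[of 0 k a "\<lambda>I J. ?F (I \<circ> ?t) J"] ksum_swap_left[of 0 k a ?F]
      by simp
    moreover have "?F (I \<circ> ?t) (J \<circ> ?t) = A' (I 0) (J 0) * (\<Prod>a\<in>{1..<k}. A t (I a) (J a))" for I J
    proof -
      have "(\<Prod>b\<in>{..<k} - {a}. A t (I (?t b)) (J (?t b))) = (\<Prod>a\<in>{1..<k}. A t (I a) (J a))"
        by (rule prod.reindex_bij_witness[where i = ?t and j = ?t])
          (use a False in \<open>auto simp: Transposition.transpose_def split: if_splits\<close>)
      then show ?thesis by simp
    qed
    ultimately show ?thesis unfolding polar_S_def by (simp only:)
  qed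
  have "((\<lambda>t. ksum k (\<lambda>I J. \<Prod>a<k. A t (I a) (J a))) has_vector_derivative
     ksum k (\<lambda>I J. \<Sum>a<k. A' (I a) (J a) * (\<Prod>b\<in>{..<k} - {a}. A t (I b) (J b)))) (at t within S)"
    unfolding ksum_def
    by (intro has_vector_derivative_sum has_vector_derivative_mult_right pr)
  moreover have "ksum k (\<lambda>I J. \<Prod>a<k. A t (I a) (J a)) = polar_S k (A t) (A t)" for t
    using k by (simp add: polar_S_def lessThan_eq_insert_0[of k])
  ultimately show ?thesis by (simp add: ksum_sum 1)
qed

text \<open>Along the segment from \<open>a\<close> times the identity to \<open>M\<close> the
  derivative is constant, since \<open>polar_S_rank_one_absorb\<close> removes the rank-one part
  from it; hence the value is affine in the parameter. Radial functions have Hessians of exactly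
  this shape.\<close>

lemma polar_S_identity_plus_rank_one:
  fixes a b :: complex and x y :: "'n::finite \<Rightarrow> complex"
  assumes "1 \<le> k"
    and c: "\<And>B :: 'n \<Rightarrow> 'n \<Rightarrow> complex.
      polar_S k B (\<lambda>i j. if i = j then 1 else 0) = of_real c * (\<Sum>i\<in>UNIV. B i i)"
  defines "M \<equiv> \<lambda>i j. a * (if i = j then 1 else 0) + b * (x i * y j)"
  shows "polar_S k M M = of_real c * (of_nat CARD('n) * a ^ k + of_nat k * a ^ (k - 1) * b * (\<Sum>i\<in>UNIV. x i * y i))"
proof -
  define A where "A = (\<lambda>(t::real) (i::'n) (j::'n). a * (if i = j then 1 else 0) + t * (b * (x i * y j)))"
  define D where "D = of_nat k * b * a ^ (k - 1) * of_real c * (\<Sum>i\<in>UNIV. x i * y i)"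
  have "((\<lambda>t. polar_S k (A t) (A t)) has_vector_derivative
     of_nat k * polar_S k (\<lambda>i j. b * (x i * y j)) (A t)) (at t)" for t
    by (rule polar_S_has_vector_derivative[OF assms(1)])
      (auto simp: A_def intro!: derivative_eq_intros has_vector_derivative_real_field)
  moreover have "of_nat k * polar_S k (\<lambda>i j. b * (x i * y j)) (A t) = D" for t
  proof -
    have "polar_S k (\<lambda>i j. x i * y j) (A t)
        = polar_S k (\<lambda>i j. x i * y j) (\<lambda>i j. a * (if i = j then 1 else 0) + x i * (t * b * y j) + 0 * y j)"
      by (simp add: A_def mult_ac)
    also have "\<dots> = polar_S k (\<lambda>i j. x i * y j) (\<lambda>i j. a * (if i = j then 1 else 0))"
      by (rule polar_S_rank_one_absorb)
    also have "\<dots> = a ^ (k - 1) * (of_real c * (\<Sum>i\<in>UNIV. x i * y i))"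
      by (simp only: polar_S_scale c)
    finally show ?thesis by (simp only: polar_S_cmult D_def) (simp add: mult_ac)
  qed
  ultimately have d: "((\<lambda>t. polar_S k (A t) (A t) - t * D) has_vector_derivative 0) (at t)" for t
    by (auto intro!: derivative_eq_intros has_vector_derivative_real_field)
  have "polar_S k (A 1) (A 1) - of_real 1 * D = polar_S k (A 0) (A 0) - of_real 0 * D"
    by (rule has_derivative_zero_unique[of UNIV])
      (use d in \<open>auto simp: has_vector_derivative_def\<close>)
  moreover have "polar_S k (A 0) (A 0) = a * (a ^ (k - 1) * (of_real c * of_nat CARD('n)))"
    unfolding A_def by (simp add: polar_S_cmult polar_S_scale c)
  moreover have "a * a ^ (k - 1) = a ^ k" using assms(1) by (cases k) auto
  ultimately show ?thesis by (simp add: M_def A_def D_def algebra_simps)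
qed

section \<open>Partial derivatives and functions of class $C^m$\<close>

text \<open>\<open>partial\<close> has an unspecified value where the line derivative does not
  exist, so existence has to be carried along with the value.\<close>

abbreviation has_partial :: "'a \<Rightarrow> ('a::real_normed_vector \<Rightarrow> 'b::real_normed_vector) \<Rightarrow> 'a \<Rightarrow> bool" where
  "has_partial b f x \<equiv> ((\<lambda>t::real. f (x + t *\<^sub>R b)) has_vector_derivative partial b f x) (at 0)"

lemma partialI:
  assumes "((\<lambda>t::real. f (x + t *\<^sub>R b)) has_vector_derivative D) (at 0)"
  shows "partial b f x = D" "has_partial b f x"
  using vector_derivative_at[OF assms] assms by (auto simp: partial_def)

lemma has_partial_iff: "has_partial b f x \<longleftrightarrow> (\<lambda>t::real. f (x + t *\<^sub>R b)) differentiable (at 0)"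
  unfolding partial_def by (simp add: vector_derivative_works)

lemma line_derivative_cong:
  fixes f g :: "'a::real_normed_vector \<Rightarrow> 'b::real_normed_vector"
  assumes S: "open S" "x \<in> S" and eq: "\<And>y. y \<in> S \<Longrightarrow> f y = g y"
    and f: "((\<lambda>t::real. f (x + t *\<^sub>R b)) has_vector_derivative D) (at 0)"
  shows "((\<lambda>t::real. g (x + t *\<^sub>R b)) has_vector_derivative D) (at 0)"
proof (rule has_vector_derivative_transform_within_open[OF f])
  show "open ((\<lambda>t::real. x + t *\<^sub>R b) -` S)"
    by (intro open_vimage S continuous_on_add continuous_on_const continuous_on_scaleR continuous_on_id)
qed (use S eq in auto)

lemma partial_cong:
  fixes f g :: "'a::real_normed_vector \<Rightarrow> 'b::real_normed_vector"
  assumes S: "open S" "x \<in> S" and eq: "\<And>y. y \<in> S \<Longrightarrow> f y = g y"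
  shows "partial b f x = partial b g x" "has_partial b f x \<longleftrightarrow> has_partial b g x"
proof -
  have *: "((\<lambda>t::real. f (x + t *\<^sub>R b)) has_vector_derivative D) (at 0)
      \<longleftrightarrow> ((\<lambda>t::real. g (x + t *\<^sub>R b)) has_vector_derivative D) (at 0)" for D
    using line_derivative_cong[OF S, of f g] line_derivative_cong[OF S, of g f] eq by auto
  show 1: "partial b f x = partial b g x"
    unfolding partial_def vector_derivative_def by (simp only: *)
  show "has_partial b f x \<longleftrightarrow> has_partial b g x" by (simp only: * 1)
qed

lemma iter_partial_snoc: "iter_partial (bs @ [b]) f = iter_partial bs (partial b f)"
  by (simp add: iter_partial_def)

lemma C_on_0: "C_on 0 S f \<longleftrightarrow> continuous_on S f"
  by (auto simp: C_on_def iter_partial_def)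

text \<open>Peels off the innermost derivative, which sits at the end of the list because
  \<open>iter_partial\<close> is a \<open>foldr\<close>. The closure properties below are inductions
  along this recursion.\<close>

lemma C_on_Suc:
  "C_on (Suc m) S f \<longleftrightarrow>
     continuous_on S f \<and> (\<forall>b\<in>Basis. (\<forall>x\<in>S. has_partial b f x) \<and> C_on m S (partial b f))"
  (is "?L \<longleftrightarrow> ?R")
proof
  assume L: ?L
  show ?R
  proof (intro conjI ballI)
    show "continuous_on S f"
      using L[unfolded C_on_def, rule_format, of "[]"] by (simp add: iter_partial_def)
    fix b :: 'a assume b: "b \<in> Basis"
    show "has_partial b f x" if "x \<in> S" for x
      using L[unfolded C_on_def, rule_format, of "[]"] b that by (simp add: iter_partial_def has_partial_iff)
    show "C_on m S (partial b f)"
      unfolding C_on_def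
    proof (intro allI impI)
      fix bs :: "'a list" assume "set bs \<subseteq> Basis"
      then show "(length bs \<le> m \<longrightarrow> continuous_on S (iter_partial bs (partial b f))) \<and>
          (length bs < m \<longrightarrow> (\<forall>ba\<in>Basis. \<forall>x\<in>S.
            (\<lambda>t. iter_partial bs (partial b f) (x + t *\<^sub>R ba)) differentiable at 0))"
        using L[unfolded C_on_def, rule_format, of "bs @ [b]"] b by (simp add: iter_partial_snoc)
    qed
  qed
next
  assume R: ?R
  show ?L
    unfolding C_on_def
  proof (intro allI impI)
    fix bs :: "'a list" assume bs: "set bs \<subseteq> Basis"
    show "(length bs \<le> Suc m \<longrightarrow> continuous_on S (iter_partial bs f)) \<and>
        (length bs < Suc m \<longrightarrow> (\<forall>b\<in>Basis. \<forall>x\<in>S.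
          (\<lambda>t. iter_partial bs f (x + t *\<^sub>R b)) differentiable at 0))"
    proof (cases bs rule: rev_cases)
      case Nil
      then show ?thesis using R by (simp add: iter_partial_def has_partial_iff)
    next
      case (snoc cs b)
      then show ?thesis
        using R bs by (auto simp: iter_partial_snoc C_on_def)
    qed
  qed
qed

lemma C_on_cong:
  assumes "open S" "\<And>x. x \<in> S \<Longrightarrow> f x = g x"
  shows "C_on m S f \<longleftrightarrow> C_on m S g"
  using assms(2)
proof (induction m arbitrary: f g)
  case 0
  then show ?case by (auto simp: C_on_0 cong: continuous_on_cong)
next
  case (Suc m)
  have "C_on m S (partial b f) \<longleftrightarrow> C_on m S (partial b g)" for b
    by (intro Suc.IH partial_cong(1)[OF assms(1)] Suc.prems)
  moreover have "(\<forall>x\<in>S. has_partial b f x) \<longleftrightarrow> (\<forall>x\<in>S. has_partial b g x)" for b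
    by (intro ball_cong refl partial_cong(2)[OF assms(1)] Suc.prems)
  moreover have "continuous_on S f \<longleftrightarrow> continuous_on S g"
    using Suc.prems by (auto cong: continuous_on_cong)
  ultimately show ?case by (simp only: C_on_Suc)
qed

lemma C_on_continuous: "C_on m S f \<Longrightarrow> continuous_on S f"
  by (cases m) (auto simp: C_on_0 C_on_Suc)

lemma C_on_SucD: "C_on (Suc m) S f \<Longrightarrow> C_on m S f"
proof (induction m arbitrary: f)
  case 0
  then show ?case by (auto simp: C_on_0 C_on_Suc)
next
  case (Suc m)
  from Suc.prems have "\<forall>b\<in>Basis. C_on m S (partial b f)"
    using Suc.IH by (auto simp: C_on_Suc[of "Suc m"])
  then show ?case using Suc.prems by (auto simp: C_on_Suc)
qed

lemma C_on_mono: "C_on m S f \<Longrightarrow> k \<le> m \<Longrightarrow> C_on k S f"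
  by (induction m) (auto simp: le_Suc_eq dest: C_on_SucD)

lemma C_on_has_partial: "C_on m S f \<Longrightarrow> 1 \<le> m \<Longrightarrow> x \<in> S \<Longrightarrow> b \<in> Basis \<Longrightarrow> has_partial b f x"
  by (cases m) (auto simp: C_on_Suc)

lemma C_on_partial: "C_on (Suc m) S f \<Longrightarrow> b \<in> Basis \<Longrightarrow> C_on m S (partial b f)"
  by (auto simp: C_on_Suc)

lemma partial_add:
  assumes "has_partial b f x" "has_partial b g x"
  shows "partial b (\<lambda>x. f x + g x) x = partial b f x + partial b g x"
    and "has_partial b (\<lambda>x. f x + g x) x"
  using partialI[OF has_vector_derivative_add[OF assms]] .

lemma partial_sum:
  assumes "\<And>i. i \<in> I \<Longrightarrow> has_partial b (f i) x"
  shows "partial b (\<lambda>x. \<Sum>i\<in>I. f i x) x = (\<Sum>i\<in>I. partial b (f i) x)"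
    and "has_partial b (\<lambda>x. \<Sum>i\<in>I. f i x) x"
  using partialI[OF has_vector_derivative_sum[of I "\<lambda>i t. f i (x + t *\<^sub>R b)", OF assms]] by simp_all

lemma partial_mult:
  fixes f g :: "'a::real_normed_vector \<Rightarrow> 'b::real_normed_algebra"
  assumes "has_partial b f x" "has_partial b g x"
  shows "partial b (\<lambda>x. f x * g x) x = partial b f x * g x + f x * partial b g x"
    and "has_partial b (\<lambda>x. f x * g x) x"
  using partialI[OF has_vector_derivative_mult[OF assms]] by (simp_all add: add.commute)

lemma partial_bounded_linear:
  assumes "bounded_linear L" "has_partial b f x"
  shows "partial b (\<lambda>x. L (f x)) x = L (partial b f x)"
    and "has_partial b (\<lambda>x. L (f x)) x"
  using partialI[OF bounded_linear.has_vector_derivative[OF assms]] .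

lemma partial_linear:
  assumes "bounded_linear L"
  shows "partial b L x = L b" "has_partial b L x"
proof -
  interpret L: bounded_linear L by fact
  have "((\<lambda>t::real. L (x + t *\<^sub>R b)) has_vector_derivative L b) (at 0)"
    by (auto simp: L.add L.scaleR intro!: derivative_eq_intros)
  then show "partial b L x = L b" "has_partial b L x" by (auto intro: partialI)
qed

lemma partial_const: "partial b (\<lambda>x. c) x = 0" "has_partial b (\<lambda>x. c) x"
  by (auto intro!: partialI derivative_eq_intros)

lemma partial_const_fun [simp]: "partial b (\<lambda>x. c) = (\<lambda>x. 0)"
  by (simp add: fun_eq_iff partial_const)

lemma C_on_const: "C_on m S (\<lambda>x. c)"
  by (induction m arbitrary: c) (auto simp: C_on_0 C_on_Suc partial_const)

lemma C_on_add:
  assumes "open S" "C_on m S f" "C_on m S g"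
  shows "C_on m S (\<lambda>x. f x + g x)"
  using assms(2,3)
proof (induction m arbitrary: f g)
  case 0
  then show ?case by (auto simp: C_on_0 intro: continuous_intros)
next
  case (Suc m)
  have "C_on m S (\<lambda>x. partial b f x + partial b g x)" if "b \<in> Basis" for b
    using Suc that by (auto simp: C_on_Suc)
  moreover have "C_on m S (partial b (\<lambda>x. f x + g x)) \<longleftrightarrow> C_on m S (\<lambda>x. partial b f x + partial b g x)"
    if "b \<in> Basis" for b
    by (rule C_on_cong[OF assms(1)]) (use Suc.prems that in \<open>auto simp: partial_add(1) C_on_Suc\<close>)
  ultimately show ?case using Suc.prems
    by (auto simp: C_on_Suc intro!: partial_add(2) partial_mult(2) continuous_intros simp del: partial_const_fun)
qed

lemma C_on_sum:
  assumes "open S" "\<And>i. i \<in> I \<Longrightarrow> C_on m S (f i)"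
  shows "C_on m S (\<lambda>x. \<Sum>i\<in>I. f i x)"
  using assms(2) by (induction I rule: infinite_finite_induct) (auto intro: C_on_const C_on_add[OF assms(1)])

lemma C_on_mult:
  fixes f g :: "'a::euclidean_space \<Rightarrow> 'b::real_normed_algebra"
  assumes "open S" "C_on m S f" "C_on m S g"
  shows "C_on m S (\<lambda>x. f x * g x)"
  using assms(2,3)
proof (induction m arbitrary: f g)
  case 0
  then show ?case by (auto simp: C_on_0 intro: continuous_intros)
next
  case (Suc m)
  have "C_on m S (\<lambda>x. partial b f x * g x + f x * partial b g x)" if "b \<in> Basis" for b
    using Suc that C_on_SucD[OF Suc.prems(1)] C_on_SucD[OF Suc.prems(2)]
    by (intro C_on_add assms(1) Suc.IH) (auto simp: C_on_Suc)
  moreover have "C_on m S (partial b (\<lambda>x. f x * g x)) \<longleftrightarrow> C_on m S (\<lambda>x. partial b f x * g x + f x * partial b g x)"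
    if "b \<in> Basis" for b
    by (rule C_on_cong[OF assms(1)]) (use Suc.prems that in \<open>auto simp: partial_mult(1) C_on_Suc\<close>)
  ultimately show ?case using Suc.prems
    by (auto simp: C_on_Suc intro!: partial_add(2) partial_mult(2) continuous_intros simp del: partial_const_fun)
qed

lemma C_on_prod:
  fixes f :: "'i \<Rightarrow> 'a::euclidean_space \<Rightarrow> 'b::{comm_monoid_mult, real_normed_algebra}"
  assumes "open S" "\<And>i. i \<in> I \<Longrightarrow> C_on m S (f i)"
  shows "C_on m S (\<lambda>x. \<Prod>i\<in>I. f i x)"
  using assms(2) by (induction I rule: infinite_finite_induct) (auto intro: C_on_const C_on_mult[OF assms(1)])

lemma C_on_bounded_linear:
  assumes "open S" "bounded_linear L" "C_on m S f"
  shows "C_on m S (\<lambda>x. L (f x))"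
  using assms(3)
proof (induction m arbitrary: f)
  case 0
  then show ?case using bounded_linear.continuous_on[OF assms(2)] by (auto simp: C_on_0)
next
  case (Suc m)
  have "C_on m S (partial b (\<lambda>x. L (f x))) \<longleftrightarrow> C_on m S (\<lambda>x. L (partial b f x))"
    if "b \<in> Basis" for b
    by (rule C_on_cong[OF assms(1)])
      (use Suc.prems that in \<open>auto simp: partial_bounded_linear(1)[OF assms(2)] C_on_Suc\<close>)
  then show ?case using Suc bounded_linear.continuous_on[OF assms(2)]
    by (auto simp: C_on_Suc intro!: partial_bounded_linear(2)[OF assms(2)])
qed

lemma C_on_linear:
  assumes "bounded_linear L"
  shows "C_on m S L"
proof (cases m)
  case 0
  then show ?thesis using assms by (simp add: C_on_0 linear_continuous_on)
next
  case (Suc n)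
  have "partial b L = (\<lambda>x. L b)" for b by (simp add: fun_eq_iff partial_linear[OF assms])
  then show ?thesis
    using assms Suc partial_linear(2)[OF assms] by (simp add: C_on_Suc linear_continuous_on C_on_const)
qed

lemma partial_real_compose:
  fixes f :: "'a::real_normed_vector \<Rightarrow> real"
  assumes "(q has_real_derivative q') (at (f x))" "has_partial b f x"
  shows "partial b (\<lambda>x. q (f x)) x = q' * partial b f x" "has_partial b (\<lambda>x. q (f x)) x"
proof -
  have "((\<lambda>t::real. q (f (x + t *\<^sub>R b))) has_real_derivative q' * partial b f x) (at 0)"
    by (rule DERIV_chain2) (use assms in \<open>auto simp: has_real_derivative_iff_has_vector_derivative\<close>)
  then show "partial b (\<lambda>x. q (f x)) x = q' * partial b f x" "has_partial b (\<lambda>x. q (f x)) x"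
    by (auto simp: has_real_derivative_iff_has_vector_derivative intro: partialI)
qed

lemma C_on_1_real_compose:
  fixes f :: "'a::euclidean_space \<Rightarrow> real"
  assumes "open S" "C_on 1 S f" "\<And>y. (q has_real_derivative q' y) (at y)" "continuous_on UNIV q'"
  shows "C_on 1 S (\<lambda>x. q (f x))"
proof -
  have f: "continuous_on S f" using assms(2) by (rule C_on_continuous)
  have q: "continuous_on UNIV q" using assms(3) by (intro DERIV_continuous_on) auto
  have "C_on 0 S (partial b (\<lambda>x. q (f x)))" if b: "b \<in> Basis" for b
  proof -
    have "continuous_on S (\<lambda>x. q' (f x) * partial b f x)"
      using C_on_partial[of 0 S f b] assms(2) b
      by (intro continuous_on_mult continuous_on_compose2[OF assms(4) f]) (auto simp: C_on_0)
    moreover have "partial b (\<lambda>x. q (f x)) x = q' (f x) * partial b f x" if "x \<in> S" for x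
      by (rule partial_real_compose(1)[OF assms(3) C_on_has_partial[OF assms(2) _ that b]]) simp
    ultimately show ?thesis by (simp add: C_on_0 cong: continuous_on_cong)
  qed
  moreover have "has_partial b (\<lambda>x. q (f x)) x" if "x \<in> S" "b \<in> Basis" for b x
    by (rule partial_real_compose(2)[OF assms(3) C_on_has_partial[OF assms(2) _ that]]) simp
  moreover have "continuous_on S (\<lambda>x. q (f x))"
    using continuous_on_compose2[OF q f] by auto
  ultimately show ?thesis by (simp add: One_nat_def[symmetric] C_on_Suc del: One_nat_def add: C_on_Suc[of 0, simplified])
qed

section \<open>Mean value arguments: symmetry of second partials, total differentiability, vanishing
  integrals\<close>

lemma line_derivative:
  assumes "has_partial b f (y + t *\<^sub>R b)"
  shows "((\<lambda>s. f (y + s *\<^sub>R b)) has_vector_derivative partial b f (y + t *\<^sub>R b)) (at t)"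
proof -
  have "((\<lambda>s::real. s - t) has_vector_derivative 1) (at t)"
    by (auto intro!: derivative_eq_intros)
  from vector_diff_chain_at[OF this, of "\<lambda>r. f (y + t *\<^sub>R b + r *\<^sub>R b)"] assms
  show ?thesis by (simp add: o_def algebra_simps)
qed

lemma partial_mvt:
  fixes f :: "'a::real_normed_vector \<Rightarrow> real"
  assumes "\<And>s. 0 \<le> s \<Longrightarrow> s \<le> h \<Longrightarrow> has_partial b f (y + s *\<^sub>R b)" "0 < h"
  shows "\<exists>s>0. s < h \<and> f (y + h *\<^sub>R b) - f y = h * partial b f (y + s *\<^sub>R b)"
  using MVT2[OF assms(2), of "\<lambda>s. f (y + s *\<^sub>R b)" "\<lambda>s. partial b f (y + s *\<^sub>R b)"]
    line_derivative[OF assms(1)] by (simp add: has_real_derivative_iff_has_vector_derivative)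

lemma partial_mvt_abs:
  fixes f :: "'a::real_normed_vector \<Rightarrow> real"
  assumes "\<And>s. \<bar>s\<bar> \<le> \<bar>h\<bar> \<Longrightarrow> has_partial b f (y + s *\<^sub>R b)"
  shows "\<exists>s. \<bar>s\<bar> \<le> \<bar>h\<bar> \<and> f (y + h *\<^sub>R b) - f y = h * partial b f (y + s *\<^sub>R b)"
proof -
  consider "h = 0" | "h > 0" | "h < 0" by linarith
  then show ?thesis
  proof cases
    case 1
    then show ?thesis by auto
  next
    case 2
    then obtain s where "s > 0" "s < h" "f (y + h *\<^sub>R b) - f y = h * partial b f (y + s *\<^sub>R b)"
      using partial_mvt[where f=f and h=h and b=b and y=y] assms by auto
    then show ?thesis by (intro exI[of _ s]) auto
  next
    case 3
    have "has_partial b f (y + h *\<^sub>R b + s *\<^sub>R b)" if "0 \<le> s" "s \<le> - h" for s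
      using assms[of "h + s"] that 3 by (simp add: algebra_simps)
    then obtain s where "s > 0" "s < -h" "f (y + h *\<^sub>R b + (-h) *\<^sub>R b) - f (y + h *\<^sub>R b)
        = -h * partial b f (y + h *\<^sub>R b + s *\<^sub>R b)"
      using partial_mvt[where f=f and h="-h" and b=b and y="y + h *\<^sub>R b"] 3 by auto
    then show ?thesis by (intro exI[of _ "h + s"]) (auto simp: algebra_simps)
  qed
qed

text \<open>The second difference is symmetric in \<open>b\<close> and \<open>c\<close>, while the
  mean value theorem, applied first along \<open>b\<close> and then along \<open>c\<close>,
  expresses it through one of the two mixed derivatives. Comparing both orders for small
  \<open>h\<close> gives the symmetry of second partials.\<close>

lemma second_difference_mvt:
  fixes f :: "'a::euclidean_space \<Rightarrow> real"
  assumes f: "C_on 2 S f" and S: "ball x r \<subseteq> S" and bc: "b \<in> Basis" "c \<in> Basis" and h: "0 < h" "2 * h < r"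
  shows "\<exists>y. dist x y < 2 * h \<and> f (x + h *\<^sub>R b + h *\<^sub>R c) - f (x + h *\<^sub>R b) - f (x + h *\<^sub>R c) + f x
    = h\<^sup>2 * partial c (partial b f) y"
proof -
  have dst: "dist x (x + s *\<^sub>R b + t *\<^sub>R c) \<le> \<bar>s\<bar> + \<bar>t\<bar>" for s t
  proof -
    have "dist x (x + s *\<^sub>R b + t *\<^sub>R c) = norm (s *\<^sub>R b + t *\<^sub>R c)"
      by (metis add.assoc add_diff_cancel_left' dist_commute dist_norm)
    then show ?thesis using norm_triangle_ineq[of "s *\<^sub>R b" "t *\<^sub>R c"] bc by simp
  qed
  have inS: "x + s *\<^sub>R b + t *\<^sub>R c \<in> S" if "0 \<le> s" "s \<le> h" "0 \<le> t" "t \<le> h" for s t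
    using dst[of s t] that h S by (auto simp: mem_ball subset_iff)
  have p1: "has_partial b f z" if "z \<in> S" for z using C_on_has_partial[OF f] that bc by auto
  have p2: "has_partial c (partial b f) z" if "z \<in> S" for z
    using C_on_has_partial[of 1 S "partial b f"] C_on_partial[of 1 S f b] f that bc by (simp add: numeral_2_eq_2)
  define g where "g = (\<lambda>y. f (y + h *\<^sub>R c) - f y)"
  have g: "((\<lambda>t. g (x + s *\<^sub>R b + t *\<^sub>R b)) has_vector_derivative
      (partial b f (x + s *\<^sub>R b + h *\<^sub>R c) - partial b f (x + s *\<^sub>R b))) (at 0)"
    if "0 \<le> s" "s \<le> h" for s
    using has_vector_derivative_diff[OF p1[OF inS[of s h]] p1[OF inS[of s 0]]] that h
    by (simp add: g_def add_ac)
  obtain s where s: "s > 0" "s < h" "g (x + h *\<^sub>R b) - g x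
      = h * (partial b f (x + s *\<^sub>R b + h *\<^sub>R c) - partial b f (x + s *\<^sub>R b))"
    using partial_mvt[where f=g and h=h and b=b and y=x] partialI[OF g] h(1) by (metis less_imp_le)
  obtain t where t: "t > 0" "t < h" "partial b f (x + s *\<^sub>R b + h *\<^sub>R c) - partial b f (x + s *\<^sub>R b)
      = h * partial c (partial b f) (x + s *\<^sub>R b + t *\<^sub>R c)"
    using partial_mvt[where f="partial b f" and h=h and b=c and y="x + s *\<^sub>R b"] p2[OF inS] s h(1) by (metis less_imp_le)
  show ?thesis
    using dst[of s t] s t by (intro exI[of _ "x + s *\<^sub>R b + t *\<^sub>R c"])
      (auto simp: g_def power2_eq_square algebra_simps)
qed

lemma partial_commute_real:
  fixes f :: "'a::euclidean_space \<Rightarrow> real"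
  assumes f: "C_on 2 S f" and S: "open S" "x \<in> S" and bc: "b \<in> Basis" "c \<in> Basis"
  shows "partial b (partial c f) x = partial c (partial b f) x"
proof (rule ccontr)
  assume ne: "\<not> ?thesis"
  define e where "e = dist (partial b (partial c f) x) (partial c (partial b f) x) / 2"
  have e: "e > 0" using ne by (simp add: e_def)
  have cont: "continuous_on S (partial b (partial c f))" "continuous_on S (partial c (partial b f))"
    using f bc C_on_continuous by (auto simp: numeral_2_eq_2 C_on_Suc C_on_0)
  obtain r where r: "r > 0" "ball x r \<subseteq> S" using S openE by blast
  obtain d1 where d1: "d1 > 0" "\<And>y. y \<in> S \<Longrightarrow> dist y x < d1 \<Longrightarrow>
      dist (partial b (partial c f) y) (partial b (partial c f) x) < e"
    using cont(1) e S unfolding continuous_on_iff by metis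
  obtain d2 where d2: "d2 > 0" "\<And>y. y \<in> S \<Longrightarrow> dist y x < d2 \<Longrightarrow>
      dist (partial c (partial b f) y) (partial c (partial b f) x) < e"
    using cont(2) e S unfolding continuous_on_iff by metis
  define h where "h = min r (min d1 d2) / 4"
  have h: "0 < h" "2 * h < r" "2 * h < d1" "2 * h < d2" using r d1 d2 by (auto simp: h_def)
  obtain y1 where y1: "dist x y1 < 2 * h" "f (x + h *\<^sub>R b + h *\<^sub>R c) - f (x + h *\<^sub>R b) - f (x + h *\<^sub>R c) + f x
    = h\<^sup>2 * partial c (partial b f) y1"
    using second_difference_mvt[OF f r(2) bc h(1,2)] by blast
  obtain y2 where y2: "dist x y2 < 2 * h" "f (x + h *\<^sub>R c + h *\<^sub>R b) - f (x + h *\<^sub>R c) - f (x + h *\<^sub>R b) + f x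
    = h\<^sup>2 * partial b (partial c f) y2"
    using second_difference_mvt[OF f r(2) bc(2,1) h(1,2)] by blast
  have "h\<^sup>2 * partial c (partial b f) y1 = h\<^sup>2 * partial b (partial c f) y2"
    using y1(2) y2(2) by (simp add: algebra_simps)
  then have "partial c (partial b f) y1 = partial b (partial c f) y2" using h by simp
  moreover have "dist (partial b (partial c f) y2) (partial b (partial c f) x) < e"
    using y2(1) h r by (intro d1(2)) (auto simp: dist_commute subset_iff)
  moreover have "dist (partial c (partial b f) y1) (partial c (partial b f) x) < e"
    using y1(1) h r by (intro d2(2)) (auto simp: dist_commute subset_iff)
  ultimately show False
    using dist_triangle3[of "partial b (partial c f) x" "partial c (partial b f) x" "partial b (partial c f) y2"]
    by (simp add: e_def)
qed

text \<open>The mean value theorem in the form of an equality fails for complex values, so the real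
  statement is applied to real and imaginary part.\<close>

lemma partial_commute:
  fixes f :: "'a::euclidean_space \<Rightarrow> complex"
  assumes f: "C_on 2 S f" and S: "open S" "x \<in> S" and bc: "b \<in> Basis" "c \<in> Basis"
  shows "partial b (partial c f) x = partial c (partial b f) x"
proof -
  have L: "L (partial b (partial c f) x) = L (partial c (partial b f) x)"
    if L: "bounded_linear L" for L :: "complex \<Rightarrow> real"
  proof -
    have 1: "partial b (partial c (\<lambda>x. L (f x))) x = L (partial b (partial c f) x)"
      if bc: "b \<in> Basis" "c \<in> Basis" for b c
    proof -
      have "partial b (partial c (\<lambda>x. L (f x))) x = partial b (\<lambda>x. L (partial c f x)) x"
        using f bc by (intro partial_cong(1)[OF S] partial_bounded_linear(1)[OF L])
          (auto simp: numeral_2_eq_2 C_on_Suc)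
      also have "\<dots> = L (partial b (partial c f) x)"
        using f bc S by (intro partial_bounded_linear(1)[OF L]) (auto simp: numeral_2_eq_2 C_on_Suc)
      finally show ?thesis .
    qed
    show ?thesis
      using partial_commute_real[OF C_on_bounded_linear[OF S(1) L f] S bc] 1[OF bc] 1[OF bc(2,1)] by simp
  qed
  show ?thesis using L[OF bounded_linear_Re] L[OF bounded_linear_Im] by (simp add: complex_eq_iff)
qed

text \<open>\<open>C_on\<close> speaks only of coordinate directions, whereas the boundary arguments
  differentiate along circles and rays. The increment is built up one coordinate at a time, each
  step being a mean value theorem with a continuous partial derivative; the induction halves
  \<open>e\<close>.\<close>

lemma C_on_1_has_derivative:
  fixes f :: "'a::euclidean_space \<Rightarrow> real"
  assumes f: "C_on 1 S f" and S: "open S" "x \<in> S"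
  shows "(f has_derivative (\<lambda>h. \<Sum>b\<in>Basis. (h \<bullet> b) * partial b f x)) (at x)"
proof -
  have main: "\<exists>d>0. \<forall>h. norm h < d \<longrightarrow>
      \<bar>f (x + (\<Sum>b\<in>B. (h \<bullet> b) *\<^sub>R b)) - f x - (\<Sum>b\<in>B. (h \<bullet> b) * partial b f x)\<bar> \<le> e * norm h"
    if "B \<subseteq> Basis" "e > 0" for B e
    using finite_subset[OF that(1) finite_Basis] that
  proof (induction B arbitrary: e rule: finite_induct)
    case empty
    then show ?case by (auto intro!: exI[of _ 1])
  next
    case (insert c B)
    then obtain d where d: "d > 0" "\<And>h. norm h < d \<Longrightarrow>
      \<bar>f (x + (\<Sum>b\<in>B. (h \<bullet> b) *\<^sub>R b)) - f x - (\<Sum>b\<in>B. (h \<bullet> b) * partial b f x)\<bar> \<le> e / 2 * norm h"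
      using insert.IH[of "e / 2"] by auto
    obtain r where r: "r > 0" "ball x r \<subseteq> S" using S openE by blast
    have "continuous_on S (partial c f)"
      using f insert.prems by (auto simp: C_on_Suc C_on_0)
    then obtain d' where d': "d' > 0" "\<And>y. y \<in> S \<Longrightarrow> dist y x < d' \<Longrightarrow>
        dist (partial c f y) (partial c f x) < e / 2"
      using S insert.prems unfolding continuous_on_iff by (metis half_gt_zero)
    \<comment> \<open>Each of the \<open>card B + 1\<close> coordinate moves has length at most
      \<open>norm h\<close>, so every intermediate point stays within \<open>N * norm h\<close> of
      \<open>x\<close>.\<close>
    define N where "N = real (card B) + 1"
    have N: "N > 0" by (simp add: N_def)
    define \<delta> where "\<delta> = min d (min r d' / N)"
    have "\<delta> > 0" using d d' r N by (simp add: \<delta>_def)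
    moreover have "\<bar>f (x + (\<Sum>b\<in>insert c B. (h \<bullet> b) *\<^sub>R b)) - f x - (\<Sum>b\<in>insert c B. (h \<bullet> b) * partial b f x)\<bar>
        \<le> e * norm h" if h: "norm h < \<delta>" for h
    proof -
      let ?y = "x + (\<Sum>b\<in>B. (h \<bullet> b) *\<^sub>R b)"
      have near: "dist (?y + s *\<^sub>R c) x < min r d'" if "\<bar>s\<bar> \<le> \<bar>h \<bullet> c\<bar>" for s
      proof -
        have "norm (\<Sum>b\<in>B. (h \<bullet> b) *\<^sub>R b) \<le> (\<Sum>b\<in>B. norm h)"
          using insert.prems by (intro sum_norm_le) (auto simp: Basis_le_norm subset_iff)
        moreover have "norm (s *\<^sub>R c) \<le> norm h"
          using that insert.prems Basis_le_norm[of c h] by auto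
        ultimately have "dist (?y + s *\<^sub>R c) x \<le> N * norm h"
          using norm_triangle_ineq[of "\<Sum>b\<in>B. (h \<bullet> b) *\<^sub>R b" "s *\<^sub>R c"]
          by (simp add: dist_norm N_def algebra_simps)
        also have "\<dots> < min r d'"
          using h N by (simp add: \<delta>_def less_divide_eq mult.commute)
        finally show ?thesis .
      qed
      then have inS: "?y + s *\<^sub>R c \<in> S" if "\<bar>s\<bar> \<le> \<bar>h \<bullet> c\<bar>" for s
        using near[OF that] r(2) by (auto simp: dist_commute subset_iff)
      have "has_partial c f (?y + s *\<^sub>R c)" if "\<bar>s\<bar> \<le> \<bar>h \<bullet> c\<bar>" for s
        using C_on_has_partial[OF f] inS[OF that] insert.prems by auto
      then obtain s where s: "\<bar>s\<bar> \<le> \<bar>h \<bullet> c\<bar>" "f (?y + (h \<bullet> c) *\<^sub>R c) - f ?y = (h \<bullet> c) * partial c f (?y + s *\<^sub>R c)"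
        using partial_mvt_abs[where f=f and h="h \<bullet> c" and b=c and y="?y"] by blast
      have "\<bar>partial c f (?y + s *\<^sub>R c) - partial c f x\<bar> \<le> e / 2"
        using d'(2)[OF inS[OF s(1)]] near[OF s(1)] by (simp add: dist_real_def)
      then have "\<bar>h \<bullet> c\<bar> * \<bar>partial c f (?y + s *\<^sub>R c) - partial c f x\<bar> \<le> norm h * (e / 2)"
        using insert.prems by (intro mult_mono) (auto simp: Basis_le_norm)
      then have "\<bar>(h \<bullet> c) * (partial c f (?y + s *\<^sub>R c) - partial c f x)\<bar> \<le> e / 2 * norm h"
        by (simp add: abs_mult mult.commute)
      moreover have "\<bar>f ?y - f x - (\<Sum>b\<in>B. (h \<bullet> b) * partial b f x)\<bar> \<le> e / 2 * norm h"
        using h by (intro d(2)) (simp add: \<delta>_def)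
      moreover have eq: "f (x + (\<Sum>b\<in>insert c B. (h \<bullet> b) *\<^sub>R b)) - f x - (\<Sum>b\<in>insert c B. (h \<bullet> b) * partial b f x)
        = (f ?y - f x - (\<Sum>b\<in>B. (h \<bullet> b) * partial b f x)) + (h \<bullet> c) * (partial c f (?y + s *\<^sub>R c) - partial c f x)"
        using insert.hyps s(2) by (simp add: algebra_simps)
      ultimately show ?thesis
        unfolding eq by (intro order_trans[OF abs_triangle_ineq]) linarith
    qed
    ultimately show ?case by blast
  qed
  have bl: "bounded_linear (\<lambda>h. \<Sum>b\<in>Basis. (h \<bullet> b) * partial b f x)"
    by (intro bounded_linear_sum bounded_linear_mult_const bounded_linear_inner_left)
  show ?thesis
    unfolding has_derivative_at_alt
  proof (intro conjI bl allI impI)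
    fix e :: real assume "e > 0"
    from main[OF subset_refl this] obtain d where d: "d > 0" "\<And>h. norm h < d \<Longrightarrow>
      \<bar>f (x + h) - f x - (\<Sum>b\<in>Basis. (h \<bullet> b) * partial b f x)\<bar> \<le> e * norm h"
      by (auto simp: euclidean_representation)
    show "\<exists>d>0. \<forall>y. norm (y - x) < d \<longrightarrow>
        norm (f y - f x - (\<Sum>b\<in>Basis. ((y - x) \<bullet> b) * partial b f x)) \<le> e * norm (y - x)"
      using d(1) d(2)[of "y - x" for y] by (intro exI[of _ d]) auto
  qed
qed

lemma difference_quotient_tendsto:
  fixes f :: "real \<Rightarrow> 'a::real_normed_vector"
  assumes "(f has_vector_derivative D) (at 0)"
  shows "((\<lambda>t. (f t - f 0) /\<^sub>R t) \<longlongrightarrow> D) (at 0)"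
proof -
  have "((\<lambda>t. norm ((f t - f 0 - t *\<^sub>R D) /\<^sub>R \<bar>t\<bar>)) \<longlongrightarrow> 0) (at 0)"
    using assms by (intro tendsto_norm_zero) (simp add: has_vector_derivative_def has_derivative_def)
  moreover have "norm ((f t - f 0 - t *\<^sub>R D) /\<^sub>R \<bar>t\<bar>) = norm ((f t - f 0) /\<^sub>R t - D)" if "t \<noteq> 0" for t
  proof -
    have "(f t - f 0) /\<^sub>R t - D = (f t - f 0 - t *\<^sub>R D) /\<^sub>R t"
      using that by (simp add: scaleR_diff_right)
    then show ?thesis by simp
  qed
  then have "\<forall>\<^sub>F t in at 0. norm ((f t - f 0 - t *\<^sub>R D) /\<^sub>R \<bar>t\<bar>) = norm ((f t - f 0) /\<^sub>R t - D)"
    by (auto simp: eventually_at_filter)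
  ultimately have "((\<lambda>t. norm ((f t - f 0) /\<^sub>R t - D)) \<longlongrightarrow> 0) (at 0)"
    by (rule Lim_transform_eventually)
  then show ?thesis by (simp only: tendsto_norm_zero_iff LIM_zero_iff)
qed

text \<open>By translation invariance the integral of the difference quotients vanishes, so no
  integration by parts along coordinate lines is needed.\<close>

lemma integral_partial_eq_0:
  fixes G :: "'a::euclidean_space \<Rightarrow> complex"
  assumes S: "open S" and G: "C_on 1 S G" and K: "compact K" "K \<subseteq> S"
    and G0: "\<And>z. z \<in> S - K \<Longrightarrow> G z = 0" and b: "b \<in> Basis"
  shows "(LINT z:K|lborel. partial b G z) = 0"
proof -
  define F where "F = (\<lambda>z. indicator K z *\<^sub>R G z)"
  define F' where "F' = (\<lambda>z. indicator K z *\<^sub>R partial b G z)"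
  have opK: "open (- K)" using K by (simp add: compact_imp_closed open_Compl)
  \<comment> \<open>\<open>G\<close> vanishes on the open set \<open>S - K\<close>, hence so does
    its derivative there, and cutting off outside \<open>K\<close> changes nothing on
    \<open>S\<close>.\<close>
  have F'S: "F' z = partial b G z" if "z \<in> S" for z
  proof (cases "z \<in> K")
    case False
    have "partial b G z = partial b (\<lambda>_. 0) z"
      by (rule partial_cong(1)[of "S \<inter> - K"]) (use S opK that False G0 in auto)
    then show ?thesis using False by (simp add: F'_def)
  qed (simp add: F'_def)
  have FS: "F z = G z" if "z \<in> S" for z using that G0 by (auto simp: F_def indicator_def)
  have Fd: "((\<lambda>t. F (z + t *\<^sub>R b)) has_vector_derivative F' z) (at 0)" for z
  proof (cases "z \<in> S")
    case True
    show ?thesis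
      by (rule line_derivative_cong[OF S True, of G])
        (use C_on_has_partial[OF G _ True b] FS F'S True in auto)
  next
    case False
    then have "z \<notin> K" using K by auto
    then show ?thesis
      by (intro line_derivative_cong[OF opK, of z "\<lambda>_. 0" F b "F' z"]) (auto simp: F_def F'_def)
  qed
  have contF: "continuous_on UNIV F"
  proof -
    have "continuous_on (S \<union> - K) F"
      using C_on_continuous[OF G] FS S opK
      by (intro continuous_on_open_Un) (auto simp: F_def cong: continuous_on_cong intro: continuous_on_eq[where f = "\<lambda>_. 0"])
    moreover have "S \<union> - K = UNIV" using K by auto
    ultimately show ?thesis by simp
  qed
  have contF': "continuous_on UNIV F'"
  proof -
    have "continuous_on S (partial b G)" using G b by (auto simp: C_on_Suc C_on_0)
    then have "continuous_on (S \<union> - K) F'"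
      using F'S S opK
      by (intro continuous_on_open_Un) (auto simp: F'_def cong: continuous_on_cong intro: continuous_on_eq[where f = "\<lambda>_. 0"])
    moreover have "S \<union> - K = UNIV" using K by auto
    ultimately show ?thesis by simp
  qed
  obtain r where r: "r > 0" "K \<subseteq> ball 0 r"
    using bounded_subset_ballD[OF compact_imp_bounded[OF K(1)]] by blast
  have "bounded (F' ` cball 0 r)"
    by (intro compact_imp_bounded compact_continuous_image continuous_on_subset[OF contF']) auto
  then obtain M where M0: "\<And>z. z \<in> cball 0 r \<Longrightarrow> norm (F' z) \<le> M" "M > 0"
    unfolding bounded_pos by blast
  have M: "norm (F' z) \<le> M" for z
  proof (cases "z \<in> K")
    case True
    then show ?thesis using M0(1)[of z] r by auto
  qed (use M0 in \<open>simp add: F'_def\<close>)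
  have intF: "integrable lborel F"
    unfolding F_def by (rule borel_integrable_compact[OF K(1) continuous_on_subset[OF C_on_continuous[OF G] K(2)]])
  have transl: "(LINT z|lborel. F (z + c)) = (LINT z|lborel. F z)" "integrable lborel (\<lambda>z. F (z + c))" for c
  proof -
    have m: "(+) c \<in> borel_measurable lborel" by simp
    have "(LINT z|distr lborel borel ((+) c). F z) = (LINT z|lborel. F (c + z))"
      using borel_measurable_integrable[OF intF] by (subst integral_distr) auto
    then show "(LINT z|lborel. F (z + c)) = (LINT z|lborel. F z)"
      by (simp add: lborel_distr_plus add.commute)
    have "integrable (distr lborel borel ((+) c)) F" using intF by (simp add: lborel_distr_plus)
    then show "integrable lborel (\<lambda>z. F (z + c))"
      using borel_measurable_integrable[OF intF] by (subst (asm) integrable_distr_eq) (auto simp: add.commute)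
  qed
  define h where "h = (\<lambda>n. 1 / real (Suc n))"
  have h: "0 < h n" "h n \<le> 1" for n by (auto simp: h_def)
  have hlim: "filterlim h (at 0) sequentially"
    unfolding filterlim_at using h LIMSEQ_inverse_real_of_nat
    by (auto simp: h_def inverse_eq_divide less_imp_neq[symmetric] intro!: always_eventually)
  \<comment> \<open>Because \<open>h n\<close> is at most 1 and \<open>b\<close> is a unit vector,
    every quotient is supported in the ball of radius \<open>r + 1\<close>; with the bound
    \<open>M\<close> on the derivative this gives the dominating function.\<close>
  define Q where "Q = (\<lambda>n z. (F (z + h n *\<^sub>R b) - F z) /\<^sub>R h n)"
  have "(\<lambda>n. LINT z|lborel. Q n z) \<longlonglongrightarrow> (LINT z|lborel. F' z)"
  proof (rule integral_dominated_convergence[where w = "\<lambda>z. indicator (cball 0 (r + 1)) z *\<^sub>R M"])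
    show "F' \<in> borel_measurable lborel"
      using borel_measurable_continuous_onI[OF contF'] by simp
    show "Q n \<in> borel_measurable lborel" for n
      unfolding Q_def using transl(2) intF by (intro borel_measurable_scaleR borel_measurable_diff borel_measurable_integrable) auto
    show "integrable lborel (\<lambda>z. indicator (cball 0 (r + 1)) z *\<^sub>R M)"
      by (intro borel_integrable_compact) auto
    have lim: "(\<lambda>n. Q n z) \<longlonglongrightarrow> F' z" for z
    proof -
      have "((\<lambda>t. (F (z + t *\<^sub>R b) - F z) /\<^sub>R t) \<longlongrightarrow> F' z) (at 0)"
        using difference_quotient_tendsto[OF Fd[of z]] by simp
      from filterlim_compose[OF this hlim] show ?thesis by (simp add: Q_def)
    qed
    then show "AE z in lborel. (\<lambda>n. Q n z) \<longlonglongrightarrow> F' z" by simp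
    have "norm (Q n z) \<le> indicator (cball 0 (r + 1)) z *\<^sub>R M" for n z
    proof (cases "z \<in> cball 0 (r + 1)")
      case True
      have "\<exists>s\<in>{0<..<h n}. norm (F (z + h n *\<^sub>R b) - F (z + 0 *\<^sub>R b)) \<le> norm ((h n - 0) *\<^sub>R F' (z + s *\<^sub>R b))"
      proof (rule mvt_general[of 0 "h n" "\<lambda>s. F (z + s *\<^sub>R b)" "\<lambda>s y. y *\<^sub>R F' (z + s *\<^sub>R b)"])
        show "continuous_on {0..h n} (\<lambda>s. F (z + s *\<^sub>R b))"
          by (intro continuous_on_compose2[OF contF] continuous_intros) auto
        fix s
        have "has_partial b F (z + s *\<^sub>R b)" "partial b F (z + s *\<^sub>R b) = F' (z + s *\<^sub>R b)"
          using partialI[OF Fd[of "z + s *\<^sub>R b"]] by auto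
        then show "((\<lambda>s. F (z + s *\<^sub>R b)) has_derivative (\<lambda>y. y *\<^sub>R F' (z + s *\<^sub>R b))) (at s)"
          using line_derivative[where f=F and b=b and y=z and t=s] by (simp add: has_vector_derivative_def)
      qed (use h in auto)
      then obtain s where "norm (F (z + h n *\<^sub>R b) - F z) \<le> h n * norm (F' (z + s *\<^sub>R b))"
        using h[of n] by auto
      also have "\<dots> \<le> h n * M" using h[of n] M by (intro mult_left_mono) auto
      finally have le: "norm (F (z + h n *\<^sub>R b) - F z) \<le> h n * M" .
      have "norm (Q n z) = norm (F (z + h n *\<^sub>R b) - F z) / h n"
        using h(1)[of n] by (simp add: Q_def divide_inverse mult.commute)
      also have "\<dots> \<le> M" using le h(1)[of n] by (simp add: pos_divide_le_eq mult.commute)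
      finally show ?thesis using True by simp
    next
      case False
      have "norm (z + h n *\<^sub>R b) \<ge> norm z - 1"
        using norm_triangle_ineq4[of "z + h n *\<^sub>R b" "h n *\<^sub>R b"] h[of n] b by auto
      then have "z + h n *\<^sub>R b \<notin> K" "z \<notin> K" using False r by (auto simp: subset_iff)
      then show ?thesis using False by (simp add: Q_def F_def)
    qed
    then show "AE z in lborel. norm (Q n z) \<le> indicator (cball 0 (r + 1)) z *\<^sub>R M" for n by simp
  qed
  moreover have "(LINT z|lborel. Q n z) = 0" for n
    unfolding Q_def using transl intF by simp
  ultimately have "(LINT z|lborel. F' z) = 0" by (simp add: LIMSEQ_const_iff)
  then show ?thesis by (simp add: F'_def set_lebesgue_integral_def)
qed

section \<open>Wirtinger derivatives and the divergence structure\<close>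

text \<open>With \<open>c\<close> equal to minus or plus the imaginary unit this is the derivative
  in z^i or in its conjugate; the calculus is thereby done once for both.\<close>

definition wirt :: "complex \<Rightarrow> 'n::finite \<Rightarrow> (complex ^ 'n \<Rightarrow> complex) \<Rightarrow> complex ^ 'n \<Rightarrow> complex" where
  "wirt c i f z = (partial (axis i 1) f z + c * partial (axis i \<i>) f z) / 2"

lemma d_z_eq_wirt: "d_z i = wirt (- \<i>) i" and d_zbar_eq_wirt: "d_zbar i = wirt \<i> i"
  by (simp_all add: fun_eq_iff d_z_def d_zbar_def wirt_def)

lemma axis_Basis: "axis i (1::complex) \<in> Basis" "axis i \<i> \<in> Basis"
  by (simp_all add: Basis_complex_def)

lemma wirt_cong:
  assumes "open S" "z \<in> S" "\<And>y. y \<in> S \<Longrightarrow> f y = g y"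
  shows "wirt c i f z = wirt c i g z"
  using partial_cong(1)[OF assms] by (simp add: wirt_def)

lemma C_on_wirt:
  assumes "open S" "C_on (Suc m) S f"
  shows "C_on m S (wirt c i f)"
proof -
  have "C_on m S (\<lambda>z. (partial (axis i 1) f z + c * partial (axis i \<i>) f z) * (1 / 2))"
    using assms by (intro C_on_add C_on_mult C_on_const C_on_partial axis_Basis)
  moreover have "wirt c i f = (\<lambda>z. (partial (axis i 1) f z + c * partial (axis i \<i>) f z) * (1 / 2))"
    by (simp add: wirt_def fun_eq_iff)
  ultimately show ?thesis by simp
qed

lemma wirt_add:
  assumes "C_on 1 S f" "C_on 1 S g" "z \<in> S"
  shows "wirt c i (\<lambda>z. f z + g z) z = wirt c i f z + wirt c i g z"
  using partial_add(1)[OF C_on_has_partial[OF assms(1) _ assms(3)] C_on_has_partial[OF assms(2) _ assms(3)]]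
  by (simp add: wirt_def axis_Basis add_divide_distrib distrib_left)

lemma wirt_mult:
  assumes "C_on 1 S f" "C_on 1 S g" "z \<in> S"
  shows "wirt c i (\<lambda>z. f z * g z) z = wirt c i f z * g z + f z * wirt c i g z"
  using partial_mult(1)[OF C_on_has_partial[OF assms(1) _ assms(3)] C_on_has_partial[OF assms(2) _ assms(3)]]
  by (simp add: wirt_def axis_Basis add_divide_distrib algebra_simps)

lemma wirt_const: "wirt c i (\<lambda>_. a) z = 0"
  by (simp add: wirt_def)

lemma wirt_prod:
  assumes S: "open S" and f: "\<And>a. a \<in> A \<Longrightarrow> C_on 1 S (f a)" and z: "z \<in> S" and A: "finite A"
  shows "wirt c i (\<lambda>z. \<Prod>a\<in>A. f a z) z = (\<Sum>a\<in>A. wirt c i (f a) z * (\<Prod>b\<in>A - {a}. f b z))"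
  using A f
proof (induction A rule: finite_induct)
  case empty
  then show ?case by (simp add: wirt_const)
next
  case (insert a A)
  have "wirt c i (\<lambda>z. f a z * (\<Prod>a\<in>A. f a z)) z
      = wirt c i (f a) z * (\<Prod>a\<in>A. f a z) + f a z * wirt c i (\<lambda>z. \<Prod>a\<in>A. f a z) z"
    using insert.prems by (intro wirt_mult[OF _ _ z] C_on_prod S) auto
  also have "wirt c i (\<lambda>z. \<Prod>a\<in>A. f a z) z = (\<Sum>a\<in>A. wirt c i (f a) z * (\<Prod>b\<in>A - {a}. f b z))"
    using insert by auto
  also have "f a z * \<dots> = (\<Sum>b\<in>A. wirt c i (f b) z * (\<Prod>b\<in>insert a A - {b}. f b z))"
    unfolding sum_distrib_left
  proof (intro sum.cong refl)
    fix b assume b: "b \<in> A"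
    then have "insert a A - {b} = insert a (A - {b})" using insert by auto
    then show "f a z * (wirt c i (f b) z * (\<Prod>b\<in>A - {b}. f b z)) = wirt c i (f b) z * (\<Prod>b\<in>insert a A - {b}. f b z)"
      using insert by simp
  qed
  finally show ?case using insert by simp
qed

lemma partial_wirt:
  assumes f: "C_on 2 S f" and z: "z \<in> S" and b: "b \<in> Basis" and S: "open S"
  shows "partial b (wirt c i f) z = wirt c i (partial b f) z"
proof -
  have hp: "has_partial b (partial (axis i a) f) z" if "axis i a \<in> Basis" for a :: complex
    using C_on_has_partial[of 1 S "partial (axis i a) f" z b] C_on_partial[of 1 S f] f that z b
    by (simp add: numeral_2_eq_2)
  have bl: "bounded_linear (\<lambda>x. a * x / 2)" for a :: complex
    by (rule bounded_linear_compose[OF bounded_linear_divide bounded_linear_mult_right])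
  have "partial b (wirt c i f) z = partial b (\<lambda>z. 1 * partial (axis i 1) f z / 2 + c * partial (axis i \<i>) f z / 2) z"
    by (intro arg_cong[where f = "\<lambda>g. partial b g z"]) (simp add: fun_eq_iff wirt_def add_divide_distrib)
  also have "\<dots> = 1 * partial b (partial (axis i 1) f) z / 2 + c * partial b (partial (axis i \<i>) f) z / 2"
    using partial_add(1)[OF partial_bounded_linear(2)[OF bl[of 1] hp[OF axis_Basis(1)]]
        partial_bounded_linear(2)[OF bl[of c] hp[OF axis_Basis(2)]]]
      partial_bounded_linear(1)[OF bl[of 1] hp[OF axis_Basis(1)]]
      partial_bounded_linear(1)[OF bl[of c] hp[OF axis_Basis(2)]] by simp
  also have "\<dots> = wirt c i (partial b f) z"
    using partial_commute[OF f S z b] by (simp add: wirt_def add_divide_distrib axis_Basis)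
  finally show ?thesis .
qed

lemma wirt_commute:
  assumes "C_on 2 S f" "open S" "z \<in> S"
  shows "wirt c i (wirt d j f) z = wirt d j (wirt c i f) z"
proof -
  have f1: "C_on 1 S (partial b f)" if "b \<in> Basis" for b
    using C_on_partial[of 1 S f b] assms that by (simp add: numeral_2_eq_2)
  have hp: "has_partial a (partial b f) z" if "a \<in> Basis" "b \<in> Basis" for a b
    using C_on_has_partial[OF f1[OF that(2)]] assms that by auto
  have 1: "wirt d j (wirt c i f) z = (wirt c i (partial (axis j 1) f) z + d * wirt c i (partial (axis j \<i>) f) z) / 2"
    for c d i j
    by (simp add: wirt_def[of d j "wirt c i f"] partial_wirt[OF assms(1,3) _ assms(2)] axis_Basis)
  show ?thesis
    unfolding 1 using partial_commute[OF assms, of "axis i _" "axis j _"]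
    by (simp add: wirt_def axis_Basis field_simps)
qed

lemma integral_wirt_eq_0:
  assumes S: "open S" and G: "C_on 1 S G" and K: "compact K" "K \<subseteq> S"
    and G0: "\<And>z. z \<in> S - K \<Longrightarrow> G z = 0"
  shows "(LINT z:K|lborel. wirt c i G z) = 0"
proof -
  have int: "set_integrable lborel K (partial b G)" if "b \<in> Basis" for b
    unfolding set_integrable_def
    using C_on_partial[of 0 S G b] G that K
    by (intro borel_integrable_compact) (auto simp: C_on_0 intro: continuous_on_subset)
  have 0: "(LINT z:K|lborel. partial b G z) = 0" if "b \<in> Basis" for b
    by (rule integral_partial_eq_0[OF S G K G0 that])
  have "(LINT z:K|lborel. wirt c i G z) = ((LINT z:K|lborel. partial (axis i 1) G z) + c * (LINT z:K|lborel. partial (axis i \<i>) G z)) / 2"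
    using int[of "axis i 1"] int[of "axis i \<i>"]
    by (simp add: wirt_def axis_Basis set_integral_add)
  then show ?thesis using 0 by (simp add: axis_Basis)
qed

section \<open>Divergence-freeness of the polarized operator\<close>

definition hess :: "(complex ^ 'n \<Rightarrow> complex) \<Rightarrow> complex ^ 'n \<Rightarrow> 'n::finite \<Rightarrow> 'n \<Rightarrow> complex" where
  "hess u z i j = wirt (- \<i>) i (wirt \<i> j u) z"

lemma complex_Hessian_eq_hess: "complex_Hessian u z $ i $ j = hess (\<lambda>w. complex_of_real (u w)) z i j"
  by (simp add: complex_Hessian_def hess_def d_z_eq_wirt d_zbar_eq_wirt)

lemma C_on_hess: "open S \<Longrightarrow> C_on (Suc (Suc m)) S u \<Longrightarrow> C_on m S (\<lambda>z. hess u z i j)"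
  unfolding hess_def using C_on_wirt by blast

text \<open>Differentiating the factors \<open>hess u\<close> produces third derivatives of
  \<open>u\<close> that are symmetric in the column indices \<open>J 0\<close> and
  \<open>J a\<close>; these vanish under the antisymmetric sum. This is the divergence-freeness of
  the coefficients of the linearized operator.\<close>

lemma divergence_right:
  assumes S: "open S" and u: "C_on 3 S u" and f: "C_on 1 S f" and g: "C_on 2 S g" and x: "x \<in> S"
  shows "ksum k (\<lambda>I J. wirt \<i> (J 0) (\<lambda>z. f z * wirt (-\<i>) (I 0) g z * (\<Prod>a\<in>{1..<k}. hess u z (I a) (J a))) x)
    = polar_S k (\<lambda>i j. wirt \<i> j f x * wirt (-\<i>) i g x) (hess u x) + f x * polar_S k (hess g x) (hess u x)"
proof -
  have g1: "C_on 1 S (wirt c i g)" for c i using C_on_wirt[OF S, of 1 g] g by (simp add: numeral_2_eq_2)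
  have h1: "C_on 1 S (\<lambda>z. hess u z i j)" for i j using C_on_hess[OF S, of 1 u] u by (simp add: numeral_3_eq_3)
  have u2: "C_on 2 S u" using C_on_mono[OF u] by simp
  have w2: "C_on 2 S (wirt c i u)" for c i using C_on_wirt[OF S, of 2 u] u by (simp add: numeral_3_eq_3 numeral_2_eq_2)
  let ?P = "\<lambda>I J z. \<Prod>a\<in>{1..<k}. hess u z (I a) (J a)"
  let ?T = "\<lambda>a I J. f x * wirt (-\<i>) (I 0) g x * (wirt \<i> (J 0) (\<lambda>z. hess u z (I a) (J a)) x *
      (\<Prod>b\<in>{1..<k} - {a}. hess u x (I b) (J b)))"
  have e: "wirt \<i> (J 0) (\<lambda>z. f z * wirt (-\<i>) (I 0) g z * ?P I J z) x
      = wirt \<i> (J 0) f x * wirt (-\<i>) (I 0) g x * ?P I J x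
        + f x * (hess g x (I 0) (J 0) * ?P I J x)
        + (\<Sum>a\<in>{1..<k}. ?T a I J)" for I J :: "nat \<Rightarrow> 'a"
  proof -
    have "wirt \<i> (J 0) (\<lambda>z. f z * wirt (-\<i>) (I 0) g z * ?P I J z) x
      = (wirt \<i> (J 0) f x * wirt (-\<i>) (I 0) g x + f x * wirt \<i> (J 0) (wirt (-\<i>) (I 0) g) x) * ?P I J x
       + f x * wirt (-\<i>) (I 0) g x * wirt \<i> (J 0) (?P I J) x"
      using f g1 h1 S x by (simp only: wirt_mult[of S] C_on_mult C_on_prod)
    also have "wirt \<i> (J 0) (wirt (-\<i>) (I 0) g) x = hess g x (I 0) (J 0)"
      unfolding hess_def by (rule wirt_commute[OF g S x])
    also have "wirt \<i> (J 0) (?P I J) x = (\<Sum>a\<in>{1..<k}. wirt \<i> (J 0) (\<lambda>z. hess u z (I a) (J a)) x *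
      (\<Prod>b\<in>{1..<k} - {a}. hess u x (I b) (J b)))"
      by (rule wirt_prod[OF S h1 x]) simp
    finally show ?thesis by (simp add: algebra_simps sum_distrib_left)
  qed
  have sym: "wirt \<i> j' (\<lambda>z. hess u z i j) x = wirt \<i> j (\<lambda>z. hess u z i j') x" for i j j'
  proof -
    have "wirt \<i> j' (\<lambda>z. hess u z i j) x = wirt (-\<i>) i (wirt \<i> j' (wirt \<i> j u)) x" for j j'
      unfolding hess_def by (rule wirt_commute[OF w2 S x])
    moreover have "wirt (-\<i>) i (wirt \<i> j' (wirt \<i> j u)) x = wirt (-\<i>) i (wirt \<i> j (wirt \<i> j' u)) x"
      by (intro wirt_cong[OF S x] wirt_commute[OF u2 S])
    ultimately show ?thesis by simp
  qed
  have "ksum k (?T a) = 0" if a: "a \<in> {1..<k}" for a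
  proof (rule ksum_eq_0_right[of 0 k a])
    fix I J :: "nat \<Rightarrow> 'a"
    have "(\<Prod>b\<in>{1..<k} - {a}. hess u x (I b) ((J \<circ> Transposition.transpose 0 a) b))
        = (\<Prod>b\<in>{1..<k} - {a}. hess u x (I b) (J b))"
      by (intro prod.cong) (auto simp: Transposition.transpose_def)
    then show "?T a I (J \<circ> Transposition.transpose 0 a) = ?T a I J"
      using sym[of "J a" "I a" "J 0"] by simp
  qed (use a in auto)
  then show ?thesis unfolding e by (simp add: ksum_add ksum_sum ksum_cmult polar_S_def)
qed

text \<open>The mirror image, with rows and columns exchanged. Testing U with the cutoff times its
  dilation derivative V on the right, and V with the cutoff times U on the left, yields the same
  quadratic term in the gradients, which cancels in the difference.\<close>

lemma divergence_left:
  assumes S: "open S" and u: "C_on 3 S u" and f: "C_on 1 S f" and g: "C_on 2 S g" and x: "x \<in> S"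
  shows "ksum k (\<lambda>I J. wirt (-\<i>) (I 0) (\<lambda>z. f z * wirt \<i> (J 0) g z * (\<Prod>a\<in>{1..<k}. hess u z (I a) (J a))) x)
    = polar_S k (\<lambda>i j. wirt (-\<i>) i f x * wirt \<i> j g x) (hess u x) + f x * polar_S k (hess g x) (hess u x)"
proof -
  have g1: "C_on 1 S (wirt c i g)" for c i using C_on_wirt[OF S, of 1 g] g by (simp add: numeral_2_eq_2)
  have h1: "C_on 1 S (\<lambda>z. hess u z i j)" for i j using C_on_hess[OF S, of 1 u] u by (simp add: numeral_3_eq_3)
  have w2: "C_on 2 S (wirt c i u)" for c i using C_on_wirt[OF S, of 2 u] u by (simp add: numeral_3_eq_3 numeral_2_eq_2)
  let ?P = "\<lambda>I J z. \<Prod>a\<in>{1..<k}. hess u z (I a) (J a)"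
  let ?T = "\<lambda>a I J. f x * wirt \<i> (J 0) g x * (wirt (-\<i>) (I 0) (\<lambda>z. hess u z (I a) (J a)) x *
      (\<Prod>b\<in>{1..<k} - {a}. hess u x (I b) (J b)))"
  have e: "wirt (-\<i>) (I 0) (\<lambda>z. f z * wirt \<i> (J 0) g z * ?P I J z) x
      = wirt (-\<i>) (I 0) f x * wirt \<i> (J 0) g x * ?P I J x
        + f x * (hess g x (I 0) (J 0) * ?P I J x)
        + (\<Sum>a\<in>{1..<k}. ?T a I J)" for I J :: "nat \<Rightarrow> 'a"
  proof -
    have "wirt (-\<i>) (I 0) (\<lambda>z. f z * wirt \<i> (J 0) g z * ?P I J z) x
      = (wirt (-\<i>) (I 0) f x * wirt \<i> (J 0) g x + f x * wirt (-\<i>) (I 0) (wirt \<i> (J 0) g) x) * ?P I J x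
       + f x * wirt \<i> (J 0) g x * wirt (-\<i>) (I 0) (?P I J) x"
      using f g1 h1 S x by (simp only: wirt_mult[of S] C_on_mult C_on_prod)
    also have "wirt (-\<i>) (I 0) (wirt \<i> (J 0) g) x = hess g x (I 0) (J 0)"
      by (simp only: hess_def)
    also have "wirt (-\<i>) (I 0) (?P I J) x = (\<Sum>a\<in>{1..<k}. wirt (-\<i>) (I 0) (\<lambda>z. hess u z (I a) (J a)) x *
      (\<Prod>b\<in>{1..<k} - {a}. hess u x (I b) (J b)))"
      by (rule wirt_prod[OF S h1 x]) simp
    finally show ?thesis by (simp add: algebra_simps sum_distrib_left)
  qed
  have sym: "wirt (-\<i>) i' (\<lambda>z. hess u z i j) x = wirt (-\<i>) i (\<lambda>z. hess u z i' j) x" for i j i'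
    unfolding hess_def by (rule wirt_commute[OF w2 S x])
  have "ksum k (?T a) = 0" if a: "a \<in> {1..<k}" for a
  proof (rule ksum_eq_0_left[of 0 k a])
    fix I J :: "nat \<Rightarrow> 'a"
    have "(\<Prod>b\<in>{1..<k} - {a}. hess u x ((I \<circ> Transposition.transpose 0 a) b) (J b))
        = (\<Prod>b\<in>{1..<k} - {a}. hess u x (I b) (J b))"
      by (intro prod.cong) (auto simp: Transposition.transpose_def)
    then show "?T a (I \<circ> Transposition.transpose 0 a) J = ?T a I J"
      using sym[of "I a" "I 0" "J a"] by simp
  qed (use a in auto)
  then show ?thesis unfolding e by (simp add: ksum_add ksum_sum ksum_cmult polar_S_def)
qed

text \<open>The generator of real dilations, which acts on both z and its conjugate; it therefore
  keeps real-valued functions real-valued.\<close>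

definition euler :: "('a::euclidean_space \<Rightarrow> complex) \<Rightarrow> 'a \<Rightarrow> complex" where
  "euler f z = (\<Sum>b\<in>Basis. of_real (z \<bullet> b) * partial b f z)"

lemma bounded_linear_coordinate: "bounded_linear (\<lambda>z. complex_of_real (z \<bullet> b))"
  by (rule bounded_linear_compose[OF bounded_linear_of_real bounded_linear_inner_left])

lemma C_on_euler: "open S \<Longrightarrow> C_on (Suc m) S f \<Longrightarrow> C_on m S (euler f)"
  unfolding euler_def
  by (intro C_on_sum C_on_mult C_on_linear[OF bounded_linear_coordinate] C_on_partial)

lemma euler_cong:
  assumes "open S" "z \<in> S" "\<And>y. y \<in> S \<Longrightarrow> f y = g y"
  shows "euler f z = euler g z"
  using partial_cong(1)[OF assms] by (simp add: euler_def)

lemma partial_euler: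
  assumes S: "open S" and f: "C_on 2 S f" and z: "z \<in> S" and c: "c \<in> Basis"
  shows "partial c (euler f) z = partial c f z + euler (partial c f) z"
proof -
  have hp: "has_partial c (partial b f) z" if "b \<in> Basis" for b
    using C_on_has_partial[of 1 S "partial b f" z c] C_on_partial[of 1 S f b] f that z c
    by (simp add: numeral_2_eq_2)
  note l = partial_linear[OF bounded_linear_coordinate]
  have "partial c (euler f) z = (\<Sum>b\<in>Basis. partial c (\<lambda>z. of_real (z \<bullet> b) * partial b f z) z)"
    unfolding euler_def by (intro partial_sum partial_mult(2) l(2) hp)
  also have "\<dots> = (\<Sum>b\<in>Basis. of_real (c \<bullet> b) * partial b f z + of_real (z \<bullet> b) * partial c (partial b f) z)"
    by (intro sum.cong refl) (simp add: partial_mult(1)[OF l(2) hp] l(1))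
  also have "\<dots> = (\<Sum>b\<in>Basis. of_real (c \<bullet> b) * partial b f z) + (\<Sum>b\<in>Basis. of_real (z \<bullet> b) * partial b (partial c f) z)"
    unfolding sum.distrib using partial_commute[OF f S z c] by (intro arg_cong2[where f = "(+)"] sum.cong) auto
  also have "(\<Sum>b\<in>Basis. of_real (c \<bullet> b) * partial b f z) = (\<Sum>b\<in>{c}. partial b f z)"
    by (rule sum.mono_neutral_cong_right) (use c in \<open>auto simp: inner_Basis\<close>)
  finally show ?thesis unfolding euler_def by simp
qed

lemma euler_wirt_linear:
  assumes f: "C_on 2 S f" and S: "open S" and z: "z \<in> S"
  shows "euler (wirt c i f) z = (euler (partial (axis i 1) f) z + c * euler (partial (axis i \<i>) f) z) / 2"
proof -
  have "euler (wirt c i f) z = (\<Sum>b\<in>Basis. of_real (z \<bullet> b) * wirt c i (partial b f) z)"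
    unfolding euler_def using partial_wirt[OF f z _ S] by simp
  also have "\<dots> = (\<Sum>b\<in>Basis. (of_real (z \<bullet> b) * partial b (partial (axis i 1) f) z
      + c * (of_real (z \<bullet> b) * partial b (partial (axis i \<i>) f) z)) / 2)"
    using partial_commute[OF f S z] by (intro sum.cong refl) (simp add: wirt_def axis_Basis algebra_simps)
  finally show ?thesis
    by (simp add: euler_def sum.distrib sum_distrib_left sum_divide_distrib[symmetric])
qed

lemma wirt_euler:
  assumes S: "open S" and f: "C_on 2 S f" and z: "z \<in> S"
  shows "wirt c i (euler f) z = wirt c i f z + euler (wirt c i f) z"
  by (simp add: wirt_def[of c i "euler f"] wirt_def[of c i f] euler_wirt_linear[OF f S z]
      partial_euler[OF S f z] axis_Basis field_simps)

text \<open>Every first order derivative has weight one under dilations, so passing the field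
  through two of them costs \<open>2 * hess u\<close>.\<close>

lemma hess_euler:
  assumes S: "open S" and u: "C_on 3 S u" and z: "z \<in> S"
  shows "hess (euler u) z i j = 2 * hess u z i j + euler (\<lambda>z. hess u z i j) z"
proof -
  have u2: "C_on 2 S u" using C_on_mono[OF u] by simp
  have w2: "C_on 2 S (wirt c i u)" for c i using C_on_wirt[OF S, of 2 u] u by (simp add: numeral_3_eq_3 numeral_2_eq_2)
  have "hess (euler u) z i j = wirt (-\<i>) i (\<lambda>y. wirt \<i> j u y + euler (wirt \<i> j u) y) z"
    unfolding hess_def by (intro wirt_cong[OF S z] wirt_euler[OF S u2])
  also have "\<dots> = hess u z i j + wirt (-\<i>) i (euler (wirt \<i> j u)) z"
    unfolding hess_def using C_on_mono[OF w2, of 1] C_on_euler[OF S, of 1 "wirt \<i> j u"] w2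
    by (intro wirt_add[OF _ _ z]) (auto simp: numeral_2_eq_2)
  also have "wirt (-\<i>) i (euler (wirt \<i> j u)) z = hess u z i j + euler (\<lambda>z. hess u z i j) z"
    unfolding hess_def by (rule wirt_euler[OF S w2 z])
  finally show ?thesis by simp
qed

text \<open>Together with \<open>hess_euler\<close> this turns the dilation derivative of the
  equation into an expression for the operator linearized at \<open>u\<close> and applied to
  \<open>euler u\<close>.\<close>

lemma euler_polar_S:
  assumes S: "open S" and u: "C_on 3 S u" and z: "z \<in> S" and k: "1 \<le> k"
  shows "euler (\<lambda>z. polar_S k (hess u z) (hess u z)) z
    = of_nat k * polar_S k (\<lambda>i j. euler (\<lambda>z. hess u z i j) z) (hess u z)"
proof -
  have h1: "C_on 1 S (\<lambda>z. hess u z i j)" for i j using C_on_hess[OF S, of 1 u] u by (simp add: numeral_3_eq_3)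
  have "partial b (\<lambda>z. polar_S k (hess u z) (hess u z)) z
      = of_nat k * polar_S k (\<lambda>i j. partial b (\<lambda>z. hess u z i j) z) (hess u z)" if "b \<in> Basis" for b
    using polar_S_has_vector_derivative[OF k, of "\<lambda>t. hess u (z + t *\<^sub>R b)" _ 0 UNIV]
      C_on_has_partial[OF h1 _ z that] by (intro partialI(1)) simp
  then show ?thesis
    by (simp add: euler_def polar_S_sum polar_S_cmult sum_distrib_left mult.left_commute)
qed

section \<open>Integrated divergence identities for compactly supported test functions\<close>

lemma set_integral_sum:
  fixes f :: "'i \<Rightarrow> 'c \<Rightarrow> complex"
  assumes "\<And>i. i \<in> I \<Longrightarrow> set_integrable M K (f i)"
  shows "(LINT z:K|M. \<Sum>i\<in>I. f i z) = (\<Sum>i\<in>I. LINT z:K|M. f i z)"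
    and "set_integrable M K (\<lambda>z. \<Sum>i\<in>I. f i z)"
  using assms unfolding set_integrable_def set_lebesgue_integral_def scaleR_sum_right
  by (auto intro: integral_sum)

lemma set_integral_ksum_eq_0:
  fixes F :: "(nat \<Rightarrow> 'b::finite) \<Rightarrow> (nat \<Rightarrow> 'b) \<Rightarrow> 'c \<Rightarrow> complex"
  assumes "\<And>I J. set_integrable M K (F I J)" "\<And>I J. (LINT z:K|M. F I J z) = 0"
  shows "(LINT z:K|M. ksum k (\<lambda>I J. F I J z)) = 0"
proof -
  have 1: "set_integrable M K (\<lambda>z. of_int (gen_kronecker k I J) * F I J z)" for I J :: "nat \<Rightarrow> 'b"
    using assms(1) by simp
  have 2: "set_integrable M K (\<lambda>z. \<Sum>J \<in> {..<k} \<rightarrow>\<^sub>E UNIV. of_int (gen_kronecker k I J) * F I J z)" for I :: "nat \<Rightarrow> 'b"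
    by (intro set_integral_sum(2) 1)
  have "(LINT z:K|M. of_int (gen_kronecker k I J) * F I J z) = 0" for I J :: "nat \<Rightarrow> 'b"
    using assms(2) by simp
  then show ?thesis unfolding ksum_def
    by (simp only: set_integral_sum(1)[OF 2] set_integral_sum(1)[OF 1] sum.neutral_const)
qed

lemma set_integrable_continuous:
  assumes "compact K" "continuous_on K f"
  shows "set_integrable lborel K (f :: 'a::euclidean_space \<Rightarrow> complex)"
  unfolding set_integrable_def by (rule borel_integrable_compact[OF assms])

lemma integral_divergence_right:
  assumes S: "open S" and u: "C_on 4 S u" and f: "C_on 1 S f" and g: "C_on 2 S g"
    and K: "compact K" "K \<subseteq> S" and f0: "\<And>z. z \<in> S - K \<Longrightarrow> f z = 0"
  shows "(LINT z:K|lborel. polar_S k (\<lambda>i j. wirt \<i> j f z * wirt (-\<i>) i g z) (hess u z)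
     + f z * polar_S k (hess g z) (hess u z)) = 0"
proof -
  have u3: "C_on 3 S u" by (rule C_on_mono[OF u]) simp
  have g1: "C_on 1 S (wirt c i g)" for c i using C_on_wirt[OF S, of 1 g] g by (simp add: numeral_2_eq_2)
  have h1: "C_on 1 S (\<lambda>z. hess u z i j)" for i j using C_on_hess[OF S, of 1 u] u3 by (simp add: numeral_3_eq_3)
  let ?G = "\<lambda>I J z. f z * wirt (-\<i>) (I 0) g z * (\<Prod>a\<in>{1..<k}. hess u z (I a) (J a))"
  have G1: "C_on 1 S (?G I J)" for I J
    by (intro C_on_mult C_on_prod S f g1 h1)
  have "(LINT z:K|lborel. ksum k (\<lambda>I J. wirt \<i> (J 0) (?G I J) z)) = 0"
  proof (rule set_integral_ksum_eq_0)
    fix I J :: "nat \<Rightarrow> 'a"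
    show "set_integrable lborel K (wirt \<i> (J 0) (?G I J))"
      using C_on_wirt[OF S, of 0 "?G I J"] G1 K
      by (intro set_integrable_continuous) (auto simp: C_on_0 intro: continuous_on_subset)
    show "(LINT z:K|lborel. wirt \<i> (J 0) (?G I J) z) = 0"
      by (rule integral_wirt_eq_0[OF S G1 K]) (use f0 in auto)
  qed
  moreover have "(LINT z:K|lborel. ksum k (\<lambda>I J. wirt \<i> (J 0) (?G I J) z))
    = (LINT z:K|lborel. polar_S k (\<lambda>i j. wirt \<i> j f z * wirt (-\<i>) i g z) (hess u z)
     + f z * polar_S k (hess g z) (hess u z))"
    using divergence_right[OF S u3 f g] K by (intro set_lebesgue_integral_cong) (auto intro: borel_compact)
  ultimately show ?thesis by simp
qed

lemma integral_divergence_left: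
  assumes S: "open S" and u: "C_on 4 S u" and f: "C_on 1 S f" and g: "C_on 2 S g"
    and K: "compact K" "K \<subseteq> S" and f0: "\<And>z. z \<in> S - K \<Longrightarrow> f z = 0"
  shows "(LINT z:K|lborel. polar_S k (\<lambda>i j. wirt (-\<i>) i f z * wirt \<i> j g z) (hess u z)
     + f z * polar_S k (hess g z) (hess u z)) = 0"
proof -
  have u3: "C_on 3 S u" by (rule C_on_mono[OF u]) simp
  have g1: "C_on 1 S (wirt c i g)" for c i using C_on_wirt[OF S, of 1 g] g by (simp add: numeral_2_eq_2)
  have h1: "C_on 1 S (\<lambda>z. hess u z i j)" for i j using C_on_hess[OF S, of 1 u] u3 by (simp add: numeral_3_eq_3)
  let ?G = "\<lambda>I J z. f z * wirt \<i> (J 0) g z * (\<Prod>a\<in>{1..<k}. hess u z (I a) (J a))"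
  have G1: "C_on 1 S (?G I J)" for I J
    by (intro C_on_mult C_on_prod S f g1 h1)
  have "(LINT z:K|lborel. ksum k (\<lambda>I J. wirt (-\<i>) (I 0) (?G I J) z)) = 0"
  proof (rule set_integral_ksum_eq_0)
    fix I J :: "nat \<Rightarrow> 'a"
    show "set_integrable lborel K (wirt (-\<i>) (I 0) (?G I J))"
      using C_on_wirt[OF S, of 0 "?G I J"] G1 K
      by (intro set_integrable_continuous) (auto simp: C_on_0 intro: continuous_on_subset)
    show "(LINT z:K|lborel. wirt (-\<i>) (I 0) (?G I J) z) = 0"
      by (rule integral_wirt_eq_0[OF S G1 K]) (use f0 in auto)
  qed
  moreover have "(LINT z:K|lborel. ksum k (\<lambda>I J. wirt (-\<i>) (I 0) (?G I J) z))
    = (LINT z:K|lborel. polar_S k (\<lambda>i j. wirt (-\<i>) i f z * wirt \<i> j g z) (hess u z)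
     + f z * polar_S k (hess g z) (hess u z))"
    using divergence_left[OF S u3 f g] K by (intro set_lebesgue_integral_cong) (auto intro: borel_compact)
  ultimately show ?thesis by simp
qed

lemma euler_mult:
  assumes "C_on 1 S f" "C_on 1 S g" "z \<in> S"
  shows "euler (\<lambda>z. f z * g z) z = euler f z * g z + f z * euler g z"
proof -
  have "partial b (\<lambda>z. f z * g z) z = partial b f z * g z + f z * partial b g z" if "b \<in> Basis" for b
    using that by (intro partial_mult(1) C_on_has_partial[OF assms(1) _ assms(3)] C_on_has_partial[OF assms(2) _ assms(3)]) auto
  then show ?thesis by (simp add: euler_def sum.distrib algebra_simps sum_distrib_left sum_distrib_right)
qed

text \<open>The integrand is the divergence of \<open>f\<close> times the position vector
  field.\<close>

lemma integral_euler:
  fixes f :: "'a::euclidean_space \<Rightarrow> complex"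
  assumes S: "open S" and f: "C_on 1 S f"
    and K: "compact K" "K \<subseteq> S" and f0: "\<And>z. z \<in> S - K \<Longrightarrow> f z = 0"
  shows "(LINT z:K|lborel. euler f z + of_nat DIM('a) * f z) = 0"
proof -
  note l = partial_linear[OF bounded_linear_coordinate]
  let ?G = "\<lambda>b z. complex_of_real (z \<bullet> b) * f z"
  have G1: "C_on 1 S (?G b)" for b by (intro C_on_mult S C_on_linear[OF bounded_linear_coordinate] f)
  have 1: "partial b (?G b) z = f z + of_real (z \<bullet> b) * partial b f z" if "z \<in> S" "b \<in> Basis" for b z
    using that by (simp add: partial_mult(1)[OF l(2) C_on_has_partial[OF f]] l(1))
  have int: "set_integrable lborel K (partial b (?G b))" if "b \<in> Basis" for b
    using C_on_partial[of 0 S "?G b" b] G1 that K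
    by (intro set_integrable_continuous) (auto simp: C_on_0 intro: continuous_on_subset)
  have "(LINT z:K|lborel. \<Sum>b\<in>Basis. partial b (?G b) z) = (\<Sum>b\<in>Basis. LINT z:K|lborel. partial b (?G b) z)"
    by (rule set_integral_sum(1)) (use int in auto)
  also have "\<dots> = 0"
    using integral_partial_eq_0[OF S G1 K] f0 by (intro sum.neutral) simp
  finally have "(LINT z:K|lborel. \<Sum>b\<in>Basis. partial b (?G b) z) = 0" .
  moreover have "(LINT z:K|lborel. \<Sum>b\<in>Basis. partial b (?G b) z) = (LINT z:K|lborel. euler f z + of_nat DIM('a) * f z)"
    using 1 K by (intro set_lebesgue_integral_cong) (auto simp: euler_def sum.distrib subset_iff intro: borel_compact)
  ultimately show ?thesis by simp
qed

section \<open>Integral identities of Pohozaev type\<close>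

text \<open>A nonpositive solution may vanish inside the ball, so (-u)^p is treated as a composition
  with a power of the positive part, which is continuously differentiable on the whole line once
  \<open>1 < p\<close>.\<close>

lemma has_real_derivative_max0_powr:
  assumes "1 < p"
  shows "((\<lambda>y. max 0 y powr p) has_real_derivative p * max 0 y powr (p - 1)) (at y)"
proof -
  consider "y > 0" | "y < 0" | "y = 0" by linarith
  then show ?thesis
  proof cases
    case 1
    have "((\<lambda>y. y powr p) has_real_derivative p * max 0 y powr (p - 1)) (at y)"
      using has_real_derivative_powr[OF 1, of p] 1 by simp
    then show ?thesis
      by (rule has_field_derivative_transform_within_open[of _ _ _ "{0<..}"]) (use 1 in auto)
  next
    case 2
    have "((\<lambda>y. 0) has_real_derivative p * max 0 y powr (p - 1)) (at y)"
      using 2 by simp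
    then show ?thesis
      by (rule has_field_derivative_transform_within_open[of _ _ _ "{..<0}"]) (use 2 in auto)
  next
    case 3
    \<comment> \<open>At the kink the difference quotient is dominated by |h|^(p-1), which tends to
      0.\<close>
    have "((\<lambda>h::real. \<bar>h\<bar> powr (p - 1)) \<longlongrightarrow> \<bar>0\<bar> powr (p - 1)) (at 0)"
      using assms by (intro tendsto_powr2 tendsto_intros) auto
    then have "((\<lambda>h::real. \<bar>h\<bar> powr (p - 1)) \<longlongrightarrow> 0) (at 0)" by simp
    moreover have "norm (max 0 h powr p / h) \<le> \<bar>h\<bar> powr (p - 1)" if "h \<noteq> 0" for h :: real
    proof (cases "h > 0")
      case True
      then have "h powr p / h = h powr (p - 1)" by (simp add: powr_diff)
      then show ?thesis using True by simp
    qed simp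
    then have "\<forall>\<^sub>F h in at 0. norm (max 0 h powr p / h) \<le> \<bar>h\<bar> powr (p - 1)"
      by (simp add: eventually_at_filter)
    ultimately have "((\<lambda>h::real. max 0 h powr p / h) \<longlongrightarrow> 0) (at 0)"
      by (rule Lim_null_comparison[rotated])
    then show ?thesis using 3 assms by (simp add: DERIV_def)
  qed
qed

lemma continuous_max0_powr:
  fixes r :: real
  assumes "0 < r"
  shows "continuous_on UNIV (\<lambda>y. max 0 y powr r)"
  using assms by (intro continuous_on_powr' continuous_intros) auto

lemma partial_inner_self: "partial b (\<lambda>z. z \<bullet> z) z = 2 * (z \<bullet> b)" "has_partial b (\<lambda>z. z \<bullet> z) z"
  for z :: "'a::real_inner"
proof -
  have "((\<lambda>t::real. (z + t *\<^sub>R b) \<bullet> (z + t *\<^sub>R b)) has_real_derivative 2 * (z \<bullet> b)) (at 0)"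
    by (auto simp: inner_add_left inner_add_right inner_commute intro!: derivative_eq_intros)
  then show "partial b (\<lambda>z. z \<bullet> z) z = 2 * (z \<bullet> b)" "has_partial b (\<lambda>z. z \<bullet> z) z"
    by (auto simp: has_real_derivative_iff_has_vector_derivative intro: partialI)
qed

lemma C_on_inner_self: "C_on 1 S (\<lambda>z::'a::euclidean_space. z \<bullet> z)"
proof -
  have "partial b (\<lambda>z::'a. z \<bullet> z) = (\<lambda>z. 2 * (z \<bullet> b))" for b
    by (simp add: fun_eq_iff partial_inner_self)
  then have "C_on 0 S (partial b (\<lambda>z::'a. z \<bullet> z))" for b
    by (auto simp: C_on_0 intro!: continuous_intros)
  then show ?thesis
    unfolding One_nat_def C_on_Suc
    by (intro conjI ballI partial_inner_self(2)) (auto intro!: continuous_intros)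
qed

lemma partial_radial:
  fixes z :: "'a::euclidean_space"
  assumes "(f has_real_derivative d) (at (z \<bullet> z))"
  shows "partial b (\<lambda>z. f (z \<bullet> z)) z = d * (2 * (z \<bullet> b))" "has_partial b (\<lambda>z. f (z \<bullet> z)) z"
  using partial_real_compose[OF assms partial_inner_self(2)] by (simp_all add: partial_inner_self(1))

lemma partial_of_real:
  assumes "has_partial b f z"
  shows "partial b (\<lambda>z. complex_of_real (f z)) z = of_real (partial b f z)"
    "has_partial b (\<lambda>z. complex_of_real (f z)) z"
  using partial_bounded_linear[OF bounded_linear_of_real assms] by auto

lemma inner_axis_Re: "z \<bullet> axis i (1::complex) = Re (z $ i)" "z \<bullet> axis i \<i> = Im (z $ i)"
  by (simp_all add: inner_axis)

lemma wirt_radial: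
  assumes "(f has_real_derivative d) (at (z \<bullet> z))"
  shows "wirt \<i> j (\<lambda>z. complex_of_real (f (z \<bullet> z))) z = of_real d * z $ j"
    "wirt (-\<i>) j (\<lambda>z. complex_of_real (f (z \<bullet> z))) z = of_real d * cnj (z $ j)"
    and euler_radial: "euler (\<lambda>z. complex_of_real (f (z \<bullet> z))) z = of_real (2 * d * (z \<bullet> z))"
proof -
  have 1: "partial b (\<lambda>z. complex_of_real (f (z \<bullet> z))) z = of_real (d * (2 * (z \<bullet> b)))" for b
    using partial_of_real(1)[OF partial_radial(2)[OF assms]] partial_radial(1)[OF assms] by simp
  show "wirt \<i> j (\<lambda>z. complex_of_real (f (z \<bullet> z))) z = of_real d * z $ j"
    "wirt (-\<i>) j (\<lambda>z. complex_of_real (f (z \<bullet> z))) z = of_real d * cnj (z $ j)"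
    by (simp_all add: wirt_def 1 inner_axis_Re complex_eq_iff)
  have "euler (\<lambda>z. complex_of_real (f (z \<bullet> z))) z = of_real (2 * d * (\<Sum>b\<in>Basis. (z \<bullet> b) * (z \<bullet> b)))"
    by (simp add: euler_def 1 sum_distrib_left mult_ac)
  then show "euler (\<lambda>z. complex_of_real (f (z \<bullet> z))) z = of_real (2 * d * (z \<bullet> z))"
    by (simp only: euclidean_inner[of z z])
qed

text \<open>A solution smooth inside the ball, and a radial cutoff written as a function of |z|^2,
  which keeps it differentiable at the origin. The cutoff vanishes outside a smaller ball, so the
  behaviour of \<open>u\<close> at the sphere does not enter the identities.\<close>

context
  fixes u :: "complex ^ 'n::finite \<Rightarrow> real" and R p \<rho> :: real and k :: nat and \<theta> \<theta>' :: "real \<Rightarrow> real"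
  assumes u4: "C_on 4 (ball 0 R) u" and u_le: "\<And>z. z \<in> ball 0 R \<Longrightarrow> u z \<le> 0"
    and p: "1 < p" and k: "1 \<le> k"
    and eq: "\<And>z. z \<in> ball 0 R \<Longrightarrow>
      polar_S k (hess (\<lambda>z. of_real (u z)) z) (hess (\<lambda>z. of_real (u z)) z) = fact k * of_real ((- u z) powr p)"
    and \<rho>: "0 < \<rho>" "\<rho> < R"
    and \<theta>: "\<And>s. (\<theta> has_real_derivative \<theta>' s) (at s)" "continuous_on UNIV \<theta>'"
      "\<And>s. \<rho>\<^sup>2 \<le> s \<Longrightarrow> \<theta> s = 0"
begin

private abbreviation (input) "U \<equiv> \<lambda>z. complex_of_real (u z)"
private abbreviation (input) "V \<equiv> euler U"
private abbreviation (input) "Z \<equiv> \<lambda>z :: complex ^ 'n. complex_of_real (\<theta> (z \<bullet> z))"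
private abbreviation (input) "B \<equiv> ball (0 :: complex ^ 'n) R"
private abbreviation (input) "K \<equiv> cball (0 :: complex ^ 'n) \<rho>"

private lemma U_C4: "C_on 4 B U"
  by (rule C_on_bounded_linear[OF open_ball bounded_linear_of_real u4])

private lemma V_C3: "C_on 3 B V"
  using C_on_euler[OF open_ball, of 3 0 R U] U_C4 by simp

private lemma cutoff_C1: "C_on 1 B Z"
  by (intro C_on_bounded_linear[OF open_ball bounded_linear_of_real]
      C_on_1_real_compose[OF open_ball C_on_inner_self \<theta>(1,2)])

private lemma cutoff_eq_0: "Z z = 0" if "z \<in> B - K" for z
proof -
  have "\<rho>\<^sup>2 \<le> (norm z)\<^sup>2" using that \<rho> by (intro power_mono) auto
  then show ?thesis using \<theta>(3)[of "z \<bullet> z"] by (simp add: power2_norm_eq_inner)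
qed

private lemma support: "compact K" "K \<subseteq> B" using \<rho> by auto

private lemma partial_powr_minus:
  assumes z: "z \<in> B" and b: "b \<in> Basis" and q: "1 < q"
  shows "partial b (\<lambda>z. complex_of_real (max 0 (- u z) powr q)) z
      = - of_real (q * max 0 (- u z) powr (q - 1)) * partial b U z"
proof -
  have hu: "has_partial b u z" using C_on_has_partial[OF u4 _ z b] by simp
  have m: "has_partial b (\<lambda>z. - u z) z" "partial b (\<lambda>z. - u z) z = - partial b u z"
    using partial_bounded_linear[OF bounded_linear_minus[OF bounded_linear_ident] hu] by auto
  note c = partial_real_compose[OF has_real_derivative_max0_powr[OF q] m(1)]
  show ?thesis
    using partial_of_real[OF c(2)] c(1) m(2) partial_of_real(1)[OF hu] by simp
qed

private lemma euler_powr_minus: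
  assumes z: "z \<in> B" and q: "1 < q"
  shows "euler (\<lambda>z. complex_of_real (max 0 (- u z) powr q)) z
      = - of_real (q * max 0 (- u z) powr (q - 1)) * V z"
  using partial_powr_minus[OF z _ q] by (simp add: euler_def sum_distrib_left mult_ac sum_negf)

private lemma C_on_powr_minus: "1 < q \<Longrightarrow> C_on 1 B (\<lambda>z. complex_of_real (max 0 (- u z) powr q))"
  using C_on_mono[OF u4, of 1]
  by (intro C_on_bounded_linear[OF open_ball bounded_linear_of_real]
      C_on_1_real_compose[OF open_ball _ has_real_derivative_max0_powr]
      C_on_bounded_linear[OF open_ball bounded_linear_minus[OF bounded_linear_ident]]
      continuous_on_mult continuous_on_const continuous_max0_powr) auto

text \<open>Apply the dilation field to the equation: the left side is evaluated by
  \<open>hess_euler\<close> and \<open>euler_polar_S\<close>, the right side by the chain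
  rule.\<close>

private lemma polar_S_hess_euler:
  assumes z: "z \<in> B"
  shows "polar_S k (hess V z) (hess U z) = fact k * (2 * of_real (max 0 (- u z) powr p)
    - of_real (p * max 0 (- u z) powr (p - 1)) * V z / of_nat k)"
proof -
  let ?f = "\<lambda>z. complex_of_real (max 0 (- u z) powr p)"
  have U3: "C_on 3 B U" using C_on_mono[OF U_C4] by simp
  have mx: "max 0 (- u y) = - u y" if "y \<in> B" for y using u_le[OF that] by simp
  have "polar_S k (hess V z) (hess U z)
      = polar_S k (\<lambda>i j. 2 * hess U z i j + euler (\<lambda>z. hess U z i j) z) (hess U z)"
    using hess_euler[OF open_ball U3 z] by (intro arg_cong2[where f = "polar_S k"]) (auto simp: fun_eq_iff)
  also have "\<dots> = 2 * polar_S k (hess U z) (hess U z) + polar_S k (\<lambda>i j. euler (\<lambda>z. hess U z i j) z) (hess U z)"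
    by (simp add: polar_S_add polar_S_cmult)
  also have "polar_S k (\<lambda>i j. euler (\<lambda>z. hess U z i j) z) (hess U z)
      = euler (\<lambda>z. polar_S k (hess U z) (hess U z)) z / of_nat k"
    using euler_polar_S[OF open_ball U3 z k] k by simp
  also have "euler (\<lambda>z. polar_S k (hess U z) (hess U z)) z = euler (\<lambda>z. fact k * ?f z) z"
    using eq mx by (intro euler_cong[OF open_ball z]) simp
  also have "\<dots> = fact k * euler ?f z"
    using euler_mult[OF C_on_const C_on_powr_minus[OF p] z, of "fact k"] by (simp add: euler_def)
  also have "euler ?f z = - of_real (p * max 0 (- u z) powr (p - 1)) * V z"
    by (rule euler_powr_minus[OF z p])
  finally show ?thesis using eq[OF z] mx[OF z] by (simp add: algebra_simps)
qed

text \<open>The constant \<open>c\<close> solves (p + 1) c = p/k - 1, the value for which the terms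
  (-u)^p V cancel. What remains in the volume has the factor 2 - 2 n c, which is at most 0 precisely
  when n (p - k) is at least k (p + 1), that is, when k < n and p is at least the critical exponent.
  The terms with \<open>\<theta>'\<close> carry the boundary information.\<close>

lemma pohozaev_identity:
  defines "c \<equiv> (p - k) / (k * (p + 1))"
  shows "(LINT z:K|lborel. Z z * of_real (fact k * (2 - 2 * real CARD('n) * c) * (- u z) powr (p + 1))
    + of_real (\<theta>' (z \<bullet> z)) *
      (V z * polar_S k (\<lambda>i j. wirt (-\<i>) i U z * z $ j) (hess U z)
       - U z * polar_S k (\<lambda>i j. cnj (z $ i) * wirt \<i> j V z) (hess U z)
       - of_real (2 * c * fact k * (z \<bullet> z) * (- u z) powr (p + 1)))) = 0"
proof -
  let ?W = "\<lambda>z. complex_of_real (max 0 (- u z) powr (p + 1))"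
  have U1: "C_on 1 B U" and U2: "C_on 2 B U" using C_on_mono[OF U_C4] by auto
  have V1: "C_on 1 B V" and V2: "C_on 2 B V" using C_on_mono[OF V_C3] by auto
  have W1: "C_on 1 B ?W" using p by (intro C_on_powr_minus) simp
  let ?T1 = "\<lambda>z. polar_S k (\<lambda>i j. wirt \<i> j (\<lambda>z. Z z * V z) z * wirt (-\<i>) i U z) (hess U z)
     + Z z * V z * polar_S k (hess U z) (hess U z)"
  let ?T2 = "\<lambda>z. polar_S k (\<lambda>i j. wirt (-\<i>) i (\<lambda>z. Z z * U z) z * wirt \<i> j V z) (hess U z)
     + Z z * U z * polar_S k (hess V z) (hess U z)"
  let ?T3 = "\<lambda>z. euler (\<lambda>z. Z z * ?W z) z + of_nat DIM(complex ^ 'n) * (Z z * ?W z)"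
  have Z1: "C_on 1 B (\<lambda>z. Z z * f z)" if "C_on 1 B f" for f
    using C_on_mult[OF open_ball cutoff_C1 that] .
  have i: "(LINT z:K|lborel. ?T1 z) = 0" "(LINT z:K|lborel. ?T2 z) = 0" "(LINT z:K|lborel. ?T3 z) = 0"
    using integral_divergence_right[OF open_ball U_C4 Z1[OF V1] U2 support]
      integral_divergence_left[OF open_ball U_C4 Z1[OF U1] V2 support]
      integral_euler[OF open_ball Z1[OF W1] support] cutoff_eq_0 by auto
  have c0: "continuous_on K f" if "C_on m B f" for f :: "complex ^ 'n \<Rightarrow> complex" and m
    using continuous_on_subset[OF C_on_continuous[OF that] support(2)] .
  have cp: "continuous_on K (\<lambda>z. polar_S k (A z) (C z))"
    if "\<And>i j. continuous_on K (\<lambda>z. A z i j)" "\<And>i j. continuous_on K (\<lambda>z. C z i j)" for A C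
    unfolding polar_S_def ksum_def by (intro continuous_intros that)
  have hc: "continuous_on K (\<lambda>z. hess f z i j)" if "C_on 2 B f" for f i j
    using c0[OF C_on_hess[OF open_ball, of 0]] that by (simp add: numeral_2_eq_2)
  have wc: "continuous_on K (wirt c i f)" if "C_on 1 B f" for f c i
    using c0[OF C_on_wirt[OF open_ball, of 0]] that by simp
  have s: "set_integrable lborel K ?T1" "set_integrable lborel K ?T2" "set_integrable lborel K ?T3"
    using c0[OF C_on_euler[OF open_ball, of 0 0 R "\<lambda>z. Z z * ?W z"]] Z1[OF W1] c0[OF cutoff_C1] c0[OF V1] c0[OF U1] c0[OF W1]
    by (intro set_integrable_continuous support(1) continuous_on_add continuous_on_mult cp hc wc U2 V2 U1 V1
        Z1 continuous_on_const; simp)+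
  \<comment> \<open>In \<open>?T1 - ?T2\<close> the common quadratic form \<open>?Q\<close> drops
    out; the multiple of \<open>?T3\<close> then removes the products of (-u)^p with
    \<open>V\<close>.\<close>
  have "(LINT z:K|lborel. ?T1 z - ?T2 z - of_real (fact k * c) * ?T3 z) = 0"
    using s i by simp
  moreover have "?T1 z - ?T2 z - of_real (fact k * c) * ?T3 z
    = Z z * of_real (fact k * (2 - 2 * real CARD('n) * c) * (- u z) powr (p + 1))
    + of_real (\<theta>' (z \<bullet> z)) *
      (V z * polar_S k (\<lambda>i j. wirt (-\<i>) i U z * z $ j) (hess U z)
       - U z * polar_S k (\<lambda>i j. cnj (z $ i) * wirt \<i> j V z) (hess U z)
       - of_real (2 * c * fact k * (z \<bullet> z) * (- u z) powr (p + 1)))" if "z \<in> K" for z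
  proof -
    have z: "z \<in> B" using that support by auto
    have mx: "max 0 (- u z) = - u z" using u_le[OF z] by simp
    let ?x = "complex_of_real (\<theta>' (z \<bullet> z))" and ?F = "complex_of_real ((- u z) powr p)"
    let ?Q = "polar_S k (\<lambda>i j. wirt (-\<i>) i U z * wirt \<i> j V z) (hess U z)"
    have "polar_S k (\<lambda>i j. wirt \<i> j (\<lambda>z. Z z * V z) z * wirt (-\<i>) i U z) (hess U z)
      = polar_S k (\<lambda>i j. (?x * V z) * (wirt (-\<i>) i U z * z $ j) + Z z * (wirt (-\<i>) i U z * wirt \<i> j V z)) (hess U z)"
      by (simp add: wirt_mult[OF cutoff_C1 V1 z] wirt_radial[OF \<theta>(1)] algebra_simps)
    also have "\<dots> = ?x * V z * polar_S k (\<lambda>i j. wirt (-\<i>) i U z * z $ j) (hess U z) + Z z * ?Q"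
      by (simp only: polar_S_add polar_S_cmult)
    finally have 1: "?T1 z = ?x * V z * polar_S k (\<lambda>i j. wirt (-\<i>) i U z * z $ j) (hess U z) + Z z * ?Q
        + Z z * V z * (fact k * ?F)" using eq[OF z] by simp
    have "polar_S k (\<lambda>i j. wirt (-\<i>) i (\<lambda>z. Z z * U z) z * wirt \<i> j V z) (hess U z)
      = polar_S k (\<lambda>i j. (?x * U z) * (cnj (z $ i) * wirt \<i> j V z) + Z z * (wirt (-\<i>) i U z * wirt \<i> j V z)) (hess U z)"
      by (simp only: wirt_mult[OF cutoff_C1 U1 z] wirt_radial[OF \<theta>(1)]) (simp add: algebra_simps)
    also have "\<dots> = ?x * U z * polar_S k (\<lambda>i j. cnj (z $ i) * wirt \<i> j V z) (hess U z) + Z z * ?Q"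
      by (simp only: polar_S_add polar_S_cmult)
    finally have 2: "?T2 z = ?x * U z * polar_S k (\<lambda>i j. cnj (z $ i) * wirt \<i> j V z) (hess U z) + Z z * ?Q
        + Z z * (fact k * (2 * (U z * ?F) - (U z * of_real (p * (- u z) powr (p - 1))) * V z / of_nat k))"
      by (simp add: polar_S_hess_euler[OF z] mx algebra_simps)
    have 3: "?T3 z = of_real (2 * \<theta>' (z \<bullet> z) * (z \<bullet> z)) * ?W z - Z z * (of_real (p + 1) * ?F * V z)
        + of_real (2 * real CARD('n)) * (Z z * ?W z)"
      using p by (simp add: euler_mult[OF cutoff_C1 W1 z] euler_radial[OF \<theta>(1)] euler_powr_minus[OF z] mx)
    \<comment> \<open>Both relations hold at zeros of \<open>u\<close> too, where every power
      involved is 0.\<close>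
    have 4: "U z * of_real (p * (- u z) powr (p - 1)) = - of_real p * ?F"
      "?W z = - (U z * ?F)"
    proof -
      have "(- u z) * (- u z) powr (p - 1) = (- u z) powr p" "(- u z) powr (p + 1) = (- u z) * (- u z) powr p"
        using u_le[OF z] p by (cases "u z = 0"; simp add: powr_diff powr_add)+
      then have e: "- (u z * (- u z) powr (p - 1)) = (- u z) powr p" "(- u z) powr (p + 1) = - (u z * (- u z) powr p)"
        by simp_all
      show "?W z = - (U z * ?F)" unfolding mx e(2) by simp
      show "U z * of_real (p * (- u z) powr (p - 1)) = - of_real p * ?F"
        unfolding e(1)[symmetric] by simp
    qed
    have 5: "of_real (p + 1) * complex_of_real c = (of_real p - of_nat k) / of_nat k"
    proof -
      have "p + 1 \<noteq> 0" using p by simp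
      then have "(p + 1) * c = (p - real k) / real k" by (simp add: c_def)
      from arg_cong[OF this, of complex_of_real] show ?thesis by simp
    qed
    have 6: "of_real (fact k * c) * (Z z * (of_real (p + 1) * ?F * V z))
        = fact k * Z z * ((of_real (p + 1) * complex_of_real c) * ?F * V z)" by simp
    have 7: "(of_real p - of_nat k) / of_nat k * ?F * V z = of_real p * ?F * V z / of_nat k - ?F * V z"
      using k by (simp add: field_simps)
    have T2: "?T2 z = ?x * U z * polar_S k (\<lambda>i j. cnj (z $ i) * wirt \<i> j V z) (hess U z) + Z z * ?Q
        + Z z * (fact k * (2 * (U z * ?F) + of_real p * ?F * V z / of_nat k))"
      unfolding 2 4(1) by simp
    have "of_real (fact k * c) * ?T3 z = of_real (fact k * c) * (of_real (2 * \<theta>' (z \<bullet> z) * (z \<bullet> z)) * ?W z)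
        - of_real (fact k * c) * (Z z * (of_real (p + 1) * ?F * V z))
        + of_real (fact k * c) * (of_real (2 * real CARD('n)) * (Z z * ?W z))"
      unfolding 3 by (simp only: distrib_left right_diff_distrib)
    also have "of_real (fact k * c) * (Z z * (of_real (p + 1) * ?F * V z))
        = fact k * Z z * (of_real p * ?F * V z / of_nat k - ?F * V z)"
      unfolding 6 5 7 ..
    finally have T3: "of_real (fact k * c) * ?T3 z
        = fact k * of_real c * (2 * ?x * of_real (z \<bullet> z) * - (U z * ?F))
        - fact k * Z z * (of_real p * ?F * V z / of_nat k - ?F * V z)
        + fact k * of_real c * (2 * of_nat CARD('n) * (Z z * - (U z * ?F)))"
      unfolding 4(2) by simp
    have W: "complex_of_real ((- u z) powr (p + 1)) = - (U z * ?F)" using 4(2) by (simp add: mx)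
    have g: "of_real (fact k * (2 - 2 * real CARD('n) * c) * (- u z) powr (p + 1))
        = fact k * (2 - 2 * of_nat CARD('n) * of_real c) * - (U z * ?F)"
      "of_real (2 * c * fact k * (z \<bullet> z) * (- u z) powr (p + 1))
        = 2 * of_real c * fact k * of_real (z \<bullet> z) * - (U z * ?F)"
      unfolding W[symmetric] by simp_all
    show ?thesis
      unfolding 1 T2 T3 g by (simp add: algebra_simps)
  qed
  ultimately show ?thesis
    using borel_compact[OF support(1)] by (subst (asm) set_lebesgue_integral_cong) auto
qed

text \<open>The equation tested with the cutoff alone: it expresses the mass of (-u)^p through a
  flux across the region where \<open>\<theta>'\<close> is nonzero.\<close>

lemma integral_S_identity:
  "(LINT z:K|lborel. Z z * of_real (fact k * (- u z) powr p)
    + of_real (\<theta>' (z \<bullet> z)) * polar_S k (\<lambda>i j. wirt (-\<i>) i U z * z $ j) (hess U z)) = 0"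
proof -
  have U2: "C_on 2 B U" using C_on_mono[OF U_C4] by auto
  have "(LINT z:K|lborel. polar_S k (\<lambda>i j. wirt \<i> j Z z * wirt (-\<i>) i U z) (hess U z)
     + Z z * polar_S k (hess U z) (hess U z)) = 0"
    by (rule integral_divergence_right[OF open_ball U_C4 cutoff_C1 U2 support cutoff_eq_0])
  moreover have "polar_S k (\<lambda>i j. wirt \<i> j Z z * wirt (-\<i>) i U z) (hess U z)
     + Z z * polar_S k (hess U z) (hess U z) = Z z * of_real (fact k * (- u z) powr p)
    + of_real (\<theta>' (z \<bullet> z)) * polar_S k (\<lambda>i j. wirt (-\<i>) i U z * z $ j) (hess U z)" if "z \<in> K" for z
  proof -
    have z: "z \<in> B" using that support by auto
    have "polar_S k (\<lambda>i j. wirt \<i> j Z z * wirt (-\<i>) i U z) (hess U z)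
      = polar_S k (\<lambda>i j. of_real (\<theta>' (z \<bullet> z)) * (wirt (-\<i>) i U z * z $ j)) (hess U z)"
      by (simp add: wirt_radial[OF \<theta>(1)] mult_ac)
    then show ?thesis using eq[OF z] by (simp add: polar_S_cmult)
  qed
  ultimately show ?thesis
    using borel_compact[OF support(1)] by (subst (asm) set_lebesgue_integral_cong) auto
qed

text \<open>For a steep cutoff \<open>\<theta>'\<close> is large, but this identity ties the
  integral of |z|^2 times \<open>\<theta>'\<close> to that of the cutoff itself. It serves to absorb
  a small error that appears multiplied by \<open>\<theta>'\<close>.\<close>

lemma integral_cutoff_identity:
  "(LINT z:K|lborel. of_real (real CARD('n)) * Z z + of_real (\<theta>' (z \<bullet> z) * (z \<bullet> z))) = 0"
proof -
  have "(LINT z:K|lborel. (1 / 2) * (euler Z z + of_nat DIM(complex ^ 'n) * Z z)) = 0"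
    using integral_euler[OF open_ball cutoff_C1 support cutoff_eq_0] by simp
  moreover have eq: "(1 / 2) * (euler Z z + of_nat DIM(complex ^ 'n) * Z z)
    = of_real (real CARD('n)) * Z z + of_real (\<theta>' (z \<bullet> z) * (z \<bullet> z))" for z
    by (simp add: euler_radial[OF \<theta>(1)])
  ultimately show ?thesis unfolding eq by simp
qed

end

section \<open>Boundary behaviour on the sphere\<close>

text \<open>Derivatives are available only inside the ball, so boundary values are approached along
  the radius; the shift by 2 keeps every factor strictly between 0 and 1.\<close>

lemma continuous_eq_limit_on_sphere:
  fixes f :: "'a::euclidean_space \<Rightarrow> real"
  assumes "continuous_on (cball 0 R) f" "z \<in> sphere 0 R"
  shows "(\<lambda>n. f ((1 - 1 / real (n + 2)) *\<^sub>R z)) \<longlonglongrightarrow> f z"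
proof -
  have s: "(\<lambda>n. 1 - 1 / real (n + 2)) \<longlonglongrightarrow> 1 - 0"
    using LIMSEQ_ignore_initial_segment[OF lim_inverse_n', of 2] by (intro tendsto_intros) simp
  have "(\<lambda>n. (1 - 1 / real (n + 2)) *\<^sub>R z) \<longlonglongrightarrow> z"
    using tendsto_scaleR[OF s tendsto_const[of z]] by simp
  moreover have "(1 - 1 / real (n + 2)) *\<^sub>R z \<in> cball 0 R" for n
  proof -
    have "(1 - 1 / real (n + 2)) * norm z \<le> 1 * norm z"
      by (intro mult_right_mono) auto
    moreover have "1 - 1 / real (n + 2) \<ge> 0" by simp
    ultimately show ?thesis using assms(2) by simp
  qed
  ultimately show ?thesis
    using assms by (intro continuous_on_tendsto_compose[OF assms(1)]) auto
qed

text \<open>\<open>W\<close> vanishes on the sphere but is differentiable only inside. If the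
  extended derivative along the rotation in the plane of \<open>b\<close> and \<open>c\<close> were
  positive at \<open>z\<close>, then \<open>W\<close> would grow by a fixed amount along slightly
  shrunken arcs, hence also along the limiting arc on the sphere. Exchanging \<open>b\<close> and
  \<open>c\<close> gives the opposite inequality.\<close>

lemma boundary_tangential_aux:
  fixes W :: "'a::euclidean_space \<Rightarrow> real"
  assumes W: "C_on 1 (ball 0 R) W" "continuous_on (cball 0 R) W" and R: "0 < R"
    and W0: "\<And>z. z \<in> sphere 0 R \<Longrightarrow> W z = 0"
    and g: "\<And>b. b \<in> Basis \<Longrightarrow> continuous_on (cball 0 R) (g b)"
      "\<And>b z. b \<in> Basis \<Longrightarrow> z \<in> ball 0 R \<Longrightarrow> g b z = partial b W z"
    and z: "z \<in> sphere 0 R" and bc: "b \<in> Basis" "c \<in> Basis" "b \<noteq> c"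
  shows "(z \<bullet> b) * g c z - (z \<bullet> c) * g b z \<le> 0"
proof (rule ccontr)
  define F where "F = (\<lambda>x. (x \<bullet> b) * g c x - (x \<bullet> c) * g b x)"
  assume "\<not> ?thesis"
  then have "F z > 0" by (simp add: F_def)
  define \<eta> where "\<eta> = F z / 2"
  have \<eta>: "\<eta> > 0" "F z = 2 * \<eta>" using \<open>F z > 0\<close> by (auto simp: \<eta>_def)
  have "continuous_on (cball 0 R) F"
    unfolding F_def using g(1) bc by (intro continuous_intros) auto
  then obtain d where d: "d > 0" "\<And>x. x \<in> cball 0 R \<Longrightarrow> dist x z < d \<Longrightarrow> dist (F x) (F z) < \<eta>"
    using \<eta>(1) z unfolding continuous_on_iff by (metis cball_eq_ball_iff mem_cball mem_sphere order_refl)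
  \<comment> \<open>\<open>y t\<close> is \<open>z\<close> rotated by the angle \<open>t\<close> in
    the plane of \<open>b\<close> and \<open>c\<close>, written as \<open>z\<close> plus a
    correction in that plane.\<close>
  define y where "y = (\<lambda>t. z + (((cos t - 1) * (z \<bullet> b) - sin t * (z \<bullet> c)) *\<^sub>R b
      + ((cos t - 1) * (z \<bullet> c) + sin t * (z \<bullet> b)) *\<^sub>R c))"
  have bb: "b \<bullet> b = 1" "c \<bullet> c = 1" "b \<bullet> c = 0" "c \<bullet> b = 0"
    using bc by (auto simp: inner_Basis)
  have yb: "y t \<bullet> b = cos t * (z \<bullet> b) - sin t * (z \<bullet> c)" "y t \<bullet> c = cos t * (z \<bullet> c) + sin t * (z \<bullet> b)" for t
    by (simp_all add: y_def inner_add_left bb algebra_simps)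
  have "norm (y t) = R" for t
  proof -
    define \<alpha> where "\<alpha> = (cos t - 1) * (z \<bullet> b) - sin t * (z \<bullet> c)"
    define \<beta> where "\<beta> = (cos t - 1) * (z \<bullet> c) + sin t * (z \<bullet> b)"
    have y: "y t = z + (\<alpha> *\<^sub>R b + \<beta> *\<^sub>R c)" by (simp add: y_def \<alpha>_def \<beta>_def)
    have "y t \<bullet> y t = z \<bullet> z + 2 * (\<alpha> * (z \<bullet> b) + \<beta> * (z \<bullet> c)) + (\<alpha>\<^sup>2 + \<beta>\<^sup>2)"
      by (simp add: y inner_add_left inner_add_right bb
          inner_commute[of b z] inner_commute[of c z] power2_eq_square algebra_simps)
    also have "\<alpha>\<^sup>2 + \<beta>\<^sup>2 = ((z \<bullet> b)\<^sup>2 + (z \<bullet> c)\<^sup>2) * ((cos t - 1)\<^sup>2 + (sin t)\<^sup>2)"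
    proof -
      have "(x * b - s * c)\<^sup>2 + (x * c + s * b)\<^sup>2 = (b\<^sup>2 + c\<^sup>2) * (x\<^sup>2 + s\<^sup>2)" for x b s c :: real
        by algebra
      then show ?thesis unfolding \<alpha>_def \<beta>_def .
    qed
    also have "(cos t - 1)\<^sup>2 + (sin t)\<^sup>2 = 2 - 2 * cos t"
      using sin_cos_squared_add[of t] by (simp add: power2_eq_square algebra_simps)
    also have "z \<bullet> z + 2 * (\<alpha> * (z \<bullet> b) + \<beta> * (z \<bullet> c)) + ((z \<bullet> b)\<^sup>2 + (z \<bullet> c)\<^sup>2) * (2 - 2 * cos t) = z \<bullet> z"
      by (simp add: \<alpha>_def \<beta>_def power2_eq_square algebra_simps)
    finally show ?thesis using z by (simp add: norm_eq_sqrt_inner)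
  qed
  then have ysph: "y t \<in> sphere 0 R" for t by simp
  have yd: "(y has_vector_derivative (- (y t \<bullet> c)) *\<^sub>R b + (y t \<bullet> b) *\<^sub>R c) (at t)" for t
    unfolding yb unfolding y_def
    by (auto intro!: derivative_eq_intros simp: has_real_derivative_iff_has_vector_derivative[symmetric] algebra_simps)
  have "isCont y 0"
    using has_vector_derivative_continuous[OF yd] .
  then have "\<exists>\<tau>>0. \<forall>t. dist t 0 < \<tau> \<longrightarrow> dist (y t) (y 0) < d / 2"
    using d(1) unfolding continuous_at_eps_delta by (metis half_gt_zero)
  then obtain \<tau>' where \<tau>': "\<tau>' > 0" "\<And>t. \<bar>t\<bar> < \<tau>' \<Longrightarrow> dist (y t) z < d / 2"
    by (auto simp: dist_real_def y_def)
  define \<tau> where "\<tau> = \<tau>' / 2"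
  have \<tau>: "\<tau> > 0" using \<tau>' by (simp add: \<tau>_def)
  define s where "s = (\<lambda>n. 1 - 1 / real (n + 2))"
  have s: "0 < s n" "s n < 1" for n by (auto simp: s_def)
  have sR: "s n *\<^sub>R y t \<in> ball 0 R" for n t
    using \<open>\<And>t. norm (y t) = R\<close> s[of n] R by (simp add: abs_of_pos)
  have "(\<lambda>n. 1 / real (n + 2)) \<longlonglongrightarrow> 0"
    using LIMSEQ_ignore_initial_segment[OF lim_inverse_n', of 2] by simp
  then have "\<forall>\<^sub>F n in sequentially. 1 / real (n + 2) < d / (2 * R)"
    using d(1) R by (intro order_tendstoD(2)) auto
  then have "\<forall>\<^sub>F n in sequentially. W (s n *\<^sub>R y \<tau>) - W (s n *\<^sub>R y 0) \<ge> \<eta> * \<tau>"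
  proof eventually_elim
    case (elim n)
    \<comment> \<open>\<open>F\<close> is the derivative along the rotation field; that field is
      linear, so scaling the arc by \<open>s n\<close> produces no extra factor.\<close>
    have fd: "((\<lambda>t. W (s n *\<^sub>R y t)) has_real_derivative F (s n *\<^sub>R y t)) (at t)" for t
    proof -
      let ?x = "s n *\<^sub>R y t"
      let ?y' = "(- (y t \<bullet> c)) *\<^sub>R b + (y t \<bullet> b) *\<^sub>R c"
      have "((\<lambda>t. s n *\<^sub>R y t) has_derivative (\<lambda>r. s n *\<^sub>R (r *\<^sub>R ?y'))) (at t)"
        using yd[of t] unfolding has_vector_derivative_def by (rule has_derivative_scaleR_right)
      from diff_chain_at[OF this C_on_1_has_derivative[OF W(1) open_ball sR]]
      have "((\<lambda>t. W (s n *\<^sub>R y t)) has_derivative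
          (\<lambda>r. \<Sum>d\<in>Basis. ((s n *\<^sub>R (r *\<^sub>R ?y')) \<bullet> d) * partial d W ?x)) (at t)"
        by (simp add: o_def)
      moreover have "(\<Sum>d\<in>Basis. ((s n *\<^sub>R (r *\<^sub>R ?y')) \<bullet> d) * partial d W ?x) = F ?x * r" for r
      proof -
        have "(\<Sum>d\<in>Basis. ((s n *\<^sub>R (r *\<^sub>R ?y')) \<bullet> d) * partial d W ?x)
          = (\<Sum>d\<in>{b, c}. ((s n *\<^sub>R (r *\<^sub>R ?y')) \<bullet> d) * partial d W ?x)"
          using bc by (intro sum.mono_neutral_right) (auto simp: inner_diff_left inner_add_left inner_Basis)
        also have "\<dots> = F ?x * r"
          using bc g(2)[OF _ sR] by (simp add: F_def inner_add_left bb algebra_simps)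
        finally show ?thesis .
      qed
      ultimately show ?thesis by (simp add: has_field_derivative_def)
    qed
    obtain t where t: "0 < t" "t < \<tau>" "W (s n *\<^sub>R y \<tau>) - W (s n *\<^sub>R y 0) = (\<tau> - 0) * F (s n *\<^sub>R y t)"
      using MVT2[OF \<tau> fd] by blast
    have "dist (s n *\<^sub>R y t) (y t) = (1 / real (n + 2)) * R"
    proof -
      have "s n *\<^sub>R y t - y t = (- (1 / real (n + 2))) *\<^sub>R y t" by (simp add: s_def scaleR_left_diff_distrib)
      then show ?thesis using \<open>norm (y t) = R\<close> by (simp add: dist_norm)
    qed
    also have "\<dots> < d / 2" using elim R by (simp add: field_simps)
    finally have "dist (s n *\<^sub>R y t) z < d"
      using \<tau>'(2)[of t] t dist_triangle[of "s n *\<^sub>R y t" z "y t"] by (simp add: \<tau>_def)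
    then have "dist (F (s n *\<^sub>R y t)) (F z) < \<eta>" using sR[of n t] by (intro d(2)) auto
    then have "F (s n *\<^sub>R y t) \<ge> \<eta>" unfolding dist_real_def \<eta>(2) by linarith
    then show ?case using t \<tau> by (simp add: mult.commute)
  qed
  moreover have "(\<lambda>n. W (s n *\<^sub>R y \<tau>) - W (s n *\<^sub>R y 0)) \<longlonglongrightarrow> W (y \<tau>) - W (y 0)"
    unfolding s_def by (intro tendsto_diff continuous_eq_limit_on_sphere[OF W(2)] ysph)
  ultimately have "\<eta> * \<tau> \<le> W (y \<tau>) - W (y 0)"
    by (intro tendsto_lowerbound) auto
  then have "\<eta> * \<tau> \<le> 0" using W0[OF ysph] by simp
  then show False using mult_pos_pos[OF \<eta>(1) \<tau>] by simp
qed

lemma boundary_tangential: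
  fixes W :: "'a::euclidean_space \<Rightarrow> real"
  assumes W: "C_on 1 (ball 0 R) W" "continuous_on (cball 0 R) W" and R: "0 < R"
    and W0: "\<And>z. z \<in> sphere 0 R \<Longrightarrow> W z = 0"
    and g: "\<And>b. b \<in> Basis \<Longrightarrow> continuous_on (cball 0 R) (g b)"
      "\<And>b z. b \<in> Basis \<Longrightarrow> z \<in> ball 0 R \<Longrightarrow> g b z = partial b W z"
    and z: "z \<in> sphere 0 R" and bc: "b \<in> Basis" "c \<in> Basis"
  shows "(z \<bullet> b) * g c z = (z \<bullet> c) * g b z"
  using boundary_tangential_aux[OF W R W0 g z bc] boundary_tangential_aux[OF W R W0 g z bc(2,1)]
  by (cases "b = c") auto

text \<open>Were the radial derivative negative at \<open>z\<close>, it would stay below half that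
  value on a final segment of the ray; starting from a nonpositive value, \<open>W\<close> would be
  negative at \<open>z\<close>.\<close>

lemma boundary_radial_nonneg:
  fixes W :: "'a::euclidean_space \<Rightarrow> real"
  assumes W: "C_on 1 (ball 0 R) W" "continuous_on (cball 0 R) W" and R: "0 < R"
    and W0: "\<And>z. z \<in> sphere 0 R \<Longrightarrow> W z = 0" and W_le: "\<And>z. z \<in> ball 0 R \<Longrightarrow> W z \<le> 0"
    and g: "\<And>b. b \<in> Basis \<Longrightarrow> continuous_on (cball 0 R) (g b)"
      "\<And>b z. b \<in> Basis \<Longrightarrow> z \<in> ball 0 R \<Longrightarrow> g b z = partial b W z"
    and z: "z \<in> sphere 0 R"
  shows "0 \<le> (\<Sum>b\<in>Basis. (z \<bullet> b) * g b z)"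
proof (rule ccontr)
  define F where "F = (\<lambda>x. \<Sum>b\<in>Basis. (z \<bullet> b) * g b x)"
  assume "\<not> ?thesis"
  then have Fz: "F z < 0" by (simp add: F_def)
  have "continuous_on (cball 0 R) F"
    unfolding F_def using g(1) by (intro continuous_intros) auto
  moreover have "z \<in> cball 0 R" using z by simp
  ultimately obtain d where d: "d > 0" "\<And>x. x \<in> cball 0 R \<Longrightarrow> dist x z < d \<Longrightarrow> dist (F x) (F z) < - F z / 2"
    using Fz unfolding continuous_on_iff by (metis half_gt_zero neg_0_less_iff_less)
  have nz: "norm z = R" using z by simp
  \<comment> \<open>Beyond this fraction of the ray all points lie within \<open>d / 2\<close> of
    \<open>z\<close>; the maximum with 1/2 keeps the fraction positive.\<close>
  define s0 where "s0 = max (1 / 2) (1 - d / (2 * R))"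
  have s0: "0 < s0" "s0 < 1" using d R by (auto simp: s0_def)
  have sR: "s *\<^sub>R z \<in> ball 0 R" if "0 < s" "s < 1" for s using that nz R by simp
  have fd: "((\<lambda>s. W (s *\<^sub>R z)) has_real_derivative F (s *\<^sub>R z)) (at s)" if "0 < s" "s < 1" for s
  proof -
    have "((\<lambda>s::real. s *\<^sub>R z) has_derivative (\<lambda>r. r *\<^sub>R z)) (at s)"
      by (auto intro!: derivative_eq_intros)
    from diff_chain_at[OF this C_on_1_has_derivative[OF W(1) open_ball sR[OF that]]]
    have "((\<lambda>s. W (s *\<^sub>R z)) has_derivative (\<lambda>r. \<Sum>b\<in>Basis. ((r *\<^sub>R z) \<bullet> b) * partial b W (s *\<^sub>R z))) (at s)"
      by (simp only: o_def)
    moreover have "(\<lambda>r. \<Sum>b\<in>Basis. ((r *\<^sub>R z) \<bullet> b) * partial b W (s *\<^sub>R z)) = (*) (F (s *\<^sub>R z))"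
      using g(2)[OF _ sR[OF that]] by (simp add: fun_eq_iff F_def sum_distrib_left mult_ac)
    ultimately show ?thesis
      by (simp add: has_field_derivative_def o_def)
  qed
  have Fneg: "F (s *\<^sub>R z) \<le> F z / 2" if "s0 \<le> s" "s < 1" for s
  proof -
    have "dist (s *\<^sub>R z) z = (1 - s) * R"
    proof -
      have "s *\<^sub>R z - z = (- (1 - s)) *\<^sub>R z" by (simp add: algebra_simps)
      then show ?thesis using nz that by (simp add: dist_norm)
    qed
    also have "\<dots> \<le> d / 2" using that R d(1) by (simp add: s0_def field_simps)
    also have "\<dots> < d" using d by simp
    finally have "dist (F (s *\<^sub>R z)) (F z) < - F z / 2"
      using sR[of s] that s0 by (intro d(2)) auto
    then show ?thesis unfolding dist_real_def by linarith
  qed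
  have le: "W (s *\<^sub>R z) \<le> (s - s0) * (F z / 2)" if s: "s0 < s" "s < 1" for s
  proof -
    obtain t where t: "s0 < t" "t < s" "W (s *\<^sub>R z) - W (s0 *\<^sub>R z) = (s - s0) * F (t *\<^sub>R z)"
      using MVT2[OF s(1), of "\<lambda>s. W (s *\<^sub>R z)" "\<lambda>s. F (s *\<^sub>R z)"] fd s s0 by auto
    have "(s - s0) * F (t *\<^sub>R z) \<le> (s - s0) * (F z / 2)"
      using Fneg[of t] t s by (intro mult_left_mono) auto
    then show ?thesis using t W_le[OF sR[OF s0]] by linarith
  qed
  have lim: "(\<lambda>n. 1 - 1 / real (n + 2)) \<longlonglongrightarrow> 1 - 0"
    using LIMSEQ_ignore_initial_segment[OF lim_inverse_n', of 2] by (intro tendsto_intros) simp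
  then have "\<forall>\<^sub>F n in sequentially. s0 < 1 - 1 / real (n + 2)"
    using s0 by (intro order_tendstoD(1)[OF lim]) auto
  then have "\<forall>\<^sub>F n in sequentially. W ((1 - 1 / real (n + 2)) *\<^sub>R z) \<le> (1 - 1 / real (n + 2) - s0) * (F z / 2)"
    by eventually_elim (intro le; simp)
  moreover have "(\<lambda>n. (1 - 1 / real (n + 2) - s0) * (F z / 2)) \<longlonglongrightarrow> (1 - 0 - s0) * (F z / 2)"
    by (intro tendsto_intros lim)
  ultimately have "W z \<le> (1 - 0 - s0) * (F z / 2)"
    using tendsto_le[OF sequentially_bot _ continuous_eq_limit_on_sphere[OF W(2) z]] by blast
  moreover have "(1 - s0) * (F z / 2) < 0" using s0 Fz by (intro mult_pos_neg) auto
  ultimately show False using W0[OF z] by simp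
qed

text \<open>The tangential lemma is applied twice: first to \<open>u\<close>, whence the functions
  x_d u_e - x_e u_d vanish on the sphere, then to these functions. Contracting the outcome with
  \<open>z\<close> isolates the second derivatives. The vectors \<open>\<alpha>\<close> and
  \<open>\<beta>\<close> may stay unspecified because \<open>polar_S_rank_one_absorb\<close> works
  modulo terms with \<open>z\<close> as a factor.\<close>

lemma boundary_hessian:
  fixes u :: "'a::euclidean_space \<Rightarrow> real"
  assumes u: "C_on 2 (ball 0 R) u" "continuous_on (cball 0 R) u" and R: "0 < R"
    and u0: "\<And>z. z \<in> sphere 0 R \<Longrightarrow> u z = 0"
    and g: "\<And>b. b \<in> Basis \<Longrightarrow> continuous_on (cball 0 R) (g b)"
      "\<And>b z. b \<in> Basis \<Longrightarrow> z \<in> ball 0 R \<Longrightarrow> g b z = partial b u z"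
    and h: "\<And>b c. b \<in> Basis \<Longrightarrow> c \<in> Basis \<Longrightarrow> continuous_on (cball 0 R) (h b c)"
      "\<And>b c z. b \<in> Basis \<Longrightarrow> c \<in> Basis \<Longrightarrow> z \<in> ball 0 R \<Longrightarrow> h b c z = partial b (partial c u) z"
    and z: "z \<in> sphere 0 R"
  defines "v \<equiv> \<Sum>b\<in>Basis. (z \<bullet> b) * g b z"
  shows "\<And>c. c \<in> Basis \<Longrightarrow> R\<^sup>2 * g c z = v * (z \<bullet> c)"
    and "\<exists>\<alpha> \<beta>. \<forall>c\<in>Basis. \<forall>e\<in>Basis. R\<^sup>2 * h c e z
      = (if c = e then v else 0) + \<alpha> c * (z \<bullet> e) + (z \<bullet> c) * \<beta> e"
proof -
  have zz: "(\<Sum>b\<in>Basis. (y \<bullet> b) * (y \<bullet> b)) = R\<^sup>2" if "y \<in> sphere 0 R" for y :: 'a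
    using that by (simp add: euclidean_inner[symmetric] power2_norm_eq_inner[symmetric])
  have u1: "C_on 1 (ball 0 R) u" using C_on_mono[OF u(1)] by simp
  have t1: "(y \<bullet> b) * g c y = (y \<bullet> c) * g b y" if "b \<in> Basis" "c \<in> Basis" "y \<in> sphere 0 R" for b c y
    by (rule boundary_tangential[where g = g, OF u1 u(2) R u0 g that(3,1,2)])
  show 1: "R\<^sup>2 * g c z = v * (z \<bullet> c)" if c: "c \<in> Basis" for c
  proof -
    have "(\<Sum>b\<in>Basis. (z \<bullet> b) * (z \<bullet> b)) * g c z = (\<Sum>b\<in>Basis. (z \<bullet> b) * ((z \<bullet> b) * g c z))"
      by (simp add: sum_distrib_left mult_ac)
    also have "\<dots> = (\<Sum>b\<in>Basis. (z \<bullet> b) * ((z \<bullet> c) * g b z))"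
      using t1[OF _ c z] by simp
    finally show ?thesis unfolding zz[OF z] v_def sum_distrib_right by (simp add: mult_ac)
  qed
  \<comment> \<open>\<open>G d e b\<close> extends the \<open>b\<close>-derivative of x_d u_e - x_e
    u_d to the closed ball.\<close>
  define G where "G = (\<lambda>d e b x. (b \<bullet> d) * g e x + (x \<bullet> d) * h b e x - ((b \<bullet> e) * g d x + (x \<bullet> e) * h b d x))"
  have t2: "(z \<bullet> b) * G d e c z = (z \<bullet> c) * G d e b z"
    if de: "d \<in> Basis" "e \<in> Basis" and bc: "b \<in> Basis" "c \<in> Basis" for d e b c
  proof -
    let ?W = "\<lambda>x. (x \<bullet> d) * g e x - (x \<bullet> e) * g d x"
    let ?W' = "\<lambda>x. (x \<bullet> d) * partial e u x + (- (x \<bullet> e)) * partial d u x"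
    have lin: "bounded_linear (\<lambda>x. x \<bullet> d)" "bounded_linear (\<lambda>x. - (x \<bullet> e))"
      by (intro bounded_linear_minus bounded_linear_inner_left)+
    have p1: "C_on 1 (ball 0 R) (partial a u)" if "a \<in> Basis" for a
      using C_on_partial[of 1 _ u] u(1) that by (simp add: numeral_2_eq_2)
    have W': "C_on 1 (ball 0 R) ?W'"
      using de by (intro C_on_add C_on_mult open_ball C_on_linear lin p1)
    have WW: "?W x = ?W' x" if "x \<in> ball 0 R" for x using g(2) de that by simp
    have "C_on 1 (ball 0 R) ?W" using iffD2[OF C_on_cong[OF open_ball WW] W'] by blast
    moreover have "continuous_on (cball 0 R) ?W" using g(1) de by (intro continuous_intros) auto
    moreover have "?W x = 0" if "x \<in> sphere 0 R" for x using t1[OF de that] by simp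
    moreover have "continuous_on (cball 0 R) (G d e b)" if "b \<in> Basis" for b
      unfolding G_def using g(1) h(1) de that by (intro continuous_intros) auto
    moreover have "G d e b x = partial b ?W x" if b: "b \<in> Basis" and x: "x \<in> ball 0 R" for b x
    proof -
      have hp: "has_partial b (partial a u) x" if "a \<in> Basis" for a
        using C_on_has_partial[OF p1[OF that] _ x b] by simp
      have "partial b ?W x = partial b ?W' x" by (rule partial_cong(1)[OF open_ball x WW])
      also have "\<dots> = (b \<bullet> d) * partial e u x + (x \<bullet> d) * partial b (partial e u) x
          + (- (b \<bullet> e) * partial d u x + - (x \<bullet> e) * partial b (partial d u) x)"
        unfolding partial_add(1)[OF partial_mult(2)[OF partial_linear(2)[OF lin(1)] hp[OF de(2)]]
            partial_mult(2)[OF partial_linear(2)[OF lin(2)] hp[OF de(1)]]]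
          partial_mult(1)[OF partial_linear(2)[OF lin(1)] hp[OF de(2)]]
          partial_mult(1)[OF partial_linear(2)[OF lin(2)] hp[OF de(1)]]
          partial_linear(1)[OF lin(1)] partial_linear(1)[OF lin(2)] ..
      finally show ?thesis using g(2) h(2) de b x by (simp add: G_def)
    qed
    ultimately show ?thesis
      using boundary_tangential[of R ?W "G d e" z b c] R z bc by blast
  qed
  define Y where "Y = (\<lambda>d e. \<Sum>b\<in>Basis. (z \<bullet> b) * G d e b z)"
  have t3: "R\<^sup>2 * G d e c z = (z \<bullet> c) * Y d e" if de: "d \<in> Basis" "e \<in> Basis" and c: "c \<in> Basis" for d e c
  proof -
    have "(\<Sum>b\<in>Basis. (z \<bullet> b) * (z \<bullet> b)) * G d e c z = (\<Sum>b\<in>Basis. (z \<bullet> b) * ((z \<bullet> b) * G d e c z))"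
      by (simp add: sum_distrib_left mult_ac)
    also have "\<dots> = (\<Sum>b\<in>Basis. (z \<bullet> b) * ((z \<bullet> c) * G d e b z))"
      using t2[OF de _ c] by simp
    finally show ?thesis unfolding zz[OF z] by (simp add: Y_def sum_distrib_left mult_ac)
  qed
  \<comment> \<open>Contracting with \<open>z\<close> in the index \<open>d\<close> turns the sum of
    the z_d^2 into the factor \<open>R\<^sup>2\<close> in front of \<open>h c e z\<close>; every
    other term has \<open>z\<close> in one index, or becomes so by the gradient formula, except the
    multiple \<open>v\<close> of the identity.\<close>
  have t4: "R\<^sup>2 * ((z \<bullet> c) * g e z + R\<^sup>2 * h c e z - ((c \<bullet> e) * v + (z \<bullet> e) * (\<Sum>d\<in>Basis. (z \<bullet> d) * h c d z)))
      = (z \<bullet> c) * (\<Sum>d\<in>Basis. (z \<bullet> d) * Y d e)" if c: "c \<in> Basis" and e: "e \<in> Basis" for c e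
  proof -
    have "(\<Sum>d\<in>Basis. (z \<bullet> d) * (R\<^sup>2 * G d e c z)) = (\<Sum>d\<in>Basis. (z \<bullet> d) * ((z \<bullet> c) * Y d e))"
      using t3[OF _ e c] by simp
    moreover have "(\<Sum>d\<in>Basis. (z \<bullet> d) * (R\<^sup>2 * G d e c z))
      = R\<^sup>2 * ((\<Sum>d\<in>Basis. (z \<bullet> d) * (c \<bullet> d)) * g e z + (\<Sum>d\<in>Basis. (z \<bullet> d) * (z \<bullet> d)) * h c e z
         - ((c \<bullet> e) * v + (z \<bullet> e) * (\<Sum>d\<in>Basis. (z \<bullet> d) * h c d z)))"
      unfolding G_def v_def
      by (simp add: sum_distrib_left sum_distrib_right sum.distrib sum_subtractf algebra_simps)
    moreover have "(\<Sum>d\<in>Basis. (z \<bullet> d) * ((z \<bullet> c) * Y d e)) = (z \<bullet> c) * (\<Sum>d\<in>Basis. (z \<bullet> d) * Y d e)"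
      by (simp add: sum_distrib_left mult_ac)
    moreover have "(\<Sum>d\<in>Basis. (z \<bullet> d) * (c \<bullet> d)) = z \<bullet> c" by (simp only: euclidean_inner[symmetric])
    ultimately show ?thesis unfolding zz[OF z] by simp
  qed
  have fin: "R\<^sup>2 * h c e z = (if c = e then v else 0) + (\<Sum>d\<in>Basis. (z \<bullet> d) * h c d z) * (z \<bullet> e)
      + (z \<bullet> c) * ((\<Sum>d\<in>Basis. (z \<bullet> d) * Y d e) / R\<^sup>2 - g e z)" if c: "c \<in> Basis" and e: "e \<in> Basis" for c e
  proof -
    have aux: "a * (x + r - (d * v + y * s)) = t' \<Longrightarrow> a \<noteq> 0 \<Longrightarrow> d * v = w \<Longrightarrow> t' = q * t \<Longrightarrow> x = q * x'
        \<Longrightarrow> r = w + s * y + q * (t / a - x')" for a x x' r w y s t t' q d :: real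
      by (simp add: field_simps)
    have "(c \<bullet> e) * v = (if c = e then v else 0)" using c e by (simp add: inner_Basis)
    then show ?thesis by (intro aux[OF t4[OF c e]]) (use R in simp_all)
  qed
  show "\<exists>\<alpha> \<beta>. \<forall>c\<in>Basis. \<forall>e\<in>Basis. R\<^sup>2 * h c e z
      = (if c = e then v else 0) + \<alpha> c * (z \<bullet> e) + (z \<bullet> c) * \<beta> e"
    by (rule exI[of _ "\<lambda>c. \<Sum>d\<in>Basis. (z \<bullet> d) * h c d z"],
        rule exI[of _ "\<lambda>e. (\<Sum>d\<in>Basis. (z \<bullet> d) * Y d e) / R\<^sup>2 - g e z"]) (intro ballI fin)
qed

text \<open>The profile (1 - t^2)^2 on [0, 1], continued by 1 and by 0. Both seams are continuously
  differentiable, which is the smoothness the integral identities ask of a cutoff.\<close>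

lemma smooth_cutoff_exists:
  fixes a b :: real
  assumes "a < b"
  shows "\<exists>f f'. (\<forall>s. (f has_real_derivative f' s) (at s)) \<and> continuous_on UNIV f' \<and>
    (\<forall>s. 0 \<le> f s \<and> f s \<le> 1 \<and> f' s \<le> 0) \<and> (\<forall>s\<le>a. f s = 1 \<and> f' s = 0) \<and> (\<forall>s\<ge>b. f s = 0)"
proof -
  define t where "t = (\<lambda>s. (s - a) / (b - a))"
  define f where "f = (\<lambda>s. max 0 (1 - max 0 (t s) powr 2) powr 2)"
  define f' where "f' = (\<lambda>s. 2 * max 0 (1 - max 0 (t s) powr 2) powr (2 - 1) * (- (2 * max 0 (t s) powr (2 - 1) * (1 / (b - a)))))"
  have td: "(t has_real_derivative 1 / (b - a)) (at s)" for s
    unfolding t_def using assms by (auto intro!: derivative_eq_intros)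
  have q: "((\<lambda>y. max 0 y powr 2) has_real_derivative 2 * max 0 y powr (2 - 1)) (at y)" for y :: real
    by (rule has_real_derivative_max0_powr) simp
  have d1: "((\<lambda>s. 1 - max 0 (t s) powr 2) has_real_derivative - (2 * max 0 (t s) powr (2 - 1) * (1 / (b - a)))) (at s)" for s
    using DERIV_diff[OF DERIV_const DERIV_chain2[OF q td]] by simp
  have d2: "(f has_real_derivative f' s) (at s)" for s
    unfolding f_def f'_def by (rule DERIV_chain2[OF q d1])
  have "continuous_on UNIV t" unfolding t_def using assms by (intro continuous_intros) auto
  then have c: "continuous_on UNIV f'"
    unfolding f'_def using assms
    by (intro continuous_intros continuous_on_powr') auto
  show ?thesis
  proof (rule exI[of _ f], rule exI[of _ f'], intro conjI allI impI c)
    fix s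
    show "(f has_real_derivative f' s) (at s)" by (rule d2)
    show "0 \<le> f s" by (simp add: f_def)
    have "max 0 (1 - max 0 (t s) powr 2) powr 2 \<le> 1 powr 2"
      by (intro powr_mono2) auto
    then show "f s \<le> 1" by (simp add: f_def)
    show "f' s \<le> 0" unfolding f'_def using assms by (intro mult_nonneg_nonpos) auto
    show "f s = 1" "f' s = 0" if "s \<le> a"
    proof -
      have "t s \<le> 0" using that assms by (simp add: t_def divide_nonpos_pos)
      then show "f s = 1" "f' s = 0" by (simp_all add: f_def f'_def)
    qed
    show "f s = 0" if "s \<ge> b"
    proof -
      have "1 \<le> t s" using that assms by (simp add: t_def)
      then have "1 powr 2 \<le> max 0 (t s) powr 2" by (intro powr_mono2) auto
      then show ?thesis by (simp add: f_def)
    qed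
  qed
qed

text \<open>The part of the ball where \<open>f\<close> is at most \<open>m\<close> is compact and
  misses the sphere, so its points have norm bounded away from \<open>R\<close>.\<close>

lemma lower_bound_near_sphere:
  fixes f :: "'a::euclidean_space \<Rightarrow> real"
  assumes "continuous_on (cball 0 R) f" "\<And>z. z \<in> sphere 0 R \<Longrightarrow> m < f z" "0 < R" "r0 < R"
  shows "\<exists>r. r0 < r \<and> 0 < r \<and> r < R \<and> (\<forall>z\<in>cball 0 R. r \<le> norm z \<longrightarrow> m \<le> f z)"
proof -
  define K where "K = {z \<in> cball 0 R. f z \<le> m}"
  have "closed K"
    unfolding K_def by (intro continuous_on_closed_Collect_le assms(1) continuous_on_const closed_cball)
  moreover have "bounded K" by (rule bounded_subset[OF bounded_cball[of 0 R]]) (auto simp: K_def)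
  ultimately have K: "compact K" by (simp add: compact_eq_bounded_closed)
  show ?thesis
  proof (cases "K = {}")
    case True
    then have "m \<le> f z" if "z \<in> cball 0 R" for z using that by (force simp: K_def)
    then show ?thesis using assms(3,4) by (intro exI[of _ "(max r0 0 + R) / 2"]) auto
  next
    case False
    obtain x where x: "x \<in> K" "\<And>y. y \<in> K \<Longrightarrow> norm y \<le> norm x"
      using continuous_attains_sup[OF K False, of norm] by (auto intro: continuous_intros)
    have "norm x < R" using x(1) assms(2)[of x] by (auto simp: K_def less_le)
    then show ?thesis using assms(3,4) x(2)
      by (intro exI[of _ "(max (max r0 0) (norm x) + R) / 2"]) (force simp: K_def not_le less_imp_le)
  qed
qed

section \<open>Nonexistence\<close>

lemma continuous_on_polar_S:
  assumes "\<And>i j. continuous_on S (\<lambda>z. A z i j)" "\<And>i j. continuous_on S (\<lambda>z. C z i j)"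
  shows "continuous_on S (\<lambda>z. polar_S k (A z) (C z))"
  unfolding polar_S_def ksum_def by (intro continuous_intros assms)

lemma C_closure_2_extensions:
  fixes u :: "'a::euclidean_space \<Rightarrow> real"
  assumes "C_closure 2 (ball 0 R) u" "0 < R"
  obtains g h where
    "\<And>b. b \<in> Basis \<Longrightarrow> continuous_on (cball 0 R) (g b)"
    "\<And>b z. b \<in> Basis \<Longrightarrow> z \<in> ball 0 R \<Longrightarrow> g b z = partial b u z"
    "\<And>b c. b \<in> Basis \<Longrightarrow> c \<in> Basis \<Longrightarrow> continuous_on (cball 0 R) (h b c)"
    "\<And>b c z. b \<in> Basis \<Longrightarrow> c \<in> Basis \<Longrightarrow> z \<in> ball 0 R \<Longrightarrow> h b c z = partial b (partial c u) z"
proof -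
  have ex: "\<exists>g. continuous_on (cball 0 R) g \<and> (\<forall>x\<in>ball 0 R. g x = iter_partial bs u x)"
    if "set bs \<subseteq> Basis" "length bs \<le> 2" for bs
    using assms that by (auto simp: C_closure_def)
  define E where "E = (\<lambda>bs. SOME g. continuous_on (cball 0 R) g \<and> (\<forall>x\<in>ball 0 R. g x = iter_partial bs u x))"
  have E: "continuous_on (cball 0 R) (E bs)" "x \<in> ball 0 R \<Longrightarrow> E bs x = iter_partial bs u x"
    if "set bs \<subseteq> Basis" "length bs \<le> 2" for bs x
    using someI_ex[OF ex[OF that]] unfolding E_def by auto
  show ?thesis
    by (rule that[of "\<lambda>b. E [b]" "\<lambda>b c. E [b, c]"]) (auto simp: E iter_partial_def)
qed

text \<open>The complex Hessian written in real second derivatives \<open>h b c\<close>. In this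
  form it makes sense on the closed ball, where only the continuous extensions of the derivatives
  are given.\<close>

definition hess_ext :: "(complex ^ 'n \<Rightarrow> complex ^ 'n \<Rightarrow> complex ^ 'n \<Rightarrow> real) \<Rightarrow> complex ^ 'n \<Rightarrow> 'n::finite \<Rightarrow> 'n \<Rightarrow> complex" where
  "hess_ext h z i j =
    (of_real (h (axis j 1) (axis i 1) z) + \<i> * of_real (h (axis j \<i>) (axis i 1) z)
     - \<i> * of_real (h (axis j 1) (axis i \<i>) z) + of_real (h (axis j \<i>) (axis i \<i>) z)) / 4"

lemma partial_partial_of_real:
  fixes u :: "complex ^ 'n::finite \<Rightarrow> real"
  assumes u: "C_on 2 S u" and S: "open S" "z \<in> S" and bc: "b \<in> Basis" "c \<in> Basis"
  shows "partial b (partial c (\<lambda>z. complex_of_real (u z))) z = of_real (partial b (partial c u) z)"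
proof -
  have "partial b (partial c (\<lambda>z. complex_of_real (u z))) z = partial b (\<lambda>z. complex_of_real (partial c u z)) z"
    using u bc by (intro partial_cong(1)[OF S] partial_of_real(1)) (auto simp: numeral_2_eq_2 C_on_Suc)
  also have "\<dots> = of_real (partial b (partial c u) z)"
    using u bc S by (intro partial_of_real(1)) (auto simp: numeral_2_eq_2 C_on_Suc)
  finally show ?thesis .
qed

lemma hess_of_real:
  fixes u :: "complex ^ 'n::finite \<Rightarrow> real"
  assumes u: "C_on 2 S u" and S: "open S" "z \<in> S"
  shows "hess (\<lambda>z. complex_of_real (u z)) z i j = hess_ext (\<lambda>b c. partial b (partial c u)) z i j"
proof -
  have U: "C_on 2 S (\<lambda>z. complex_of_real (u z))"
    by (rule C_on_bounded_linear[OF S(1) bounded_linear_of_real u])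
  show ?thesis
    unfolding hess_def wirt_def[of "-\<i>"] partial_wirt[OF U S(2) axis_Basis(1) S(1)] partial_wirt[OF U S(2) axis_Basis(2) S(1)]
    by (simp add: wirt_def partial_partial_of_real[OF u S] axis_Basis hess_ext_def field_simps)
qed

text \<open>Real terms with a factor \<open>z\<close> in one index become complex ones with factor
  z_j or its conjugate. The coefficient of the identity is halved, since the real and the imaginary
  direction contribute one quarter each.\<close>

lemma hess_ext_rank_one:
  fixes z :: "complex ^ 'n::finite"
  assumes R: "0 < R" and h: "\<And>c e. c \<in> Basis \<Longrightarrow> e \<in> Basis \<Longrightarrow> R\<^sup>2 * h c e z
      = (if c = e then v else 0) + \<alpha> c * (z \<bullet> e) + (z \<bullet> c) * \<beta> e"
  shows "\<exists>c d. hess_ext h z = (\<lambda>i j. of_real (v / (2 * R\<^sup>2)) * (if i = j then 1 else 0) + cnj (z $ i) * c j + d i * z $ j)"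
proof -
  let ?c = "\<lambda>j. (of_real (\<alpha> (axis j 1)) + \<i> * of_real (\<alpha> (axis j \<i>))) / (4 * of_real (R\<^sup>2))"
  let ?d = "\<lambda>i. (of_real (\<beta> (axis i 1)) - \<i> * of_real (\<beta> (axis i \<i>))) / (4 * of_real (R\<^sup>2))"
  have R2: "complex_of_real (R\<^sup>2) \<noteq> 0" using R by simp
  have ax: "axis j (1::complex) = axis i 1 \<longleftrightarrow> i = j" "axis j \<i> = axis i \<i> \<longleftrightarrow> i = j"
    "axis j (1::complex) \<noteq> axis i \<i>" "axis j \<i> \<noteq> axis i (1::complex)" for i j :: 'n
    by (auto simp: axis_eq_axis)
  have "hess_ext h z i j = of_real (v / (2 * R\<^sup>2)) * (if i = j then 1 else 0) + cnj (z $ i) * ?c j + ?d i * z $ j" for i j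
  proof -
    have e: "complex_of_real (R\<^sup>2) * of_real (h c e z)
        = of_real ((if c = e then v else 0) + \<alpha> c * (z \<bullet> e) + (z \<bullet> c) * \<beta> e)" if "c \<in> Basis" "e \<in> Basis" for c e
      using arg_cong[OF h[OF that], of complex_of_real] by simp
    have "of_real (R\<^sup>2) * hess_ext h z i j = (of_real (R\<^sup>2) * of_real (h (axis j 1) (axis i 1) z) + \<i> * (of_real (R\<^sup>2) * of_real (h (axis j \<i>) (axis i 1) z))
     - \<i> * (of_real (R\<^sup>2) * of_real (h (axis j 1) (axis i \<i>) z)) + of_real (R\<^sup>2) * of_real (h (axis j \<i>) (axis i \<i>) z)) / 4"
      unfolding hess_ext_def by (simp add: algebra_simps)
    also have "\<dots> = (if i = j then of_real v / 2 else 0)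
        + cnj (z $ i) * ((of_real (\<alpha> (axis j 1)) + \<i> * of_real (\<alpha> (axis j \<i>))) / 4)
        + (of_real (\<beta> (axis i 1)) - \<i> * of_real (\<beta> (axis i \<i>))) / 4 * z $ j"
      unfolding e[OF axis_Basis(1) axis_Basis(1)] e[OF axis_Basis(1) axis_Basis(2)] e[OF axis_Basis(2) axis_Basis(1)]
        e[OF axis_Basis(2) axis_Basis(2)] inner_axis_Re ax
      by (cases "i = j") (simp_all add: ax complex_eq_iff, simp_all add: algebra_simps add_divide_distrib diff_divide_distrib)
    also have "\<dots> = of_real (R\<^sup>2) * (of_real (v / (2 * R\<^sup>2)) * (if i = j then 1 else 0) + cnj (z $ i) * ?c j + ?d i * z $ j)"
    proof -
      have "of_real (R\<^sup>2) * ?c j = (of_real (\<alpha> (axis j 1)) + \<i> * of_real (\<alpha> (axis j \<i>))) / 4"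
        "of_real (R\<^sup>2) * ?d i = (of_real (\<beta> (axis i 1)) - \<i> * of_real (\<beta> (axis i \<i>))) / 4"
        "of_real (R\<^sup>2) * (of_real (v / (2 * R\<^sup>2)) * (if i = j then 1 else 0)) = (if i = j then of_real v / 2 else (0::complex))"
        using R2 by simp_all
      then show ?thesis by (simp only: distrib_left mult.left_commute[of "of_real (R\<^sup>2)" "cnj (z $ i)"] mult.assoc[symmetric, of "of_real (R\<^sup>2)" "?d i"])
    qed
    finally show ?thesis using R2 by (metis mult_left_cancel)
  qed
  then have "hess_ext h z = (\<lambda>i j. of_real (v / (2 * R\<^sup>2)) * (if i = j then 1 else 0) + cnj (z $ i) * ?c j + ?d i * z $ j)"
    by (intro ext)
  show ?thesis by (rule exI[of _ ?c], rule exI[of _ ?d]) fact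
qed

theorem no_nonpositive_solution:
  fixes u :: "complex ^ 'n::finite \<Rightarrow> real"
  assumes k: "1 \<le> k" "k \<le> CARD('n)" and R: "0 < R" and p: "1 < p"
    and supercritical: "real k * (p + 1) \<le> real CARD('n) * (p - real k)"
    and u2: "C_closure 2 (ball 0 R) u" and u4: "C_on 4 (ball 0 R) u"
    and u_le: "\<And>z. z \<in> cball 0 R \<Longrightarrow> u z \<le> 0" and u0: "\<And>z. z \<in> sphere 0 R \<Longrightarrow> u z = 0"
    and eq: "\<And>z. z \<in> ball 0 R \<Longrightarrow>
      polar_S k (hess (\<lambda>z. of_real (u z)) z) (hess (\<lambda>z. of_real (u z)) z) = fact k * of_real ((- u z) powr p)"
    and z0: "z0 \<in> cball 0 R"
  shows "u z0 = 0"
proof (rule ccontr)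
  assume nz: "u z0 \<noteq> 0"
  define U where "U = (\<lambda>z. complex_of_real (u z))"
  note eq' = eq[folded U_def]
  define n where "n = CARD('n)"
  obtain g h where g: "\<And>b. b \<in> Basis \<Longrightarrow> continuous_on (cball 0 R) (g b)"
      "\<And>b z. b \<in> Basis \<Longrightarrow> z \<in> ball 0 R \<Longrightarrow> g b z = partial b u z"
    and h: "\<And>b c. b \<in> Basis \<Longrightarrow> c \<in> Basis \<Longrightarrow> continuous_on (cball 0 R) (h b c)"
      "\<And>b c z. b \<in> Basis \<Longrightarrow> c \<in> Basis \<Longrightarrow> z \<in> ball 0 R \<Longrightarrow> h b c z = partial b (partial c u) z"
    using C_closure_2_extensions[OF u2 R] by blast
  have u2': "C_on 2 (ball 0 R) u" and uc: "continuous_on (cball 0 R) u"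
    using u2 R by (auto simp: C_closure_def)
  have u1: "C_on 1 (ball 0 R) u" using C_on_mono[OF u2'] by simp
  have U2: "C_on 2 (ball 0 R) U" unfolding U_def
    by (rule C_on_bounded_linear[OF open_ball bounded_linear_of_real u2'])
  obtain c0 where c0: "c0 > 0" "\<And>B :: 'n \<Rightarrow> 'n \<Rightarrow> complex.
    polar_S k B (\<lambda>i j. if i = j then 1 else 0) = of_real c0 * (\<Sum>i\<in>UNIV. B i i)"
    using polar_S_mat1[OF k] by blast

  \<comment> \<open>\<open>N\<close> and \<open>E\<close> are the integrands that multiply
    \<open>\<theta>'\<close> in the Pohozaev identity and in the identity for the mass of (-u)^p,
    rewritten through the extensions \<open>g\<close> and \<open>h\<close> so that they are
    continuous up to the sphere.\<close>
  define v where "v = (\<lambda>z. \<Sum>b\<in>Basis. (z \<bullet> b) * g b z)"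
  define dU where "dU = (\<lambda>i z. (of_real (g (axis i 1) z) - \<i> * of_real (g (axis i \<i>) z)) / 2)"
  define dV where "dV = (\<lambda>j z. (of_real (g (axis j 1) z) + \<i> * of_real (g (axis j \<i>) z)) / 2
     + (\<Sum>b\<in>Basis. of_real (z \<bullet> b) * ((of_real (h (axis j 1) b z) + \<i> * of_real (h (axis j \<i>) b z)) / 2)))"
  define E where "E = (\<lambda>z. polar_S k (\<lambda>i j. dU i z * z $ j) (hess_ext h z))"
  define F where "F = (\<lambda>z. polar_S k (\<lambda>i j. cnj (z $ i) * dV j z) (hess_ext h z))"
  define w where "w = (\<lambda>z. max 0 (- u z) powr (p + 1))"
  define f0 where "f0 = (\<lambda>z. max 0 (- u z) powr p)"
  define c where "c = (p - k) / (k * (p + 1))"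
  define \<kappa> where "\<kappa> = 2 - 2 * real n * c"
  define N where "N = (\<lambda>z. of_real (v z) * E z - of_real (u z) * F z - of_real (2 * c * fact k * (z \<bullet> z) * w z))"
  \<comment> \<open>Supercriticality enters the argument through this sign.\<close>
  have \<kappa>: "\<kappa> \<le> 0"
  proof -
    have "0 < real k * (p + 1)" using k p by simp
    then have "1 \<le> real n * c" using supercritical by (simp add: c_def n_def le_divide_eq)
    then show ?thesis by (simp add: \<kappa>_def)
  qed

  have cu: "continuous_on (cball 0 R) (\<lambda>z. complex_of_real (f z))" if "continuous_on (cball 0 R) f" for f :: "complex ^ 'n \<Rightarrow> real"
    using that by (intro continuous_intros)
  have vc: "continuous_on (cball 0 R) v" unfolding v_def using g(1) by (intro continuous_intros) auto
  have hc: "continuous_on (cball 0 R) (\<lambda>z. hess_ext h z i j)" for i j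
    unfolding hess_ext_def using h(1) by (intro continuous_intros) (auto simp: axis_Basis)
  have Ec: "continuous_on (cball 0 R) E"
    unfolding E_def dU_def using g(1) by (intro continuous_on_polar_S hc continuous_intros) (auto simp: axis_Basis)
  have Fc: "continuous_on (cball 0 R) F"
    unfolding F_def dV_def using g(1) h(1) by (intro continuous_on_polar_S hc continuous_intros) (auto simp: axis_Basis)
  have pc: "continuous_on (cball 0 R) (\<lambda>z. max 0 (- u z) powr q)" if "0 < q" for q
    using continuous_on_compose2[OF continuous_max0_powr[OF that], of "cball 0 R" "\<lambda>z. - u z"] uc
    by (auto intro: continuous_intros)
  have wc: "continuous_on (cball 0 R) w" and f0c: "continuous_on (cball 0 R) f0"
    unfolding w_def f0_def using p by (auto intro!: pc)
  have Nc: "continuous_on (cball 0 R) N"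
    unfolding N_def by (intro continuous_intros vc Ec Fc wc uc)

  have mx: "max 0 (- u z) = - u z" if "z \<in> cball 0 R" for z using u_le[OF that] by simp
  have wU: "wirt d i U z = (of_real (g (axis i 1) z) + d * of_real (g (axis i \<i>) z)) / 2" if "z \<in> ball 0 R" for d i z
    using partial_of_real(1)[OF C_on_has_partial[OF u1 _ that]] g(2)[OF _ that]
    by (simp add: wirt_def U_def axis_Basis)
  have HH: "hess U z = hess_ext h z" if "z \<in> ball 0 R" for z
    using hess_of_real[OF u2' open_ball that] h(2)[OF _ _ that]
    by (intro ext) (simp add: U_def hess_ext_def axis_Basis)
  have VV: "euler U z = of_real (v z)" if "z \<in> ball 0 R" for z
    using partial_of_real(1)[OF C_on_has_partial[OF u1 _ that]] g(2)[OF _ that]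
    by (simp add: euler_def U_def v_def)
  have dV: "wirt \<i> j (euler U) z = dV j z" if z: "z \<in> ball 0 R" for j z
  proof -
    have "euler (wirt \<i> j U) z = (\<Sum>b\<in>Basis. of_real (z \<bullet> b) * ((of_real (h (axis j 1) b z) + \<i> * of_real (h (axis j \<i>) b z)) / 2))"
      unfolding euler_def using h(2)[OF _ _ z]
      by (intro sum.cong refl) (simp add: partial_wirt[OF U2 z _ open_ball], simp add: wirt_def U_def
          partial_partial_of_real[OF u2' open_ball z] axis_Basis)
    then show ?thesis unfolding wirt_euler[OF open_ball U2 z] wU[OF z] dV_def by simp
  qed
  have EE: "E z = polar_S k (\<lambda>i j. wirt (-\<i>) i U z * z $ j) (hess U z)" if "z \<in> ball 0 R" for z
    unfolding E_def dU_def HH[OF that] wU[OF that] by simp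
  have FF: "F z = polar_S k (\<lambda>i j. cnj (z $ i) * wirt \<i> j (euler U) z) (hess U z)" if "z \<in> ball 0 R" for z
    unfolding F_def HH[OF that] dV[OF that] ..

  define e where "e = c0 * R\<^sup>2"
  define C0 where "C0 = e / (2 * R\<^sup>2) ^ k"
  have e: "0 < e" and C0: "0 < C0" using c0 R by (auto simp: e_def C0_def)
  \<comment> \<open>On the sphere \<open>polar_S\<close> sees the Hessian only as v/(2 R^2) times
    the identity, so \<open>E\<close> is \<open>C0\<close> times v^k and \<open>N\<close> is v times
    \<open>E\<close>, the terms with \<open>u\<close> dropping out. Subtracting
    \<open>\<eta> * E\<close> leaves \<open>C0\<close> times (v - \<eta>) v^k: nonnegative for v at
    least \<eta>, and otherwise of modulus at most \<open>C0 * \<eta> ^ (k + 1)\<close>.\<close>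
  have sphere: "- (C0 * \<eta> ^ (k + 1)) \<le> Re (N z - of_real \<eta> * E z)" if z: "z \<in> sphere 0 R" and \<eta>: "0 < \<eta>" for z \<eta>
  proof -
    have v0: "0 \<le> v z" unfolding v_def
      by (rule boundary_radial_nonneg[OF u1 uc R u0 _ g z]) (use u_le in auto)
    obtain \<alpha> \<beta> where ab: "\<forall>c\<in>Basis. \<forall>e\<in>Basis. R\<^sup>2 * h c e z
      = (if c = e then v z else 0) + \<alpha> c * (z \<bullet> e) + (z \<bullet> c) * \<beta> e"
      using boundary_hessian(2)[where g = g and h = h, OF u2' uc R u0 g h z] unfolding v_def by blast
    obtain cc dd where H: "hess_ext h z = (\<lambda>i j. of_real (v z / (2 * R\<^sup>2)) * (if i = j then 1 else 0) + cnj (z $ i) * cc j + dd i * z $ j)"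
      using hess_ext_rank_one[OF R, of h z "v z" \<alpha> \<beta>] ab by blast
    have g1: "R\<^sup>2 * g b z = v z * (z \<bullet> b)" if "b \<in> Basis" for b
      unfolding v_def by (rule boundary_hessian(1)[where g = g and h = h, OF u2' uc R u0 g h z that])
    have g1': "g b z = v z / R\<^sup>2 * (z \<bullet> b)" if "b \<in> Basis" for b
      using g1[OF that] R by (simp add: field_simps)
    have dUz: "dU i z = of_real (v z / (2 * R\<^sup>2)) * cnj (z $ i)" for i
      unfolding dU_def g1'[OF axis_Basis(1)] g1'[OF axis_Basis(2)] inner_axis_Re
      by (simp add: complex_eq_iff)
    let ?s = "complex_of_real (v z / (2 * R\<^sup>2))"
    have zz: "(\<Sum>i\<in>UNIV. cnj (z $ i) * z $ i) = of_real (R\<^sup>2)"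
    proof -
      have "(\<Sum>i\<in>UNIV. cnj (z $ i) * z $ i) = of_real (\<Sum>i\<in>UNIV. (cmod (z $ i))\<^sup>2)"
        unfolding of_real_sum by (intro sum.cong refl) (simp add: complex_norm_square[symmetric] mult.commute)
      also have "(\<Sum>i\<in>UNIV. (cmod (z $ i))\<^sup>2) = (norm z)\<^sup>2"
        by (simp add: norm_vec_def L2_set_def sum_nonneg)
      finally show ?thesis using z by simp
    qed
    have "E z = polar_S k (\<lambda>i j. ?s * (cnj (z $ i) * z $ j)) (hess_ext h z)"
      unfolding E_def dUz by (simp add: mult.assoc)
    also have "\<dots> = ?s * polar_S k (\<lambda>i j. cnj (z $ i) * z $ j) (\<lambda>i j. ?s * (if i = j then 1 else 0))"
      unfolding polar_S_cmult H polar_S_rank_one_absorb ..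
    also have "\<dots> = ?s * (?s ^ (k - 1) * (of_real c0 * of_real (R\<^sup>2)))"
      unfolding polar_S_scale c0(2) zz ..
    also have "\<dots> = of_real (e * (v z / (2 * R\<^sup>2)) ^ k)"
      using k by (cases k) (simp_all add: e_def)
    also have "e * (v z / (2 * R\<^sup>2)) ^ k = C0 * v z ^ k" by (simp add: C0_def power_divide)
    finally have Ez: "E z = of_real (C0 * v z ^ k)" .
    have wz: "w z = 0" using u0[OF z] by (simp add: w_def)
    have "Re (N z - of_real \<eta> * E z) = (v z - \<eta>) * (C0 * v z ^ k)"
      using u0[OF z] wz by (simp add: N_def Ez algebra_simps)
    also have "\<dots> \<ge> - (C0 * \<eta> ^ (k + 1))"
    proof (cases "v z \<ge> \<eta>")
      case True
      then have "0 \<le> (v z - \<eta>) * (C0 * v z ^ k)" using v0 C0 by (intro mult_nonneg_nonneg) auto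
      moreover have "0 \<le> C0 * \<eta> ^ (k + 1)" using C0 \<eta> by simp
      ultimately show ?thesis by linarith
    next
      case False
      have "(\<eta> - v z) * (C0 * v z ^ k) \<le> \<eta> * (C0 * \<eta> ^ k)"
        using False v0 C0 \<eta> by (intro mult_mono power_mono) auto
      then show ?thesis by (simp add: algebra_simps)
    qed
    finally show ?thesis .
  qed

  have z0b: "z0 \<in> ball 0 R" and u_neg: "u z0 < 0"
    using z0 nz u0[of z0] u_le[OF z0] by (auto simp: less_le)
  have f0z: "f0 z0 > 0" using u_neg by (simp add: f0_def)
  define m where "m = f0 z0 / 2"
  have m: "m > 0" using f0z by (simp add: m_def)
  obtain d where d: "d > 0" "norm z0 + d < R" "\<And>z. z \<in> cball z0 d \<Longrightarrow> m \<le> f0 z"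
  proof -
    obtain d1 where d1: "d1 > 0" "\<And>z. z \<in> cball 0 R \<Longrightarrow> dist z z0 < d1 \<Longrightarrow> dist (f0 z) (f0 z0) < m"
      using f0c z0 m unfolding continuous_on_iff by metis
    define d where "d = min d1 (R - norm z0) / 2"
    have "R - norm z0 > 0" using z0b by simp
    moreover from this have "d \<le> (R - norm z0) / 2" "d \<le> d1 / 2" "d > 0" using d1(1) by (auto simp: d_def)
    moreover have "x + y < r" if "0 < r - x" "y \<le> (r - x) / 2" for x y r :: real
      using that by (simp add: field_simps)
    ultimately have d: "d > 0" "d < d1" "norm z0 + d < R" using d1(1) by (blast, linarith, blast)
    show ?thesis
    proof (rule that[OF d(1,3)])
      fix z assume z: "z \<in> cball z0 d"
      have "norm z \<le> norm z0 + d" using z norm_triangle_sub[of z z0] by (simp add: dist_norm norm_minus_commute)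
      then have "dist (f0 z) (f0 z0) < m" using z d by (intro d1(2)) (auto simp: dist_commute)
      then show "m \<le> f0 z" unfolding dist_real_def m_def by linarith
    qed
  qed
  \<comment> \<open>A cutoff equal to 1 up to a radius beyond \<open>r0\<close> is 1 on
    \<open>cball z0 d\<close>, and its derivative is nonzero only where |z| exceeds R/2.\<close>
  define r0 where "r0 = max (norm z0 + d) (R / 2)"
  have r0: "r0 < R" "norm z0 + d \<le> r0" "R / 2 \<le> r0" using d R by (auto simp: r0_def)

  define v0 where "v0 = measure lborel (cball z0 d)"
  have v0: "v0 > 0" unfolding v0_def using d(1) by (simp add: content_cball_pos)
  define A where "A = 8 * C0 / R\<^sup>2 * real n * measure lborel (cball (0 :: complex ^ 'n) R)"
  have A: "A > 0" unfolding A_def n_def using C0 R by (simp add: content_cball_pos)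

  \<comment> \<open>The left side is linear in \<open>\<eta>\<close> and the right side of order
    \<open>k + 1\<close>, while \<open>m\<close>, \<open>v0\<close> and \<open>A\<close> depend
    neither on \<open>\<eta>\<close> nor on the cutoff.\<close>
  have key: "\<eta> * (fact k * m * v0) \<le> A * \<eta> ^ (k + 1)" if \<eta>: "0 < \<eta>" for \<eta>
  proof -
    define f where "f = (\<lambda>z. Re (N z - of_real \<eta> * E z))"
    have fc: "continuous_on (cball 0 R) f" unfolding f_def by (intro continuous_intros Nc Ec)
    have pos: "0 < C0 * \<eta> ^ (k + 1)" using C0 \<eta> by simp
    \<comment> \<open>Doubling the constant makes the bound strict, as is needed to extend it from
      the sphere to a shell.\<close>
    have "- (2 * (C0 * \<eta> ^ (k + 1))) < f z" if "z \<in> sphere 0 R" for z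
      using sphere[OF that \<eta>] pos unfolding f_def by linarith
    from lower_bound_near_sphere[OF fc this R r0(1)]
    obtain r where r: "r0 < r" "0 < r" "r < R" "\<And>z. z \<in> cball 0 R \<Longrightarrow> r \<le> norm z \<Longrightarrow> - (2 * (C0 * \<eta> ^ (k + 1))) \<le> f z"
      by blast
    define \<rho> where "\<rho> = (r + R) / 2"
    have \<rho>: "r < \<rho>" "0 < \<rho>" "\<rho> < R" using r R by (auto simp: \<rho>_def)
    have "r\<^sup>2 < \<rho>\<^sup>2" using \<rho> r by (intro power_strict_mono) auto
    then obtain \<theta> \<theta>' where \<theta>: "\<And>s. (\<theta> has_real_derivative \<theta>' s) (at s)" "continuous_on UNIV \<theta>'"
      "\<And>s. 0 \<le> \<theta> s" "\<And>s. \<theta> s \<le> 1" "\<And>s. \<theta>' s \<le> 0" "\<And>s. s \<le> r\<^sup>2 \<Longrightarrow> \<theta> s = 1" "\<And>s. s \<le> r\<^sup>2 \<Longrightarrow> \<theta>' s = 0"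
      "\<And>s. \<rho>\<^sup>2 \<le> s \<Longrightarrow> \<theta> s = 0"
      using smooth_cutoff_exists[of "r\<^sup>2" "\<rho>\<^sup>2"] by blast
    let ?K = "cball (0 :: complex ^ 'n) \<rho>"
    have K: "compact ?K" "?K \<subseteq> ball 0 R" "?K \<subseteq> cball 0 R" using \<rho> by auto
    have Kb: "?K \<in> sets lborel" by simp
    have em: "emeasure lborel (cball x s) < top" for x :: "complex ^ 'n" and s
      using emeasure_bounded_finite[OF bounded_cball, of x s] by (simp add: infinity_ennreal_def)
    have sq: "continuous_on ?K (\<lambda>z. z \<bullet> z)" by (intro continuous_intros)
    note poh = u4 u_le[OF subsetD[OF ball_subset_cball]] p k(1) eq \<rho>(2,3) \<theta>(1,2,8)
    \<comment> \<open>Chosen so that \<open>c3\<close> times R^2/4, a lower bound for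
      \<open>c3\<close> times |z|^2 where \<open>\<theta>'\<close> is nonzero, compensates the lower
      bound of \<open>f\<close> in the shell.\<close>
    define c3 where "c3 = 8 * C0 * \<eta> ^ (k + 1) / R\<^sup>2"
    have c3: "0 \<le> c3" using C0 \<eta> R by (simp add: c3_def)
    define I1 where "I1 = (\<lambda>z. of_real (\<theta> (z \<bullet> z)) * of_real (fact k * \<kappa> * w z) + of_real (\<theta>' (z \<bullet> z)) * N z)"
    define I2 where "I2 = (\<lambda>z. of_real (\<theta> (z \<bullet> z)) * of_real (fact k * f0 z) + of_real (\<theta>' (z \<bullet> z)) * E z)"
    define I3 where "I3 = (\<lambda>z::complex ^ 'n. of_real (real n) * complex_of_real (\<theta> (z \<bullet> z)) + of_real (\<theta>' (z \<bullet> z) * (z \<bullet> z)))"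
    have J1: "(LINT z:?K|lborel. I1 z) = 0"
    proof -
      have "(LINT z:?K|lborel. I1 z) = (LINT z:?K|lborel. of_real (\<theta> (z \<bullet> z)) * of_real (fact k * (2 - 2 * real CARD('n) * c) * (- u z) powr (p + 1))
        + of_real (\<theta>' (z \<bullet> z)) *
        (euler U z * polar_S k (\<lambda>i j. wirt (-\<i>) i U z * z $ j) (hess U z)
         - U z * polar_S k (\<lambda>i j. cnj (z $ i) * wirt \<i> j (euler U) z) (hess U z)
         - of_real (2 * c * fact k * (z \<bullet> z) * (- u z) powr (p + 1))))"
      proof (rule set_lebesgue_integral_cong[OF Kb], intro allI impI)
        fix z assume "z \<in> ?K"
        then have z: "z \<in> ball 0 R" "z \<in> cball 0 R" using K by auto
        show "I1 z = of_real (\<theta> (z \<bullet> z)) * of_real (fact k * (2 - 2 * real CARD('n) * c) * (- u z) powr (p + 1))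
        + of_real (\<theta>' (z \<bullet> z)) *
        (euler U z * polar_S k (\<lambda>i j. wirt (-\<i>) i U z * z $ j) (hess U z)
         - U z * polar_S k (\<lambda>i j. cnj (z $ i) * wirt \<i> j (euler U) z) (hess U z)
         - of_real (2 * c * fact k * (z \<bullet> z) * (- u z) powr (p + 1)))"
          unfolding I1_def N_def EE[OF z(1), symmetric] FF[OF z(1), symmetric] VV[OF z(1)] w_def mx[OF z(2)]
          by (simp only: \<kappa>_def n_def U_def)
      qed
      also have "\<dots> = 0"
        using pohozaev_identity[OF poh] by (simp only: U_def c_def)
      finally show ?thesis .
    qed
    have J2: "(LINT z:?K|lborel. I2 z) = 0"
    proof -
      have "(LINT z:?K|lborel. I2 z) = (LINT z:?K|lborel. of_real (\<theta> (z \<bullet> z)) * of_real (fact k * (- u z) powr p)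
        + of_real (\<theta>' (z \<bullet> z)) * polar_S k (\<lambda>i j. wirt (-\<i>) i U z * z $ j) (hess U z))"
      proof (rule set_lebesgue_integral_cong[OF Kb], intro allI impI)
        fix z assume "z \<in> ?K"
        then have z: "z \<in> ball 0 R" "z \<in> cball 0 R" using K by auto
        show "I2 z = of_real (\<theta> (z \<bullet> z)) * of_real (fact k * (- u z) powr p)
        + of_real (\<theta>' (z \<bullet> z)) * polar_S k (\<lambda>i j. wirt (-\<i>) i U z * z $ j) (hess U z)"
          unfolding I2_def EE[OF z(1), symmetric] f0_def mx[OF z(2)] ..
      qed
      also have "\<dots> = 0"
        using integral_S_identity[OF poh] by (simp only: U_def)
      finally show ?thesis .
    qed
    have J3: "(LINT z:?K|lborel. I3 z) = 0"
      using integral_cutoff_identity[OF poh] by (simp only: I3_def n_def)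
    have th: "continuous_on ?K (\<lambda>z. \<theta> (z \<bullet> z))" "continuous_on ?K (\<lambda>z. \<theta>' (z \<bullet> z))"
      using continuous_on_compose2[OF DERIV_continuous_on[of UNIV \<theta> \<theta>'], of ?K "\<lambda>z. z \<bullet> z"] \<theta>(1)
        continuous_on_compose2[OF \<theta>(2), of ?K "\<lambda>z. z \<bullet> z"] sq by auto
    have int: "set_integrable lborel ?K I1" "set_integrable lborel ?K I2" "set_integrable lborel ?K I3"
      unfolding I1_def I2_def I3_def
      by (intro set_integrable_continuous K(1) continuous_intros th
          continuous_on_subset[OF wc K(3)] continuous_on_subset[OF Nc K(3)] continuous_on_subset[OF Ec K(3)]
          continuous_on_subset[OF f0c K(3)])+
    define I where "I = (\<lambda>z. I1 z - of_real \<eta> * I2 z + of_real c3 * I3 z)"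
    have intI: "set_integrable lborel ?K I" unfolding I_def using int by simp
    have "(LINT z:?K|lborel. I z) = 0"
      using int J1 J2 J3 unfolding I_def by (simp add: set_integral_add)
    then have "0 = Re (LINT z|lborel. indicator ?K z *\<^sub>R I z)"
      by (simp add: set_lebesgue_integral_def)
    also have "\<dots> = (LINT z|lborel. Re (indicator ?K z *\<^sub>R I z))"
      by (rule integral_Re[symmetric]) (use intI in \<open>simp only: set_integrable_def\<close>)
    also have "\<dots> \<le> (LINT z|lborel. c3 * real n * indicator ?K z - \<eta> * fact k * m * indicator (cball z0 d) z)"
    proof (rule integral_mono)
      show "integrable lborel (\<lambda>z. Re (indicator ?K z *\<^sub>R I z))"
        by (rule integrable_Re) (use intI in \<open>simp only: set_integrable_def\<close>)
      show "integrable lborel (\<lambda>z. c3 * real n * indicator ?K z - \<eta> * fact k * m * indicator (cball z0 d) z)"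
        by (intro Bochner_Integration.integrable_diff integrable_mult_right integrable_real_indicator)
          (auto simp: em)
      fix z :: "complex ^ 'n"
      show "Re (indicator ?K z *\<^sub>R I z) \<le> c3 * real n * indicator ?K z - \<eta> * fact k * m * indicator (cball z0 d) z"
      proof (cases "z \<in> ?K")
        case False
        have "norm z \<le> norm z0 + d" if "z \<in> cball z0 d"
          using that norm_triangle_sub[of z z0] by (simp add: dist_norm norm_minus_commute)
        then have "z \<notin> cball z0 d" using False r0 r(1) \<rho>(1) by auto
        then show ?thesis using False by simp
      next
        case True
        then have z: "z \<in> cball 0 R" using K by auto
        have "Re (I z) = \<theta> (z \<bullet> z) * fact k * \<kappa> * w z - \<eta> * (\<theta> (z \<bullet> z) * fact k * f0 z)
            + c3 * real n * \<theta> (z \<bullet> z) + \<theta>' (z \<bullet> z) * (f z + c3 * (z \<bullet> z))"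
          by (simp add: I_def I1_def I2_def I3_def f_def algebra_simps)
        moreover have "\<theta> (z \<bullet> z) * fact k * \<kappa> * w z \<le> 0"
          using \<theta>(3)[of "z \<bullet> z"] \<kappa> by (intro mult_nonpos_nonneg mult_nonneg_nonpos) (auto simp: w_def)
        moreover have "\<theta>' (z \<bullet> z) * (f z + c3 * (z \<bullet> z)) \<le> 0"
        proof (cases "norm z \<le> r")
          case True
          then have "z \<bullet> z \<le> r\<^sup>2" unfolding power2_norm_eq_inner[symmetric] by (intro power_mono) auto
          then show ?thesis using \<theta>(7) by simp
        next
          case False
          have "(R / 2)\<^sup>2 \<le> (norm z)\<^sup>2" using False r0(3) r(1) R by (intro power_mono) auto
          then have "R\<^sup>2 / 4 \<le> z \<bullet> z" by (simp add: power2_norm_eq_inner power_divide)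
          then have "c3 * (R\<^sup>2 / 4) \<le> c3 * (z \<bullet> z)" by (intro mult_left_mono c3)
          moreover have "c3 * (R\<^sup>2 / 4) = 2 * (C0 * \<eta> ^ (k + 1))" using R by (simp add: c3_def)
          ultimately have "0 \<le> f z + c3 * (z \<bullet> z)" using r(4)[OF z] False by linarith
          then show ?thesis using \<theta>(5) by (intro mult_nonpos_nonneg)
        qed
        moreover have "c3 * real n * \<theta> (z \<bullet> z) \<le> c3 * real n * 1"
          using \<theta>(4) c3 by (intro mult_left_mono) auto
        moreover have "\<eta> * fact k * m * indicator (cball z0 d) z \<le> \<eta> * (\<theta> (z \<bullet> z) * fact k * f0 z)"
        proof (cases "z \<in> cball z0 d")
          case True
          have "norm z \<le> norm z0 + d"
            using True norm_triangle_sub[of z z0] by (simp add: dist_norm norm_minus_commute)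
          then have "norm z \<le> r" using r0 r(1) by linarith
          then have "z \<bullet> z \<le> r\<^sup>2" unfolding power2_norm_eq_inner[symmetric] by (intro power_mono) auto
          then have "\<theta> (z \<bullet> z) = 1" using \<theta>(6) by simp
          moreover have "\<eta> * fact k * m \<le> \<eta> * fact k * f0 z"
            using d(3)[OF True] \<eta> by (intro mult_left_mono) auto
          ultimately show ?thesis using True by simp
        next
          case False
          then show ?thesis using \<eta> \<theta>(3)[of "z \<bullet> z"] by (simp add: f0_def)
        qed
        ultimately show ?thesis using True by simp
      qed
    qed
    also have "\<dots> = c3 * real n * measure lborel ?K - \<eta> * fact k * m * v0"
    proof -
      have i: "integrable lborel (\<lambda>z. a * indicator (cball x s) z)" for a s :: real and x :: "complex ^ 'n"
        by (intro integrable_mult_right integrable_real_indicator) (auto simp: em)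
      show ?thesis by (subst Bochner_Integration.integral_diff[OF i i]) (simp add: v0_def)
    qed
    finally have "\<eta> * fact k * m * v0 \<le> c3 * real n * measure lborel ?K" by simp
    also have "\<dots> \<le> c3 * real n * measure lborel (cball (0 :: complex ^ 'n) R)"
      using c3 K(3) by (intro mult_left_mono measure_mono_fmeasurable) (auto simp: fmeasurable_def em)
    also have "\<dots> = A * \<eta> ^ (k + 1)" by (simp add: A_def c3_def)
    finally show ?thesis by (simp add: mult_ac)
  qed
  define Q where "Q = fact k * m * v0"
  have Q: "Q > 0" unfolding Q_def using m v0 by simp
  \<comment> \<open>The bound 1 lets \<open>\<eta> ^ k\<close> be replaced by \<open>\<eta>\<close>;
    the other bound then makes the right side at most \<open>Q / 2\<close>.\<close>
  define \<eta> where "\<eta> = min 1 (Q / (2 * A))"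
  have \<eta>: "0 < \<eta>" "\<eta> \<le> 1" using Q A by (auto simp: \<eta>_def)
  have "\<eta> * Q \<le> \<eta> * (A * \<eta> ^ k)" using key[OF \<eta>(1)] by (simp add: Q_def mult_ac)
  then have "Q \<le> A * \<eta> ^ k" using \<eta> by simp
  also have "\<dots> \<le> A * \<eta> ^ 1" using \<eta> A k by (intro mult_left_mono power_decreasing) auto
  also have "\<dots> \<le> A * (Q / (2 * A))" using A by (intro mult_left_mono) (auto simp: \<eta>_def)
  also have "\<dots> = Q / 2" using A by simp
  finally show False using Q by simp
qed

section \<open>The radial equation\<close>

text \<open>\<open>avg n h\<close> is the continuous solution \<open>y\<close> of $(s^n y)' = n s^{n-1} h$; the case
  distinction removes the singularity at \<open>0\<close>.\<close>

definition avg :: "nat \<Rightarrow> (real \<Rightarrow> real) \<Rightarrow> real \<Rightarrow> real" where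
  "avg n h t = (if t = 0 then h 0 else integral {0..t} (\<lambda>x. real n * x ^ (n - 1) * h x) / t ^ n)"

lemma avg_integrable:
  assumes "continuous_on {0..t} h"
  shows "(\<lambda>x. real n * x ^ (n - 1) * h x) integrable_on {0..t}"
  using assms by (intro integrable_continuous_real continuous_intros)

text \<open>The weight has total mass \<open>t ^ n\<close>, so \<open>avg n h t\<close> is a genuine
  mean of \<open>h\<close> over [0, t]; the bounds and limits of \<open>avg\<close> below are those
  of a mean.\<close>

lemma integral_power_weight:
  assumes "1 \<le> n" "0 \<le> t"
  shows "integral {0..t} (\<lambda>x. real n * x ^ (n - 1)) = t ^ n"
proof -
  have "((\<lambda>x. real n * x ^ (n - 1)) has_integral (t ^ n - 0 ^ n)) {0..t}"
  proof (rule fundamental_theorem_of_calculus[OF assms(2)])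
    fix x :: real
    have "((\<lambda>x. x ^ n) has_real_derivative real n * x ^ (n - 1)) (at x within {0..t})"
      by (auto intro!: derivative_eq_intros)
    then show "((\<lambda>x. x ^ n) has_vector_derivative real n * x ^ (n - 1)) (at x within {0..t})"
      by (simp add: has_real_derivative_iff_has_vector_derivative)
  qed
  then have "integral {0..t} (\<lambda>x. real n * x ^ (n - 1)) = t ^ n - 0 ^ n" by (rule integral_unique)
  then show ?thesis using assms by (simp add: zero_power)
qed

lemma avg_const: "1 \<le> n \<Longrightarrow> 0 \<le> t \<Longrightarrow> avg n (\<lambda>x. c) t = c"
  using integral_power_weight[of n t] by (simp add: avg_def)

lemma avg_mono:
  assumes "1 \<le> n" "0 \<le> t" "continuous_on {0..t} f" "continuous_on {0..t} g"
    and "\<And>x. x \<in> {0..t} \<Longrightarrow> f x \<le> g x"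
  shows "avg n f t \<le> avg n g t"
proof (cases "t = 0")
  case False
  have "integral {0..t} (\<lambda>x. real n * x ^ (n - 1) * f x) \<le> integral {0..t} (\<lambda>x. real n * x ^ (n - 1) * g x)"
    using assms by (intro integral_le avg_integrable mult_left_mono) auto
  then show ?thesis using assms False by (simp add: avg_def divide_right_mono)
qed (use assms in \<open>simp add: avg_def\<close>)

lemma avg_le:
  assumes "1 \<le> n" "0 \<le> t" "continuous_on {0..t} f" "\<And>x. x \<in> {0..t} \<Longrightarrow> f x \<le> c"
  shows "avg n f t \<le> c"
  using avg_mono[OF assms(1-3), of "\<lambda>_. c"] assms avg_const by auto

lemma avg_ge:
  assumes "1 \<le> n" "0 \<le> t" "continuous_on {0..t} f" "\<And>x. x \<in> {0..t} \<Longrightarrow> c \<le> f x"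
  shows "c \<le> avg n f t"
  using avg_mono[OF assms(1,2) _ assms(3), of "\<lambda>_. c"] assms avg_const by auto

lemma avg_diff_le:
  assumes "1 \<le> n" "0 \<le> t" "continuous_on {0..t} f" "continuous_on {0..t} g"
    and "\<And>x. x \<in> {0..t} \<Longrightarrow> \<bar>f x - g x\<bar> \<le> c"
  shows "\<bar>avg n f t - avg n g t\<bar> \<le> c"
proof -
  have "avg n (\<lambda>x. f x - g x) t = avg n f t - avg n g t"
  proof -
    have "(\<lambda>x. real n * x ^ (n - 1) * (f x - g x)) = (\<lambda>x. real n * x ^ (n - 1) * f x - real n * x ^ (n - 1) * g x)"
      by (simp only: right_diff_distrib)
    then show ?thesis unfolding avg_def
      by (simp only: integral_diff[OF avg_integrable[OF assms(3)] avg_integrable[OF assms(4)]] diff_divide_distrib) simp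
  qed
  moreover have "avg n (\<lambda>x. f x - g x) t \<le> c" "- c \<le> avg n (\<lambda>x. f x - g x) t"
    using assms by (intro avg_le avg_ge continuous_intros; force simp: abs_le_iff)+
  ultimately show ?thesis by linarith
qed

lemma avg_cong: "(\<And>x. x \<in> {0..t} \<Longrightarrow> f x = g x) \<Longrightarrow> 0 \<le> t \<Longrightarrow> avg n f t = avg n g t"
  unfolding avg_def by (auto intro!: arg_cong2[where f = "(/)"] integral_cong)

lemma avg_moment_derivative:
  assumes "continuous_on {0..S} h" "t \<in> {0..S}" "0 < t"
  shows "((\<lambda>t. t ^ n * avg n h t) has_real_derivative real n * t ^ (n - 1) * h t) (at t within {0..S})"
proof -
  have "((\<lambda>u. integral {0..u} (\<lambda>x. real n * x ^ (n - 1) * h x)) has_real_derivative real n * t ^ (n - 1) * h t) (at t within {0..S})"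
    using assms by (intro integral_has_real_derivative continuous_intros)
  then show ?thesis
    by (rule has_field_derivative_transform_within[where d = t]) (use assms in \<open>auto simp: avg_def dist_real_def\<close>)
qed

lemma avg_derivative:
  assumes "continuous_on {0..S} h" "t \<in> {0..S}" "0 < t" "1 \<le> n"
  shows "(avg n h has_real_derivative real n * (h t - avg n h t) / t) (at t within {0..S})"
proof -
  have "((\<lambda>t. t ^ n * avg n h t / t ^ n) has_real_derivative
    (real n * t ^ (n - 1) * h t * t ^ n - t ^ n * avg n h t * (real n * t ^ (n - 1))) / (t ^ n * t ^ n)) (at t within {0..S})"
    using assms by (intro DERIV_divide avg_moment_derivative) (auto intro!: derivative_eq_intros)
  moreover have "(real n * t ^ (n - 1) * h t * t ^ n - t ^ n * avg n h t * (real n * t ^ (n - 1))) / (t ^ n * t ^ n)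
    = real n * (h t - avg n h t) / t"
    using assms by (cases n) (simp_all add: field_simps)
  ultimately have "((\<lambda>t. t ^ n * avg n h t / t ^ n) has_real_derivative real n * (h t - avg n h t) / t) (at t within {0..S})"
    by simp
  then show ?thesis
    by (rule has_field_derivative_transform_within[where d = t]) (use assms in \<open>auto simp: dist_real_def\<close>)
qed

lemma avg_continuous:
  assumes h: "continuous_on {0..S} h" and n: "1 \<le> n"
  shows "continuous_on {0..S} (avg n h)"
  unfolding continuous_on_eq_continuous_within
proof
  fix t assume t: "t \<in> {0..S}"
  show "continuous (at t within {0..S}) (avg n h)"
  proof (cases "t = 0")
    case False
    then show ?thesis using DERIV_continuous[OF avg_derivative[OF h t _ n]] t by auto
  next
    case True
    show ?thesis
      unfolding continuous_within_eps_delta True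
    proof (intro allI impI)
      fix e :: real assume "e > 0"
      then obtain d where d: "d > 0" "\<And>x. x \<in> {0..S} \<Longrightarrow> dist x 0 < d \<Longrightarrow> dist (h x) (h 0) < e / 2"
        using h t True unfolding continuous_on_iff by (metis half_gt_zero)
      show "\<exists>d>0. \<forall>x'\<in>{0..S}. dist x' 0 < d \<longrightarrow> dist (avg n h x') (avg n h 0) < e"
      proof (intro exI conjI ballI impI)
        fix x assume x: "x \<in> {0..S}" "dist x 0 < d"
        have cx: "continuous_on {0..x} h" using x by (intro continuous_on_subset[OF h]) auto
        have "\<bar>avg n h x - avg n (\<lambda>_. h 0) x\<bar> \<le> e / 2"
        proof (rule avg_diff_le[OF n _ cx])
          fix y assume "y \<in> {0..x}"
          then show "\<bar>h y - h 0\<bar> \<le> e / 2" using d(2)[of y] x by (auto simp: dist_real_def)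
        qed (use x in auto)
        then show "dist (avg n h x) (avg n h 0) < e"
          using x n \<open>e > 0\<close> avg_const[OF n, of x "h 0"] by (simp add: avg_def[of n h 0] dist_real_def)
      qed (use d in auto)
    qed
  qed
qed

text \<open>The left side is the derivative of \<open>avg n h\<close>, a quotient that is singular
  at 0. Integration by parts shows it to be a multiple of a mean of \<open>h'\<close> with the
  weight exponent raised by one, which is continuous at 0.\<close>

lemma avg_by_parts:
  assumes n: "1 \<le> n" and t: "0 < t"
    and h: "\<And>x. x \<in> {0..t} \<Longrightarrow> (h has_real_derivative h' x) (at x within {0..t})"
    and h': "continuous_on {0..t} h'"
  shows "real n * (h t - avg n h t) / t = real n / (real n + 1) * avg (n + 1) h' t"
proof -
  have hc: "continuous_on {0..t} h" using h by (rule DERIV_continuous_on)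
  have "((\<lambda>x. real n * x ^ (n - 1) * h x + x ^ n * h' x) has_integral (t ^ n * h t - 0 ^ n * h 0)) {0..t}"
  proof (rule fundamental_theorem_of_calculus)
    fix x assume x: "x \<in> {0..t}"
    have "((\<lambda>x. x ^ n * h x) has_real_derivative real n * x ^ (n - 1) * h x + x ^ n * h' x) (at x within {0..t})"
      by (rule derivative_eq_intros h[OF x] refl)+ simp
    then show "((\<lambda>x. x ^ n * h x) has_vector_derivative real n * x ^ (n - 1) * h x + x ^ n * h' x) (at x within {0..t})"
      by (simp add: has_real_derivative_iff_has_vector_derivative)
  qed (use t in simp)
  then have "integral {0..t} (\<lambda>x. real n * x ^ (n - 1) * h x + x ^ n * h' x) = t ^ n * h t"
    using n by (simp add: integral_unique zero_power)
  moreover have "integral {0..t} (\<lambda>x. real n * x ^ (n - 1) * h x + x ^ n * h' x)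
    = integral {0..t} (\<lambda>x. real n * x ^ (n - 1) * h x) + integral {0..t} (\<lambda>x. x ^ n * h' x)"
    using hc h' by (intro integral_add integrable_continuous_real continuous_intros)
  ultimately have 1: "t ^ n * h t - t ^ n * avg n h t = integral {0..t} (\<lambda>x. x ^ n * h' x)"
    using t by (simp add: avg_def)
  have "avg (n + 1) h' t = integral {0..t} (\<lambda>x. (real n + 1) * (x ^ n * h' x)) / t ^ (n + 1)"
    using t by (simp add: avg_def mult.assoc add.commute)
  also have "\<dots> = (real n + 1) * (t ^ n * h t - t ^ n * avg n h t) / t ^ (n + 1)"
    using 1 by simp
  also have "\<dots> = (real n + 1) * ((h t - avg n h t) / t)" using t by (simp add: field_simps)
  finally show ?thesis by simp
qed

text \<open>Carries positive lower bounds for the mean outward, past points where \<open>h\<close>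
  may vanish.\<close>

lemma avg_moment_mono:
  assumes h: "continuous_on {0..t} h" and "\<And>x. x \<in> {0..t} \<Longrightarrow> 0 \<le> h x" and st: "0 < s" "s \<le> t"
  shows "s ^ n * avg n h s \<le> t ^ n * avg n h t"
proof -
  have "integral {0..s} (\<lambda>x. real n * x ^ (n - 1) * h x) \<le> integral {0..t} (\<lambda>x. real n * x ^ (n - 1) * h x)"
    using assms continuous_on_subset[OF h, of "{0..s}"]
    by (intro integral_subset_le avg_integrable) auto
  then show ?thesis using st by (simp add: avg_def)
qed

lemma avg_tendsto:
  assumes t: "0 \<le> t" and f: "\<And>m. continuous_on {0..t} (f m)"
    and b: "\<And>m x. x \<in> {0..t} \<Longrightarrow> \<bar>f m x\<bar> \<le> c" and lim: "\<And>x. x \<in> {0..t} \<Longrightarrow> (\<lambda>m. f m x) \<longlonglongrightarrow> g x"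
  shows "(\<lambda>m. avg n (f m) t) \<longlonglongrightarrow> avg n g t"
proof (cases "t = 0")
  case False
  have "(\<lambda>m. integral {0..t} (\<lambda>x. real n * x ^ (n - 1) * f m x)) \<longlonglongrightarrow> integral {0..t} (\<lambda>x. real n * x ^ (n - 1) * g x)"
  proof (rule dominated_convergence(2))
    show "(\<lambda>x. real n * x ^ (n - 1) * c) integrable_on {0..t}" by (rule avg_integrable) auto
    fix m x assume x: "x \<in> {0..t}"
    show "norm (real n * x ^ (n - 1) * f m x) \<le> real n * x ^ (n - 1) * c"
      using x b[OF x, of m] by (simp add: abs_mult mult_left_mono)
  qed (use f lim avg_integrable in \<open>auto intro!: tendsto_intros\<close>)
  then show ?thesis using False by (auto simp: avg_def intro!: tendsto_divide)
qed (use lim[of 0] in \<open>simp add: avg_def\<close>)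

text \<open>The radial equation integrated once: the \<open>k\<close>-th power of -\<psi>' is the
  mean of \<psi>^p. The interval length \<open>S\<close> is left free, since a dilation together
  with a constant factor later carries it to R^2.\<close>

definition profile :: "nat \<Rightarrow> nat \<Rightarrow> real \<Rightarrow> real \<Rightarrow> (real \<Rightarrow> real) \<Rightarrow> bool" where
  "profile n k p S \<psi> \<longleftrightarrow> 0 < S \<and> \<psi> S = 0 \<and> (\<forall>s\<in>{0..<S}. 0 < \<psi> s) \<and>
    (\<forall>s\<in>{0..S}. (\<psi> has_real_derivative - (avg n (\<lambda>x. \<psi> x powr p) s powr (1 / k))) (at s within {0..S}))"

section \<open>Sublinear case p < k: monotone iteration\<close>

lemma continuous_on_powr_nonneg:
  fixes f :: "'a::topological_space \<Rightarrow> real"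
  assumes "continuous_on S f" "\<And>x. x \<in> S \<Longrightarrow> 0 \<le> f x" "0 < q"
  shows "continuous_on S (\<lambda>x. f x powr q)"
  using assms by (intro continuous_on_powr' continuous_on_const) auto

text \<open>\<open>T\<close> inverts the equation for a given right-hand side, with value 0 at the
  end point. It is monotone, so from a positive subsolution the iterates increase; this start keeps
  the limit away from the trivial fixed point 0.\<close>

lemma sublinear_profile_exists:
  fixes n k :: nat and p :: real
  assumes n: "1 \<le> n" and k: "1 \<le> k" and p: "0 < p" "p < k"
  shows "\<exists>\<psi>. profile n k p 1 \<psi>"
proof -
  define A where "A = (\<lambda>\<psi> s. avg n (\<lambda>x. \<psi> x powr p) s powr (1 / k))"
  define T where "T = (\<lambda>\<psi> s. integral {s..1} (A \<psi>))"
  define good where "good = (\<lambda>\<psi>. continuous_on {0..1} \<psi> \<and> (\<forall>s\<in>{0..1::real}. 0 \<le> \<psi> s \<and> \<psi> s \<le> (1::real)))"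
  have k1: "0 < 1 / real k" using k by simp
  have pc: "continuous_on {0..t} (\<lambda>x. \<psi> x powr p)" if "good \<psi>" "t \<le> 1" for \<psi> t
  proof -
    have "continuous_on {0..1} (\<lambda>x. \<psi> x powr p)"
      using that p by (intro continuous_on_powr_nonneg) (auto simp: good_def)
    then show ?thesis by (rule continuous_on_subset) (use that in auto)
  qed
  have avg01: "0 \<le> avg n (\<lambda>x. \<psi> x powr p) s" "avg n (\<lambda>x. \<psi> x powr p) s \<le> 1" if "good \<psi>" "s \<in> {0..1}" for \<psi> s
  proof -
    have "\<psi> x powr p \<le> 1" if "x \<in> {0..s}" for x
      using \<open>good \<psi>\<close> that \<open>s \<in> {0..1}\<close> p powr_mono2[of p "\<psi> x" 1] by (auto simp: good_def)
    then show "0 \<le> avg n (\<lambda>x. \<psi> x powr p) s" "avg n (\<lambda>x. \<psi> x powr p) s \<le> 1"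
      using that n by (auto intro!: avg_le avg_ge pc)
  qed
  have A01: "0 \<le> A \<psi> s" "A \<psi> s \<le> 1" if "good \<psi>" "s \<in> {0..1}" for \<psi> s
    using avg01[OF that] powr_mono2[of "1 / k" "avg n (\<lambda>x. \<psi> x powr p) s" 1] k1 by (auto simp: A_def)
  have Ac: "continuous_on {0..1} (A \<psi>)" if "good \<psi>" for \<psi>
    unfolding A_def using that k1 n
    by (intro continuous_on_powr_nonneg avg_continuous pc avg01) auto
  have Aint: "A \<psi> integrable_on {s..1}" if "good \<psi>" "0 \<le> s" for \<psi> s
    using that by (intro integrable_continuous_real continuous_on_subset[OF Ac]) auto
  have Amono: "A \<psi> s \<le> A \<phi> s" if "good \<psi>" "good \<phi>" "\<And>x. x \<in> {0..1} \<Longrightarrow> \<psi> x \<le> \<phi> x" "s \<in> {0..1}" for \<psi> \<phi> s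
  proof -
    have "\<psi> x powr p \<le> \<phi> x powr p" if "x \<in> {0..s}" for x
      using that \<open>s \<in> {0..1}\<close> \<open>good \<psi>\<close> p \<open>\<And>x. x \<in> {0..1} \<Longrightarrow> \<psi> x \<le> \<phi> x\<close>[of x]
      by (intro powr_mono2) (auto simp: good_def)
    then have "avg n (\<lambda>x. \<psi> x powr p) s \<le> avg n (\<lambda>x. \<phi> x powr p) s"
      using that n by (intro avg_mono pc) auto
    then show ?thesis unfolding A_def using avg01(1)[OF \<open>good \<psi>\<close> \<open>s \<in> {0..1}\<close>] k1 by (intro powr_mono2) auto
  qed
  have Tmono: "T \<psi> s \<le> T \<phi> s" if "good \<psi>" "good \<phi>" "\<And>x. x \<in> {0..1} \<Longrightarrow> \<psi> x \<le> \<phi> x" "s \<in> {0..1}" for \<psi> \<phi> s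
    unfolding T_def using that by (intro integral_le Aint Amono) auto
  have Td: "(T \<psi> has_real_derivative - A \<psi> s) (at s within {0..1})" if "good \<psi>" "s \<in> {0..1}" for \<psi> s
    unfolding T_def by (rule integral_has_real_derivative'[OF Ac[OF that(1)] that(2)])
  have Tbd: "0 \<le> T \<psi> s" "T \<psi> s \<le> 1 - s" if "good \<psi>" "s \<in> {0..1}" for \<psi> s
  proof -
    show "0 \<le> T \<psi> s" unfolding T_def using that A01 by (intro integral_nonneg Aint) auto
    have "T \<psi> s \<le> integral {s..1} (\<lambda>_. 1)"
      unfolding T_def using that A01 by (intro integral_le Aint) auto
    then show "T \<psi> s \<le> 1 - s" using that by simp
  qed
  have Tgood: "good (T \<psi>)" if "good \<psi>" for \<psi>
  proof -
    have "T \<psi> s \<le> 1" if "s \<in> {0..1}" for s using Tbd(2)[OF \<open>good \<psi>\<close> that] that by auto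
    moreover have "continuous_on {0..1} (T \<psi>)" using Td[OF that] by (rule DERIV_continuous_on)
    ultimately show ?thesis unfolding good_def using Tbd(1)[OF that] by blast
  qed
  have TLip: "\<bar>T \<psi> s - T \<psi> t\<bar> \<le> \<bar>s - t\<bar>" if "good \<psi>" "s \<in> {0..1}" "t \<in> {0..1}" for \<psi> s t
  proof -
    have "norm (T \<psi> s - T \<psi> t) \<le> 1 * norm (s - t)"
      by (rule field_differentiable_bound[of "{0..1}" "T \<psi>" "\<lambda>s. - A \<psi> s"])
        (use Td[OF that(1)] A01[OF that(1)] that in auto)
    then show ?thesis by simp
  qed
  define c where "c = avg n (\<lambda>x. (1 - x) powr p) 1"
  have lin: "good (\<lambda>s. 1 - s)" by (auto simp: good_def intro!: continuous_intros)
  have c0: "0 < c"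
  proof -
    have "(1 / 2 :: real) powr p \<le> avg n (\<lambda>x. (1 - x) powr p) (1 / 2)"
      using n p by (intro avg_ge pc[OF lin] powr_mono2) auto
    then have "0 < (1 / 2) ^ n * avg n (\<lambda>x. (1 - x) powr p) (1 / 2)"
      by (intro mult_pos_pos less_le_trans[OF _ \<open>(1 / 2 :: real) powr p \<le> _\<close>]) auto
    also have "\<dots> \<le> 1 ^ n * avg n (\<lambda>x. (1 - x) powr p) 1"
      by (intro avg_moment_mono pc[OF lin]) auto
    finally show ?thesis by (simp add: c_def)
  qed
  \<comment> \<open>The function \<open>\<epsilon> * (1 - s)\<close> is a subsolution as soon as
    \<epsilon> is at most (\<epsilon>^p c)^(1/k), that is, \<epsilon>^(k-p) at most
    \<open>c\<close>. A positive \<epsilon> with this property exists because p < k.\<close>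
  define \<epsilon> where "\<epsilon> = min 1 (c powr (1 / (k - p)))"
  have \<epsilon>: "0 < \<epsilon>" "\<epsilon> \<le> 1" using c0 by (auto simp: \<epsilon>_def)
  define \<psi>0 where "\<psi>0 = (\<lambda>s::real. \<epsilon> * (1 - s))"
  have g0: "good \<psi>0"
    using \<epsilon> by (auto simp: good_def \<psi>0_def mult_le_one intro!: continuous_intros)
  have sub: "\<psi>0 s \<le> T \<psi>0 s" if s: "s \<in> {0..1}" for s
  proof -
    have "\<epsilon> \<le> A \<psi>0 x" if x: "x \<in> {0..1}" for x
    proof -
      have "\<epsilon> powr p * (1 - y) powr p = \<psi>0 y powr p" if "y \<in> {0..1}" for y
        using \<epsilon> that by (simp add: \<psi>0_def powr_mult)
      \<comment> \<open>The mean of a decreasing function decreases in its end point, so the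
        smallest value is the one at 1, namely \<open>c\<close>.\<close>
      moreover have cx: "c \<le> avg n (\<lambda>y. (1 - y) powr p) x"
      proof (cases "x = 0")
        case True
        have "c \<le> 1" unfolding c_def using n p powr_mono2[of p _ 1] by (intro avg_le pc[OF lin]) auto
        then show ?thesis using True by (simp add: avg_def)
      next
        case False
        have "avg n (\<lambda>y. (1 - y) powr p) 1 \<le> avg n (\<lambda>y. (1 - y) powr p) x"
        proof (rule DERIV_nonpos_imp_decreasing_open[where f = "avg n (\<lambda>y. (1 - y) powr p)"])
          show "x \<le> 1" using x by simp
          show "continuous_on {x..1} (avg n (\<lambda>y. (1 - y) powr p))"
            using x n by (intro continuous_on_subset[OF avg_continuous[OF pc[OF lin order_refl]]]) auto
          fix t assume t: "x < t" "t < 1"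
          have "(avg n (\<lambda>y. (1 - y) powr p) has_real_derivative
              real n * ((1 - t) powr p - avg n (\<lambda>y. (1 - y) powr p) t) / t) (at t within {0..1})"
            using t x n by (intro avg_derivative pc[OF lin]) auto
          moreover have "at t within {0..1} = at t" using t x by (intro at_within_interior) auto
          moreover have "(1 - t) powr p \<le> avg n (\<lambda>y. (1 - y) powr p) t"
            using t x n p by (intro avg_ge pc[OF lin] powr_mono2) auto
          then have "real n * ((1 - t) powr p - avg n (\<lambda>y. (1 - y) powr p) t) / t \<le> 0"
            using t x by (intro divide_nonpos_pos mult_nonneg_nonpos) auto
          ultimately show "\<exists>y. (avg n (\<lambda>y. (1 - y) powr p) has_real_derivative y) (at t) \<and> y \<le> 0" by auto
        qed
        then show ?thesis by (simp add: c_def)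
      qed
      moreover have "avg n (\<lambda>y. \<epsilon> powr p * (1 - y) powr p) x = \<epsilon> powr p * avg n (\<lambda>y. (1 - y) powr p) x"
        by (simp add: avg_def mult.left_commute)
      moreover have "avg n (\<lambda>y. \<psi>0 y powr p) x = avg n (\<lambda>y. \<epsilon> powr p * (1 - y) powr p) x"
        using calculation(1) x by (intro avg_cong) auto
      ultimately have "\<epsilon> powr p * c \<le> avg n (\<lambda>y. \<psi>0 y powr p) x"
        using \<epsilon> by (simp add: mult_left_mono)
      moreover have "\<epsilon> powr k \<le> \<epsilon> powr p * c"
      proof -
        have "\<epsilon> powr (k - p) \<le> (c powr (1 / (k - p))) powr (k - p)"
          using \<epsilon> p by (intro powr_mono2) (auto simp: \<epsilon>_def)
        also have "\<dots> = c" using c0 p by (simp add: powr_powr)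
        finally have "\<epsilon> powr p * \<epsilon> powr (k - p) \<le> \<epsilon> powr p * c" by (intro mult_left_mono) auto
        then show ?thesis by (simp add: powr_add[symmetric])
      qed
      ultimately have "(\<epsilon> powr k) powr (1 / k) \<le> A \<psi>0 x"
        unfolding A_def using k1 \<epsilon> by (intro powr_mono2) auto
      then show ?thesis using \<epsilon> k by (simp add: powr_powr)
    qed
    then have "integral {s..1} (\<lambda>_. \<epsilon>) \<le> T \<psi>0 s"
      unfolding T_def using s by (intro integral_le Aint[OF g0]) auto
    then show ?thesis using s by (simp add: \<psi>0_def mult.commute)
  qed
  define F where "F = (\<lambda>m. (T ^^ m) \<psi>0)"
  have Fg: "good (F m)" for m by (induction m) (auto simp: F_def g0 Tgood)
  have FS: "F (Suc m) = T (F m)" for m by (simp add: F_def)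
  have Finc: "F m s \<le> F (Suc m) s" if "s \<in> {0..1}" for m s
    using that
  proof (induction m arbitrary: s)
    case 0
    then show ?case using sub by (simp add: F_def)
  next
    case (Suc m)
    show ?case unfolding FS[of "Suc m"] unfolding FS[of m]
      by (rule Tmono[OF Fg _ _ Suc.prems]) (use Suc.IH Fg[of "Suc m"] in \<open>auto simp: FS\<close>)
  qed
  have "\<exists>l. (\<lambda>m. F m s) \<longlonglongrightarrow> l" if "s \<in> {0..1}" for s
  proof (rule Bseq_monoseq_convergent[unfolded convergent_def])
    show "Bseq (\<lambda>m. F m s)" using Fg that by (intro BseqI'[where K = 1]) (auto simp: good_def)
    show "monoseq (\<lambda>m. F m s)" using Finc[OF that] by (intro incseq_imp_monoseq incseq_SucI)
  qed
  then obtain \<psi> where lim: "\<And>s. s \<in> {0..1} \<Longrightarrow> (\<lambda>m. F m s) \<longlonglongrightarrow> \<psi> s" by metis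
  have ge: "\<psi>0 s \<le> \<psi> s" if "s \<in> {0..1}" for s
    using incseq_le[OF incseq_SucI lim, of s 0] Finc that by (simp add: F_def)
  have \<psi>01: "0 \<le> \<psi> s" "\<psi> s \<le> 1" if "s \<in> {0..1}" for s
    using Fg that by (auto intro!: LIMSEQ_le_const[OF lim[OF that]] LIMSEQ_le_const2[OF lim[OF that]] simp: good_def)
  have Lip: "\<bar>\<psi> s - \<psi> t\<bar> \<le> \<bar>s - t\<bar>" if "s \<in> {0..1}" "t \<in> {0..1}" for s t
  proof (rule LIMSEQ_le_const2)
    \<comment> \<open>The index shift makes every term an image under \<open>T\<close>, for which
      the 1-Lipschitz bound is available. It survives the pointwise limit and gives
      continuity.\<close>
    show "(\<lambda>m. \<bar>F (Suc m) s - F (Suc m) t\<bar>) \<longlonglongrightarrow> \<bar>\<psi> s - \<psi> t\<bar>"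
      by (intro tendsto_intros LIMSEQ_Suc lim that)
    show "\<exists>N. \<forall>m\<ge>N. \<bar>F (Suc m) s - F (Suc m) t\<bar> \<le> \<bar>s - t\<bar>"
      using TLip[OF Fg that] by (auto simp: FS)
  qed
  have \<psi>c: "continuous_on {0..1} \<psi>"
    unfolding continuous_on_iff dist_real_def
  proof (intro ballI allI impI)
    fix x e :: real assume x: "x \<in> {0..1}" and "0 < e"
    then show "\<exists>d>0. \<forall>x'\<in>{0..1}. \<bar>x' - x\<bar> < d \<longrightarrow> \<bar>\<psi> x' - \<psi> x\<bar> < e"
      using le_less_trans[OF Lip[OF _ x]] by blast
  qed
  have \<psi>g: "good \<psi>" using \<psi>c \<psi>01 by (auto simp: good_def)
  have Alim: "(\<lambda>m. A (F m) s) \<longlonglongrightarrow> A \<psi> s" if s: "s \<in> {0..1}" for s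
    unfolding A_def
  proof (rule tendsto_powr2)
    show "(\<lambda>m. avg n (\<lambda>x. F m x powr p) s) \<longlonglongrightarrow> avg n (\<lambda>x. \<psi> x powr p) s"
    proof (rule avg_tendsto[where c = 1])
      fix m x assume x: "x \<in> {0..s}"
      then have x1: "x \<in> {0..1}" using s by auto
      show "\<bar>F m x powr p\<bar> \<le> 1" using Fg x1 p powr_mono2[of p "F m x" 1] by (auto simp: good_def)
      show "(\<lambda>m. F m x powr p) \<longlonglongrightarrow> \<psi> x powr p"
        using Fg x1 p lim[OF x1] by (intro tendsto_powr2 tendsto_const) (auto simp: good_def)
    qed (use s pc[OF Fg] in auto)
  qed (use k1 avg01(1)[OF Fg s] in auto)
  have fix_eq: "T \<psi> s = \<psi> s" if s: "s \<in> {0..1}" for s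
  proof -
    have "(\<lambda>m. T (F m) s) \<longlonglongrightarrow> T \<psi> s"
      unfolding T_def
      by (rule dominated_convergence(2)[where h = "\<lambda>_. 1"]) (use s Aint[OF Fg] A01[OF Fg] Alim in auto)
    moreover have "(\<lambda>m. T (F m) s) \<longlonglongrightarrow> \<psi> s"
      using LIMSEQ_Suc[OF lim[OF s]] by (simp add: FS)
    ultimately show ?thesis by (rule LIMSEQ_unique)
  qed
  have "profile n k p 1 \<psi>"
    unfolding profile_def
  proof (intro conjI ballI)
    show "\<psi> 1 = 0" using fix_eq[of 1] by (simp add: T_def)
    show "0 < \<psi> s" if "s \<in> {0..<1}" for s
    proof -
      have "0 < \<psi>0 s" using that \<epsilon> by (simp add: \<psi>0_def)
      then show ?thesis using ge[of s] that by auto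
    qed
    show "(\<psi> has_real_derivative - (avg n (\<lambda>x. \<psi> x powr p) s powr (1 / k))) (at s within {0..1})"
      if "s \<in> {0..1}" for s
      using Td[OF \<psi>g that] unfolding A_def
      by (rule has_field_derivative_transform_within[where d = 1]) (use fix_eq that in auto)
  qed simp
  then show ?thesis by blast
qed

section \<open>Superlinear case p > k: the initial value problem and the first zero\<close>

lemma powr_diff_le:
  fixes p :: real
  assumes "1 \<le> p" "0 \<le> a" "a \<le> b" "b \<le> 1"
  shows "b powr p - a powr p \<le> p * (b - a)"
proof (cases "a = b")
  case False
  have "continuous_on {a..b} (\<lambda>x. x powr p)"
    using assms by (intro continuous_on_powr_nonneg continuous_intros) auto
  moreover have "((\<lambda>x. x powr p) has_real_derivative p * x powr (p - 1)) (at x)" if "a < x" "x < b" for x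
    using has_real_derivative_powr[of x p] that assms by auto
  ultimately obtain z where z: "a < z" "z < b" "b powr p - a powr p = (b - a) * (p * z powr (p - 1))"
    using MVT[of a b "\<lambda>x. x powr p"] False assms
    by (metis DERIV_unique less_le real_differentiable_def)
  have "z powr (p - 1) \<le> 1" using z assms powr_mono2[of "p - 1" z 1] by auto
  then have "(b - a) * (p * z powr (p - 1)) \<le> (b - a) * (p * 1)"
    using assms by (intro mult_left_mono) auto
  then show ?thesis using z by (simp add: mult.commute)
qed (use assms in simp)

text \<open>For x/y at least 1, its power with exponent at most 1 is bounded by x/y itself; the
  resulting Lipschitz constant degenerates only as \<open>m\<close> tends to 0.\<close>

lemma root_diff_le:
  fixes m x y :: real
  assumes "0 < m" "m \<le> y" "y \<le> x" "y \<le> 1" "0 < q" "q \<le> 1"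
  shows "x powr q - y powr q \<le> (x - y) / m"
proof -
  have y: "0 < y" using assms by linarith
  have "(x / y) powr q \<le> (x / y) powr 1" using assms y by (intro powr_mono) auto
  then have "x powr q \<le> y powr q * (x / y)"
    using y assms by (simp add: powr_divide field_simps)
  then have "x powr q - y powr q \<le> y powr q * ((x - y) / y)" using y by (simp add: field_simps)
  also have "\<dots> \<le> 1 * ((x - y) / m)"
    using assms y powr_mono2[of q y 1] by (intro mult_mono divide_left_mono) auto
  finally show ?thesis by simp
qed

text \<open>The positive part lets the equation continue beyond a zero of \<psi>, so that a solution
  exists on any prescribed interval and a zero can be found afterwards by the intermediate value
  theorem.\<close>

lemma initial_value_problem_solvable:
  fixes n k :: nat and p S :: real
  assumes n: "1 \<le> n" and k: "1 \<le> k" and p: "1 \<le> p" and S: "1 \<le> S"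
  shows "\<exists>\<psi>. \<psi> 0 = 1 \<and> (\<forall>s\<in>{0..S}. \<psi> s \<le> 1 \<and>
    0 < avg n (\<lambda>x. max 0 (\<psi> x) powr p) s \<and> avg n (\<lambda>x. max 0 (\<psi> x) powr p) s \<le> 1 \<and>
    (\<psi> has_real_derivative - (avg n (\<lambda>x. max 0 (\<psi> x) powr p) s powr (1 / k))) (at s within {0..S}))"
proof -
  define q where "q = 1 / real k"
  have q: "0 < q" "q \<le> 1" using k by (auto simp: q_def)
  \<comment> \<open>Clamping the unknown from below by \<open>1 - x\<close>, which every solution exceeds, keeps the average away
    from \<open>0\<close>, where the \<open>k\<close>-th root is not Lipschitz.\<close>
  define r where "r = (\<lambda>x y. min 1 (max y (max 0 (1 - x))) :: real)"
  \<comment> \<open>Lower bound for the mean of the clamped function: that function is at least 1/2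
    on [0, 1/2], the moment \<open>t ^ n * A \<psi> t\<close> does not decrease afterwards, and
    \<open>t ^ n\<close> is at most \<open>S ^ n\<close>.\<close>
  define m where "m = (1 / 2) ^ n * (1 / 2) powr p / S ^ n"
  have m: "0 < m" using S by (simp add: m_def)
  have hc: "continuous_on {0..t} (\<lambda>x. r x (\<psi> x) powr p)" if "continuous_on {0..t} \<psi>" for \<psi> t
    unfolding r_def using that p by (intro continuous_on_powr_nonneg continuous_intros) auto
  have h01: "0 \<le> r x y powr p" "r x y powr p \<le> 1" for x y
    using p powr_mono2[of p "r x y" 1] by (auto simp: r_def)
  define A where "A = (\<lambda>\<psi> t. avg n (\<lambda>x. r x (\<psi> x) powr p) t)"
  have A: "m \<le> A \<psi> t" "A \<psi> t \<le> 1" if c: "continuous_on {0..t} \<psi>" and t: "0 \<le> t" "t \<le> S" for \<psi> t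
  proof -
    show "A \<psi> t \<le> 1" unfolding A_def using n t h01 by (intro avg_le hc c) auto
    have half: "(1 / 2) powr p \<le> A \<psi> s" if "0 \<le> s" "s \<le> 1 / 2" "s \<le> t" for s
      unfolding A_def using n that p
      by (intro avg_ge hc continuous_on_subset[OF c] powr_mono2) (auto simp: r_def le_max_iff_disj)
    have "m \<le> 1 * (1 / 2) powr p / 1"
      unfolding m_def using S by (intro frac_le mult_mono power_le_one one_le_power) auto
    show "m \<le> A \<psi> t"
    proof (cases "t \<le> 1 / 2")
      case True
      then show ?thesis using half[of t] t \<open>m \<le> _\<close> by simp
    next
      case False
      have "(1 / 2) ^ n * (1 / 2) powr p \<le> (1 / 2) ^ n * A \<psi> (1 / 2)"
        using half[of "1 / 2"] False by (intro mult_left_mono) auto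
      also have "\<dots> \<le> t ^ n * A \<psi> t"
        unfolding A_def using False h01 by (intro avg_moment_mono hc c) auto
      also have "\<dots> \<le> S ^ n * A \<psi> t"
        using t False h01 n avg_ge[OF n t(1) hc[OF c], of 0] unfolding A_def
        by (intro mult_right_mono power_mono) auto
      finally show ?thesis unfolding m_def using S by (simp add: divide_le_eq mult.commute)
    qed
  qed
  have Ac: "continuous_on {0..S} (\<lambda>t. A \<psi> t powr q)" if "continuous_on {0..S} \<psi>" for \<psi>
  proof (rule continuous_on_powr_nonneg)
    show "continuous_on {0..S} (A \<psi>)" unfolding A_def using n that by (intro avg_continuous hc)
    show "0 \<le> A \<psi> x" if x: "x \<in> {0..S}" for x
    proof -
      have "continuous_on {0..x} \<psi>" by (rule continuous_on_subset[OF \<open>continuous_on {0..S} \<psi>\<close>]) (use x in auto)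
      from A(1)[OF this] show ?thesis using x m by simp
    qed
  qed (use q in auto)
  have r_lip: "\<bar>r x y powr p - r x z powr p\<bar> \<le> p * \<bar>y - z\<bar>" for x y z
  proof -
    have 1: "r x y powr p - r x z powr p \<le> p * \<bar>y - z\<bar>" if "z \<le> y" for y z
    proof -
      have "r x y powr p - r x z powr p \<le> p * (r x y - r x z)"
        using that by (intro powr_diff_le p) (auto simp: r_def)
      also have "\<dots> \<le> p * \<bar>y - z\<bar>" using p that by (intro mult_left_mono) (auto simp: r_def)
      finally show ?thesis .
    qed
    have 2: "r x z powr p \<le> r x y powr p" if "z \<le> y" for y z
      using p that by (intro powr_mono2) (auto simp: r_def)
    show ?thesis
    proof (cases "z \<le> y")
      case True
      show ?thesis using 1[OF True] 2[OF True] by linarith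
    next
      case False
      then have "y \<le> z" by simp
      from 1[OF this] 2[OF this] show ?thesis by (simp add: abs_minus_commute)
    qed
  qed
  \<comment> \<open>\<open>\<theta>\<close> stands for $e^{-\Lambda s}\psi(s)$, so that the plain sup norm of \<open>\<theta>\<close> is the weighted norm
    of \<open>\<psi>\<close> in which the integral operator contracts on all of \<open>{0..S}\<close>.\<close>
  define \<Lambda> where "\<Lambda> = 2 * p / m"
  have \<Lambda>: "0 < \<Lambda>" using p m by (simp add: \<Lambda>_def)
  \<comment> \<open>The Banach space consists of functions on the whole line, so arguments are
    projected to [0, S].\<close>
  define cl where "cl = (\<lambda>s. max 0 (min S s) :: real)"
  have cl: "cl s \<in> {0..S}" "s \<in> {0..S} \<Longrightarrow> cl s = s" for s using S by (auto simp: cl_def)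
  define W where "W = (\<lambda>\<theta> x. exp (\<Lambda> * x) * apply_bcontfun \<theta> x)"
  have Wc: "continuous_on X (W \<theta>)" for \<theta> :: "real \<Rightarrow>\<^sub>C real" and X
    unfolding W_def by (intro continuous_intros continuous_on_apply_bcontfun)
  define T where "T = (\<lambda>\<theta> s. exp (- \<Lambda> * s) * (1 - integral {0..s} (\<lambda>t. A (W \<theta>) t powr q)))"
  have Tc: "continuous_on {0..S} (T \<theta>)" for \<theta>
    unfolding T_def
    by (intro continuous_intros indefinite_integral_continuous_1 integrable_continuous_real Ac Wc)
  have Tcl: "(\<lambda>s. T \<theta> (cl s)) \<in> bcontfun" for \<theta>
  proof -
    have "bounded (T \<theta> ` {0..S})"
      by (intro compact_imp_bounded compact_continuous_image Tc) auto
    then obtain b where "\<forall>x\<in>{0..S}. norm (T \<theta> x) \<le> b" by (auto simp: bounded_iff)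
    moreover have "continuous_on UNIV (\<lambda>s. T \<theta> (cl s))"
      by (rule continuous_on_compose2[OF Tc]) (use cl in \<open>auto simp: cl_def intro!: continuous_intros\<close>)
    ultimately show ?thesis using cl(1) by (intro bcontfun_normI[of _ b]) auto
  qed
  define \<Phi> where "\<Phi> = (\<lambda>\<theta>. Bcontfun (\<lambda>s. T \<theta> (cl s)))"
  have \<Phi>: "apply_bcontfun (\<Phi> \<theta>) s = T \<theta> (cl s)" for \<theta> s
    unfolding \<Phi>_def by (simp add: Bcontfun_inverse[OF Tcl])
  have "dist (\<Phi> \<theta>1) (\<Phi> \<theta>2) \<le> (1 / 2) * dist \<theta>1 \<theta>2" for \<theta>1 \<theta>2
  proof (rule dist_bound)
    fix s0
    define s where "s = cl s0"
    have s: "s \<in> {0..S}" using cl by (simp add: s_def)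
    define D where "D = dist \<theta>1 \<theta>2"
    have D: "\<bar>apply_bcontfun \<theta>1 x - apply_bcontfun \<theta>2 x\<bar> \<le> D" for x
      using dist_bounded[of \<theta>1 x \<theta>2] by (simp add: D_def dist_real_def)
    have D0: "0 \<le> D" by (simp add: D_def)
    have diff: "\<bar>A (W \<theta>1) t powr q - A (W \<theta>2) t powr q\<bar> \<le> p * (exp (\<Lambda> * t) * D) / m" if t: "t \<in> {0..s}" for t
    proof -
      have tS: "0 \<le> t" "t \<le> S" using t s by auto
      have "\<bar>A (W \<theta>1) t - A (W \<theta>2) t\<bar> \<le> p * (exp (\<Lambda> * t) * D)"
        unfolding A_def
      proof (rule avg_diff_le[OF n tS(1) hc[OF Wc] hc[OF Wc]])
        fix x assume x: "x \<in> {0..t}"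
        have "\<bar>r x (W \<theta>1 x) powr p - r x (W \<theta>2 x) powr p\<bar> \<le> p * \<bar>W \<theta>1 x - W \<theta>2 x\<bar>" by (rule r_lip)
        also have "\<bar>W \<theta>1 x - W \<theta>2 x\<bar> = exp (\<Lambda> * x) * \<bar>apply_bcontfun \<theta>1 x - apply_bcontfun \<theta>2 x\<bar>"
          unfolding W_def right_diff_distrib[symmetric] abs_mult by simp
        also have "\<dots> \<le> exp (\<Lambda> * t) * D"
          using x \<Lambda> D by (intro mult_mono) auto
        finally show "\<bar>r x (W \<theta>1 x) powr p - r x (W \<theta>2 x) powr p\<bar> \<le> p * (exp (\<Lambda> * t) * D)"
          using p by (simp add: mult_left_mono)
      qed
      moreover have "\<bar>A (W \<theta>1) t powr q - A (W \<theta>2) t powr q\<bar> \<le> \<bar>A (W \<theta>1) t - A (W \<theta>2) t\<bar> / m"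
      proof -
        note a = A[OF Wc tS]
        have "x powr q - y powr q \<le> \<bar>x - y\<bar> / m \<and> y powr q \<le> x powr q"
          if "m \<le> y" "y \<le> x" "y \<le> 1" for x y
          using root_diff_le[OF m that q] that m q powr_mono2[of q y x] by auto
        from this[of "A (W \<theta>1) t" "A (W \<theta>2) t"] this[of "A (W \<theta>2) t" "A (W \<theta>1) t"] a[of \<theta>1] a[of \<theta>2]
        show ?thesis by (cases "A (W \<theta>1) t \<le> A (W \<theta>2) t") (auto simp: abs_minus_commute)
      qed
      ultimately show ?thesis using m by (meson divide_right_mono less_imp_le order_trans)
    qed
    have int: "(\<lambda>t. A (W \<theta>) t powr q) integrable_on {0..s}" for \<theta>
      using s by (intro integrable_continuous_real continuous_on_subset[OF Ac[OF Wc]]) auto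
    \<comment> \<open>With \<open>\<Lambda> = 2 * p / m\<close> the antiderivative carries the
      factor \<open>D / 2\<close>; this is the origin of the contraction constant 1/2.\<close>
    have exp_int: "((\<lambda>t. p * (exp (\<Lambda> * t) * D) / m) has_integral (D / 2 * exp (\<Lambda> * s) - D / 2 * exp (\<Lambda> * 0))) {0..s}"
    proof (rule fundamental_theorem_of_calculus)
      fix x assume "x \<in> {0..s}"
      have "((\<lambda>t. D / 2 * exp (\<Lambda> * t)) has_real_derivative p * (exp (\<Lambda> * x) * D) / m) (at x within {0..s})"
        using m by (auto intro!: derivative_eq_intros simp: \<Lambda>_def)
      then show "((\<lambda>t. D / 2 * exp (\<Lambda> * t)) has_vector_derivative p * (exp (\<Lambda> * x) * D) / m) (at x within {0..s})"
        by (simp add: has_real_derivative_iff_has_vector_derivative)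
    qed (use s in simp)
    have "\<bar>integral {0..s} (\<lambda>t. A (W \<theta>1) t powr q) - integral {0..s} (\<lambda>t. A (W \<theta>2) t powr q)\<bar>
        = norm (integral {0..s} (\<lambda>t. A (W \<theta>1) t powr q - A (W \<theta>2) t powr q))"
      by (simp add: integral_diff[OF int int])
    also have "\<dots> \<le> integral {0..s} (\<lambda>t. p * (exp (\<Lambda> * t) * D) / m)"
      using diff exp_int int by (intro integral_norm_bound_integral integrable_diff) auto
    also have "\<dots> \<le> D / 2 * exp (\<Lambda> * s)" unfolding integral_unique[OF exp_int] using D0 by simp
    finally have I: "\<bar>integral {0..s} (\<lambda>t. A (W \<theta>1) t powr q) - integral {0..s} (\<lambda>t. A (W \<theta>2) t powr q)\<bar> \<le> D / 2 * exp (\<Lambda> * s)" .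
    have "\<bar>T \<theta>1 s - T \<theta>2 s\<bar> = exp (- \<Lambda> * s) * \<bar>integral {0..s} (\<lambda>t. A (W \<theta>1) t powr q) - integral {0..s} (\<lambda>t. A (W \<theta>2) t powr q)\<bar>"
      unfolding T_def right_diff_distrib[symmetric] abs_mult by (simp add: abs_minus_commute)
    also have "\<dots> \<le> exp (- \<Lambda> * s) * (D / 2 * exp (\<Lambda> * s))" by (intro mult_left_mono I) auto
    also have "\<dots> = D / 2" by (simp add: exp_minus field_simps)
    finally show "dist (apply_bcontfun (\<Phi> \<theta>1) s0) (apply_bcontfun (\<Phi> \<theta>2) s0) \<le> 1 / 2 * dist \<theta>1 \<theta>2"
      by (simp add: \<Phi> s_def[symmetric] dist_real_def D_def[symmetric])
  qed
  then have "\<exists>!\<theta>. \<Phi> \<theta> = \<theta>"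
    by (intro banach_fix_type[where c = "1 / 2"]) auto
  then obtain \<theta> where fix_eq: "\<Phi> \<theta> = \<theta>" by blast
  define \<psi> where "\<psi> = W \<theta>"
  have \<psi>: "\<psi> s = 1 - integral {0..s} (\<lambda>t. A \<psi> t powr q)" if "s \<in> {0..S}" for s
  proof -
    have "apply_bcontfun \<theta> s = T \<theta> s" using \<Phi>[of \<theta> s] fix_eq cl(2)[OF that] by simp
    moreover have "T \<theta> s = exp (- \<Lambda> * s) * (1 - integral {0..s} (\<lambda>t. A \<psi> t powr q))"
      by (simp add: T_def \<psi>_def)
    moreover have "\<psi> s = exp (\<Lambda> * s) * apply_bcontfun \<theta> s" by (simp add: \<psi>_def W_def)
    ultimately show ?thesis by (simp add: exp_minus)
  qed
  have \<psi>c: "continuous_on X \<psi>" for X unfolding \<psi>_def by (rule Wc)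
  have A01: "0 < A \<psi> t" "A \<psi> t \<le> 1" if "t \<in> {0..S}" for t
    using A[OF \<psi>c, of t] that m by auto
  have \<psi>d: "(\<psi> has_real_derivative - (A \<psi> s powr q)) (at s within {0..S})" if s: "s \<in> {0..S}" for s
  proof -
    have "((\<lambda>s. 1 - integral {0..s} (\<lambda>t. A \<psi> t powr q)) has_real_derivative 0 - A \<psi> s powr q) (at s within {0..S})"
      by (intro DERIV_diff DERIV_const integral_has_real_derivative Ac \<psi>c s)
    then have "((\<lambda>s. 1 - integral {0..s} (\<lambda>t. A \<psi> t powr q)) has_real_derivative - (A \<psi> s powr q)) (at s within {0..S})"
      by simp
    then show ?thesis
      by (rule has_field_derivative_transform_within[where d = 1]) (use s \<psi> in auto)
  qed
  have int: "(\<lambda>t. A \<psi> t powr q) integrable_on {0..s}" if "s \<in> {0..S}" for s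
    using that by (intro integrable_continuous_real continuous_on_subset[OF Ac[OF \<psi>c]]) auto
  have Aq: "0 \<le> A \<psi> t powr q" "A \<psi> t powr q \<le> 1" if "t \<in> {0..S}" for t
    using A01[OF that] q powr_mono2[of q "A \<psi> t" 1] by auto
  \<comment> \<open>The lower bound makes the clamp inactive, so the fixed point solves the equation
    with the mere positive part.\<close>
  have bd: "1 - s \<le> \<psi> s" "\<psi> s \<le> 1" if s: "s \<in> {0..S}" for s
  proof -
    have "0 \<le> integral {0..s} (\<lambda>t. A \<psi> t powr q)" using Aq s by (intro integral_nonneg int) auto
    moreover have "integral {0..s} (\<lambda>t. A \<psi> t powr q) \<le> integral {0..s} (\<lambda>_. 1)"
      using Aq s by (intro integral_le int) auto
    ultimately show "1 - s \<le> \<psi> s" "\<psi> s \<le> 1" using \<psi>[OF s] s by auto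
  qed
  have "A \<psi> t = avg n (\<lambda>x. max 0 (\<psi> x) powr p) t" if t: "t \<in> {0..S}" for t
    unfolding A_def
  proof (rule avg_cong)
    fix x assume "x \<in> {0..t}"
    then have "x \<in> {0..S}" using t by auto
    from bd[OF this] have "r x (\<psi> x) = max 0 (\<psi> x)" by (auto simp: r_def)
    then show "r x (\<psi> x) powr p = max 0 (\<psi> x) powr p" by simp
  qed (use t in auto)
  then show ?thesis
    using \<psi>[of 0] \<psi>d A01 bd S unfolding q_def by (intro exI[of _ \<psi>]) auto
qed

text \<open>The threshold depends on n, k and p alone. A positive solution satisfies \<psi>' \<le>
  -\<psi>^(p/k), which gives the decay exponent \<open>\<alpha>\<close>; then \<open>P\<close> is at
  most of order s^\<mu> with negative \<mu>, although it starts at 0, never decreases, and gains at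
  least \<open>m\<close> by 1/2.\<close>

lemma positive_solution_interval_bounded:
  fixes n k :: nat and p :: real
  assumes n: "1 \<le> n" and k: "1 \<le> k" and p: "real k < p"
    and subcritical: "real n * (p - real k) < real k * (p + 1)"
  shows "\<exists>S0\<ge>1. \<forall>S \<psi>. S0 \<le> S \<longrightarrow> \<psi> 0 = 1 \<longrightarrow> (\<forall>s\<in>{0..S}. 0 < \<psi> s \<and> \<psi> s \<le> 1 \<and>
    (\<psi> has_real_derivative - (avg n (\<lambda>x. \<psi> x powr p) s powr (1 / k))) (at s within {0..S})) \<longrightarrow> False"
proof -
  define \<beta> where "\<beta> = p / k - 1"
  have k0: "0 < real k" using k by simp
  have \<beta>: "0 < \<beta>" using p k0 by (simp add: \<beta>_def)
  define \<alpha> where "\<alpha> = 1 / \<beta>"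
  have \<alpha>: "0 < \<alpha>" "\<alpha> * (p - k) = k"
    using \<beta> p k0 by (auto simp: \<alpha>_def \<beta>_def field_simps)
  \<comment> \<open>The exponent of the bound for \<open>P\<close>; multiplied by p - k, its
    negativity is exactly subcriticality, because \<alpha> (p - k) = k.\<close>
  define \<mu> where "\<mu> = real n - \<alpha> * (p + 1)"
  have \<mu>: "\<mu> < 0"
  proof -
    have "real n * (p - k) < (\<alpha> * (p + 1)) * (p - k)"
    proof -
      have "(\<alpha> * (p + 1)) * (p - k) = (\<alpha> * (p - k)) * (p + 1)" by (simp only: mult_ac)
      also have "\<dots> = real k * (p + 1)" unfolding \<alpha>(2) ..
      finally show ?thesis using subcritical by (simp only:)
    qed
    then show ?thesis using p by (simp add: \<mu>_def)
  qed
  \<comment> \<open>Between \<open>s\<close> and \<open>2 * s\<close> the mean retains at least the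
    fraction (1/2)^n of its value at \<open>s\<close>; the k-th root of this fraction is
    \<open>c2\<close>.\<close>
  define c2 where "c2 = ((1 / 2) ^ n) powr (1 / k)"
  have c2: "0 < c2" by (simp add: c2_def)
  \<comment> \<open>The coefficient in the derivative of \<open>P\<close>. Over the common
    denominator its numerator is k (p + 1) - n (p - k).\<close>
  define e where "e = real n / (p + 1) - (real n - real k) / (real k + 1)"
  have e: "0 < e"
  proof -
    have "e = (real k * (p + 1) - real n * (p - real k)) / ((p + 1) * (real k + 1))"
      using p k0 unfolding e_def by (subst diff_frac_eq) (auto simp: algebra_simps)
    moreover have "0 < (p + 1) * (real k + 1)" using p k0 by (intro mult_pos_pos) auto
    ultimately show ?thesis using subcritical by simp
  qed
  \<comment> \<open>The growth of \<open>P\<close> over [1/4, 1/2], where \<psi> is at least 1/2: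
    the interval length times a lower bound for its derivative.\<close>
  define m where "m = 1 / 4 * (e * (1 / 4) ^ n * ((1 / 2) powr p * ((1 / 2) powr p) powr (1 / k)))"
  have m: "0 < m" using e by (simp add: m_def)
  define C where "C = \<beta> powr (- \<alpha> * (k + 1)) / c2 ^ (k + 1) + real n * \<beta> powr (- \<alpha> * (p + 1))"
  have "((\<lambda>s. C * s powr \<mu>) \<longlongrightarrow> C * 0) at_top"
    by (intro tendsto_intros tendsto_neg_powr \<mu> filterlim_ident)
  then have "\<forall>\<^sub>F s in at_top. C * s powr \<mu> < m" using m by (intro order_tendstoD(2)) auto
  then obtain s1 where s1: "\<And>s. s1 \<le> s \<Longrightarrow> C * s powr \<mu> < m" by (auto simp: eventually_at_top_linorder)
  have "False" if S: "max 2 (2 * s1) \<le> S" and \<psi>0: "\<psi> 0 = 1"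
    and H: "\<forall>s\<in>{0..S}. 0 < \<psi> s \<and> \<psi> s \<le> 1 \<and>
      (\<psi> has_real_derivative - (avg n (\<lambda>x. \<psi> x powr p) s powr (1 / k))) (at s within {0..S})" for S \<psi>
  proof -
    define y where "y = avg n (\<lambda>x. \<psi> x powr p)"
    define w where "w = (\<lambda>s. y s powr (1 / k))"
    have pos: "0 < \<psi> s" and le1: "\<psi> s \<le> 1" if "s \<in> {0..S}" for s using H that by auto
    have d0: "(\<psi> has_real_derivative - w s) (at s within {0..S})" if "s \<in> {0..S}" for s
      using H that by (simp add: w_def y_def)
    have inter: "at s within {0..S} = at s" if "0 < s" "s < S" for s
      using that by (intro at_within_interior) auto
    have d: "(\<psi> has_real_derivative - w s) (at s)" if "0 < s" "s < S" for s
      using d0[of s] that inter by auto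
    have \<psi>c: "continuous_on {0..S} \<psi>" using d0 by (rule DERIV_continuous_on)
    have hc: "continuous_on {0..S} (\<lambda>x. \<psi> x powr p)"
      using p k0 pos by (intro continuous_on_powr_nonneg \<psi>c) (auto intro: less_imp_le)
    have hcs: "continuous_on {0..s} (\<lambda>x. \<psi> x powr p)" if "s \<le> S" for s
      by (rule continuous_on_subset[OF hc]) (use that in auto)
    have yc: "continuous_on {0..S} y" unfolding y_def by (rule avg_continuous[OF hc n])
    have w0: "0 \<le> w s" for s by (simp add: w_def)
    have dec: "\<psi> t \<le> \<psi> s" if "0 \<le> s" "s \<le> t" "t \<le> S" for s t
    proof (rule DERIV_nonpos_imp_decreasing_open[where f = \<psi>])
      show "continuous_on {s..t} \<psi>" by (rule continuous_on_subset[OF \<psi>c]) (use that in auto)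
      fix x assume "s < x" "x < t"
      then show "\<exists>l. (\<psi> has_real_derivative l) (at x) \<and> l \<le> 0"
        using d[of x] that w0 by (intro exI[of _ "- w x"]) auto
    qed (use that in auto)
    have y_ge: "\<psi> s powr p \<le> y s" if "s \<in> {0..S}" for s
      unfolding y_def using that pos dec p k0
      by (intro avg_ge n hcs powr_mono2) (auto intro: less_imp_le)
    have ypos: "0 < y s" if "s \<in> {0..S}" for s
    proof -
      have "0 < \<psi> s powr p" using pos[OF that] by simp
      then show ?thesis using y_ge[OF that] by linarith
    qed
    have y_le1: "y s \<le> 1" if "s \<in> {0..S}" for s
      unfolding y_def
    proof (rule avg_le[OF n _ hcs])
      fix x assume "x \<in> {0..s}"
      then have "x \<in> {0..S}" using that by auto
      then show "\<psi> x powr p \<le> 1" using pos[of x] le1[of x] p k0 powr_mono2[of p "\<psi> x" 1] by auto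
    qed (use that in auto)
    have w_le1: "w s \<le> 1" if "s \<in> {0..S}" for s
      using powr_mono2[of "1 / k" "y s" 1] y_le1[OF that] ypos[OF that] k0 by (simp add: w_def)
    have \<psi>_ge: "1 - s \<le> \<psi> s" if "s \<in> {0..S}" for s
    proof -
      have "\<psi> 0 + 0 \<le> \<psi> s + s"
      proof (rule DERIV_nonneg_imp_increasing_open[where f = "\<lambda>s. \<psi> s + s"])
        show "continuous_on {0..s} (\<lambda>s. \<psi> s + s)"
          by (intro continuous_intros continuous_on_subset[OF \<psi>c]) (use that in auto)
        fix x assume x: "0 < x" "x < s"
        then have "((\<lambda>s. \<psi> s + s) has_real_derivative - w x + 1) (at x)"
          using that by (intro derivative_intros d) auto
        then show "\<exists>l. ((\<lambda>s. \<psi> s + s) has_real_derivative l) (at x) \<and> 0 \<le> l"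
          using w_le1[of x] x that by (intro exI[of _ "- w x + 1"]) auto
      qed (use that in auto)
      then show ?thesis using \<psi>0 by simp
    qed
    \<comment> \<open>Since \<psi> decreases, \<open>w\<close> is at least \<psi>^(p/k); thus
      \<psi>^(-\<beta>) grows at rate at least \<beta>.\<close>
    have decay: "\<psi> s \<le> (\<beta> * s) powr (- \<alpha>)" if s: "0 < s" "s \<le> S" for s
    proof -
      have "\<psi> 0 powr (- \<beta>) - \<beta> * 0 \<le> \<psi> s powr (- \<beta>) - \<beta> * s"
      proof (rule DERIV_nonneg_imp_increasing_open[where f = "\<lambda>s. \<psi> s powr (- \<beta>) - \<beta> * s"])
        show "continuous_on {0..s} (\<lambda>s. \<psi> s powr (- \<beta>) - \<beta> * s)"
          using pos s by (intro continuous_on_diff continuous_on_powr continuous_intros continuous_on_subset[OF \<psi>c])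
            (auto simp: less_imp_neq[symmetric])
        fix x assume x: "0 < x" "x < s"
        have px: "0 < \<psi> x" using pos[of x] x s by auto
        have "((\<lambda>s. \<psi> s powr (- \<beta>)) has_real_derivative (- \<beta>) * \<psi> x powr (- \<beta> - 1) * (- w x)) (at x)"
          using DERIV_chain2[OF has_real_derivative_powr[OF px, of "- \<beta>"] d[of x]] x s by simp
        then have 1: "((\<lambda>s. \<psi> s powr (- \<beta>) - \<beta> * s) has_real_derivative \<beta> * (\<psi> x powr (- \<beta> - 1) * w x) - \<beta>) (at x)"
          using DERIV_diff[OF _ DERIV_cmult_Id[of \<beta>], of "\<lambda>s. \<psi> s powr (- \<beta>)"] by (simp add: mult.assoc)
        have "(\<psi> x powr p) powr (1 / k) \<le> w x"
          unfolding w_def using y_ge[of x] x s k0 by (intro powr_mono2) auto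
        then have "\<psi> x powr (- \<beta> - 1) * (\<psi> x powr (p / k)) \<le> \<psi> x powr (- \<beta> - 1) * w x"
          by (intro mult_left_mono) (auto simp: powr_powr)
        moreover have "\<psi> x powr (- \<beta> - 1) * (\<psi> x powr (p / k)) = 1"
          using px by (simp add: powr_add[symmetric] \<beta>_def)
        ultimately have "0 \<le> \<beta> * (\<psi> x powr (- \<beta> - 1) * w x) - \<beta>"
          using \<beta> by simp
        then show "\<exists>l. ((\<lambda>s. \<psi> s powr (- \<beta>) - \<beta> * s) has_real_derivative l) (at x) \<and> 0 \<le> l"
          using 1 by blast
      qed (use s in auto)
      then have "\<beta> * s \<le> \<psi> s powr (- \<beta>)" using \<psi>0 by simp
      then have "(\<psi> s powr (- \<beta>)) powr (- \<alpha>) \<le> (\<beta> * s) powr (- \<alpha>)"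
        using \<alpha> \<beta> s by (intro powr_mono2') auto
      then show ?thesis using pos[of s] s \<beta> by (simp add: powr_powr \<alpha>_def)
    qed
    \<comment> \<open>The mean value theorem on [s, 2s] yields a point where \<open>w\<close> is at
      most \<psi>(s)/s; monotonicity of the moment carries the bound back to
      \<open>s\<close>.\<close>
    have w_le: "w s \<le> \<psi> s / (s * c2)" if s: "0 < s" "2 * s \<le> S" for s
    proof -
      have "\<exists>l z. s < z \<and> z < 2 * s \<and> DERIV \<psi> z :> l \<and> \<psi> (2 * s) - \<psi> s = (2 * s - s) * l"
      proof (rule MVT)
        show "continuous_on {s..2 * s} \<psi>" by (rule continuous_on_subset[OF \<psi>c]) (use s in auto)
        show "\<psi> differentiable at x" if "s < x" "x < 2 * s" for x
          using d[of x] that s by (auto simp: real_differentiable_def)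
      qed (use s in auto)
      then obtain z where z: "s < z" "z < 2 * s" "\<psi> (2 * s) - \<psi> s = s * - w z"
        using d s by (smt (verit) DERIV_unique)
      have zS: "z \<in> {0..S}" "s \<in> {0..S}" "2 * s \<in> {0..S}" using z s by auto
      have "s ^ n * y s \<le> z ^ n * y z"
        unfolding y_def using zS z s by (intro avg_moment_mono hcs) auto
      also have "\<dots> \<le> (2 * s) ^ n * y z"
        using z s ypos[OF zS(1)] by (intro mult_right_mono power_mono) auto
      finally have "(1 / 2) ^ n * y s \<le> y z" using s by (simp add: power_mult_distrib field_simps)
      then have "((1 / 2) ^ n * y s) powr (1 / k) \<le> w z"
        unfolding w_def using ypos[OF zS(2)] k0 by (intro powr_mono2) auto
      then have "c2 * w s \<le> w z" using ypos[OF zS(2)] by (simp add: powr_mult c2_def w_def)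
      then have "s * (c2 * w s) \<le> s * w z" using s by (intro mult_left_mono) auto
      also have "\<dots> \<le> \<psi> s" using z(3) pos[OF zS(3)] by simp
      finally show ?thesis using s c2 by (simp add: field_simps)
    qed
    \<comment> \<open>the one-dimensional Pohozaev functional\<close>
    define P where "P = (\<lambda>s. k / (k + 1) * (s ^ (n + 1) * (y s * w s)) + real n / (p + 1) * (s ^ n * \<psi> s powr (p + 1))
        - real n / (p + 1) * (\<psi> s * (s ^ n * y s)))"
    have wc: "continuous_on {0..S} w"
      unfolding w_def using k0 ypos by (intro continuous_on_powr_nonneg yc) (auto intro: less_imp_le)
    have pc: "continuous_on {0..S} (\<lambda>s. \<psi> s powr (p + 1))"
      by (rule continuous_on_powr_nonneg[OF \<psi>c]) (use p k0 pos in \<open>auto intro: less_imp_le\<close>)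
    have Pc: "continuous_on {0..S} P"
      unfolding P_def
      by (intro continuous_on_diff continuous_on_add continuous_on_mult continuous_on_const
          continuous_on_power continuous_on_id \<psi>c yc wc pc)
    \<comment> \<open>The weights in \<open>P\<close> are chosen so that the terms with \<psi>^p w
      and with \<psi>^(p+1) cancel; only a multiple of s^n y w survives.\<close>
    have Pd: "(P has_real_derivative e * (x ^ n * (y x * w x))) (at x)" if x: "0 < x" "x < S" for x
    proof -
      have xS: "x \<in> {0..S}" using x by auto
      define y' where "y' = real n * (\<psi> x powr p - y x) / x"
      have yd: "(y has_real_derivative y') (at x)"
        using avg_derivative[OF hc xS x(1) n] inter[OF x] unfolding y_def y'_def by simp
      have yw: "((\<lambda>s. y s * w s) has_real_derivative (1 + 1 / k) * w x * y') (at x)"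
      proof -
        have "((\<lambda>s. y s powr (1 + 1 / k)) has_real_derivative (1 + 1 / k) * y x powr (1 + 1 / k - 1) * y') (at x)"
          by (rule DERIV_chain2[OF has_real_derivative_powr[OF ypos[OF xS]] yd])
        then have 1: "((\<lambda>s. y s powr (1 + 1 / k)) has_real_derivative (1 + 1 / k) * w x * y') (at x)"
          by (simp add: w_def)
        have 2: "y s powr (1 + 1 / k) = y s * w s" if "s \<in> {0<..<S}" for s
          using ypos[of s] that by (simp add: powr_add w_def)
        show ?thesis
          by (rule has_field_derivative_transform_within_open[OF 1 open_greaterThanLessThan[of 0 S]])
            (use x 2 in auto)
      qed
      have sy: "((\<lambda>s. s ^ n * y s) has_real_derivative real n * x ^ (n - 1) * \<psi> x powr p) (at x)"
        using avg_moment_derivative[OF hc xS x(1), of n] inter[OF x] unfolding y_def by simp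
      have \<psi>p: "((\<lambda>s. \<psi> s powr (p + 1)) has_real_derivative (p + 1) * \<psi> x powr p * (- w x)) (at x)"
        using DERIV_chain2[OF has_real_derivative_powr[OF pos[OF xS], of "p + 1"] d[OF x]] by simp
      have pw: "((\<lambda>s. s ^ m) has_real_derivative real m * x ^ (m - 1)) (at x)" for m
        by (auto intro!: derivative_eq_intros)
      have "(P has_real_derivative k / (k + 1) * (real (n + 1) * x ^ (n + 1 - 1) * (y x * w x) + (1 + 1 / k) * w x * y' * x ^ (n + 1))
          + real n / (p + 1) * (real n * x ^ (n - 1) * \<psi> x powr (p + 1) + (p + 1) * \<psi> x powr p * (- w x) * x ^ n)
          - real n / (p + 1) * (- w x * (x ^ n * y x) + real n * x ^ (n - 1) * \<psi> x powr p * \<psi> x)) (at x)"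
        unfolding P_def by (intro DERIV_diff DERIV_add DERIV_cmult DERIV_mult pw yw \<psi>p sy d x)
      moreover have "k / (k + 1) * (real (n + 1) * x ^ (n + 1 - 1) * (y x * w x) + (1 + 1 / k) * w x * y' * x ^ (n + 1))
          + real n / (p + 1) * (real n * x ^ (n - 1) * \<psi> x powr (p + 1) + (p + 1) * \<psi> x powr p * (- w x) * x ^ n)
          - real n / (p + 1) * (- w x * (x ^ n * y x) + real n * x ^ (n - 1) * \<psi> x powr p * \<psi> x)
        = e * (x ^ n * (y x * w x))"
      proof -
        have a: "y' * x ^ (n + 1) = real n * (\<psi> x powr p - y x) * x ^ n" using x by (simp add: y'_def)
        have b: "\<psi> x powr (p + 1) = \<psi> x powr p * \<psi> x" using pos[OF xS] by (simp add: powr_add)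
        have c: "k / (k + 1) * ((1 + 1 / k) * w x * y' * x ^ (n + 1)) = w x * (real n * (\<psi> x powr p - y x) * x ^ n)"
        proof -
          have "1 + 1 / real k = (real k + 1) / real k" using k0 by (simp add: add_divide_distrib)
          then have one: "k / (k + 1) * (1 + 1 / k) = 1" using k0 by simp
          have "k / (k + 1) * ((1 + 1 / k) * w x * y' * x ^ (n + 1))
            = (k / (k + 1) * (1 + 1 / k)) * (w x * (y' * x ^ (n + 1)))" by (simp only: mult_ac)
          then show ?thesis unfolding one a by simp
        qed
        have dd: "real n / (p + 1) * ((p + 1) * \<psi> x powr p * (- w x) * x ^ n) = - (real n * \<psi> x powr p * w x * x ^ n)"
          using p k0 by simp
        have ee: "k / (k + 1) * real (n + 1) - real n = - ((real n - real k) / (real k + 1))"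
          using k0 by (simp add: field_simps)
        have "k / (k + 1) * (real (n + 1) * x ^ (n + 1 - 1) * (y x * w x) + (1 + 1 / k) * w x * y' * x ^ (n + 1))
          + real n / (p + 1) * (real n * x ^ (n - 1) * \<psi> x powr (p + 1) + (p + 1) * \<psi> x powr p * (- w x) * x ^ n)
          - real n / (p + 1) * (- w x * (x ^ n * y x) + real n * x ^ (n - 1) * \<psi> x powr p * \<psi> x)
          = (k / (k + 1) * real (n + 1) - real n) * (x ^ n * (y x * w x)) + real n / (p + 1) * (x ^ n * (y x * w x))"
          unfolding distrib_left c dd b by (simp add: algebra_simps add_divide_distrib)
        then show ?thesis unfolding ee e_def by (simp add: algebra_simps)
      qed
      ultimately show ?thesis by simp
    qed
    have Pmono: "P s \<le> P t" if "0 \<le> s" "s \<le> t" "t \<le> S" for s t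
    proof (rule DERIV_nonneg_imp_increasing_open[where f = P])
      show "continuous_on {s..t} P" by (rule continuous_on_subset[OF Pc]) (use that in auto)
      fix x assume x: "s < x" "x < t"
      have "0 \<le> e * (x ^ n * (y x * w x))"
        using x that e ypos[of x] w0[of x] by (intro mult_nonneg_nonneg) auto
      then show "\<exists>l. (P has_real_derivative l) (at x) \<and> 0 \<le> l" using Pd[of x] x that by auto
    qed (use that in auto)
    have S2: "2 \<le> S" "s1 \<le> S / 2" using S by auto
    have "m \<le> P (1 / 2)"
    proof -
      have "\<exists>l z. 1 / 4 < z \<and> z < 1 / 2 \<and> DERIV P z :> l \<and> P (1 / 2) - P (1 / 4) = (1 / 2 - 1 / 4) * l"
      proof (rule MVT)
        show "continuous_on {1 / 4..1 / 2} P" by (rule continuous_on_subset[OF Pc]) (use S2 in auto)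
        show "P differentiable at x" if "1 / 4 < x" "x < 1 / 2" for x
          using Pd[of x] that S2 by (auto simp: real_differentiable_def)
      qed auto
      then obtain z l where z: "1 / 4 < z" "z < 1 / 2" "DERIV P z :> l" "P (1 / 2) - P (1 / 4) = (1 / 2 - 1 / 4) * l"
        by blast
      have l: "l = e * (z ^ n * (y z * w z))" using DERIV_unique[OF z(3) Pd[of z]] z S2 by auto
      have zS: "z \<in> {0..S}" using z S2 by auto
      have "(1 / 2) powr p \<le> \<psi> z powr p" using \<psi>_ge[OF zS] z p k0 by (intro powr_mono2) auto
      then have yz: "(1 / 2) powr p \<le> y z" using y_ge[OF zS] by linarith
      then have "((1 / 2) powr p) powr (1 / k) \<le> w z" unfolding w_def using k0 by (intro powr_mono2) auto
      then have "e * ((1 / 4) ^ n * ((1 / 2) powr p * ((1 / 2) powr p) powr (1 / k))) \<le> l"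
        unfolding l using yz z e ypos[OF zS] by (intro mult_left_mono mult_mono power_mono) auto
      then have "m \<le> P (1 / 2) - P (1 / 4)" unfolding z(4) m_def by simp
      moreover have "P 0 \<le> P (1 / 4)" using S2 by (intro Pmono) auto
      moreover have "P 0 = 0" using n by (simp add: P_def zero_power)
      ultimately show ?thesis by linarith
    qed
    also have "\<dots> \<le> P (S / 2)" using S2 by (intro Pmono) auto
    finally have lower: "m \<le> P (S / 2)" .
    define s where "s = S / 2"
    have s: "0 < s" "2 * s \<le> S" "s \<in> {0..S}" "s1 \<le> s" using S2 by (auto simp: s_def)
    have ys: "y s = w s ^ k" using ypos[OF s(3)] k0 by (simp add: w_def powr_power)
    have "P s \<le> 1 * (s ^ (n + 1) * (y s * w s)) + real n / (p + 1) * (s ^ n * \<psi> s powr (p + 1))"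
    proof -
      have "0 \<le> real n / (p + 1) * (\<psi> s * (s ^ n * y s))"
        using p k0 pos[OF s(3)] ypos[OF s(3)] s by (intro mult_nonneg_nonneg) auto
      moreover have "k / (k + 1) * (s ^ (n + 1) * (y s * w s)) \<le> 1 * (s ^ (n + 1) * (y s * w s))"
        using ypos[OF s(3)] s w0 by (intro mult_right_mono mult_nonneg_nonneg) auto
      ultimately show ?thesis unfolding P_def by linarith
    qed
    also have "real n / (p + 1) * (s ^ n * \<psi> s powr (p + 1)) \<le> real n * (s ^ n * ((\<beta> * s) powr (- \<alpha>)) powr (p + 1))"
      using p k0 s pos[OF s(3)] decay[of s]
      by (intro mult_mono powr_mono2) (auto simp: divide_le_eq mult_le_cancel_left1)
    also have "real n * (s ^ n * ((\<beta> * s) powr (- \<alpha>)) powr (p + 1)) = real n * \<beta> powr (- \<alpha> * (p + 1)) * s powr \<mu>"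
    proof -
      have "((\<beta> * s) powr (- \<alpha>)) powr (p + 1) = \<beta> powr (- \<alpha> * (p + 1)) * s powr (- \<alpha> * (p + 1))"
        using s \<beta> by (simp only: powr_powr powr_mult)
      moreover have "s ^ n = s powr real n" using s by (simp only: powr_realpow)
      moreover have "s powr real n * s powr (- \<alpha> * (p + 1)) = s powr \<mu>"
        by (simp add: powr_add[symmetric] \<mu>_def)
      ultimately show ?thesis by (simp add: mult.left_commute mult.assoc)
    qed
    also have "1 * (s ^ (n + 1) * (y s * w s)) \<le> \<beta> powr (- \<alpha> * (k + 1)) / c2 ^ (k + 1) * s powr \<mu>"
    proof -
      have "y s * w s = w s ^ (k + 1)" by (simp add: ys)
      also have "\<dots> \<le> (((\<beta> * s) powr (- \<alpha>)) / (s * c2)) ^ (k + 1)"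
      proof (rule power_mono)
        show "w s \<le> (\<beta> * s) powr (- \<alpha>) / (s * c2)"
          using w_le[OF s(1,2)] decay[of s] s c2 divide_right_mono[of "\<psi> s" "(\<beta> * s) powr (- \<alpha>)" "s * c2"] by auto
      qed (rule w0)
      finally have "s ^ (n + 1) * (y s * w s) \<le> s ^ (n + 1) * (((\<beta> * s) powr (- \<alpha>)) / (s * c2)) ^ (k + 1)"
        using s by (intro mult_left_mono) auto
      also have "\<dots> = \<beta> powr (- \<alpha> * (k + 1)) / c2 ^ (k + 1) * (s powr (n + 1) * s powr (- \<alpha> * (k + 1)) / s powr (k + 1))"
      proof -
        have a: "((\<beta> * s) powr (- \<alpha>)) ^ (k + 1) = \<beta> powr (- \<alpha> * (k + 1)) * s powr (- \<alpha> * (k + 1))"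
        proof -
          have "((\<beta> * s) powr (- \<alpha>)) ^ (k + 1) = ((\<beta> * s) powr (- \<alpha>)) powr real (k + 1)"
            using s \<beta> by (subst powr_realpow) auto
          then show ?thesis using s \<beta> by (simp only: powr_powr powr_mult)
        qed
        have b: "s ^ (n + 1) = s powr real (n + 1)" "s ^ (k + 1) = s powr real (k + 1)"
          using s by (simp_all only: powr_realpow)
        show ?thesis unfolding power_divide power_mult_distrib[of s c2] a b by (simp add: mult_ac)
      qed
      \<comment> \<open>By \<alpha> (p - k) = k the term with \<open>y\<close> and \<open>w\<close>
        has the same exponent as the term with \<psi>^(p+1).\<close>
      also have "s powr (n + 1) * s powr (- \<alpha> * (k + 1)) / s powr (k + 1) = s powr \<mu>"
      proof -
        have "s powr (n + 1) * s powr (- \<alpha> * (k + 1)) / s powr (k + 1) = s powr (real (n + 1) + - \<alpha> * real (k + 1) - real (k + 1))"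
          by (simp only: powr_add powr_diff)
        moreover have "real (n + 1) + - \<alpha> * real (k + 1) - real (k + 1) = \<mu>"
          using \<alpha>(2) by (simp add: \<mu>_def algebra_simps)
        ultimately show ?thesis by (simp only:)
      qed
      finally show ?thesis by simp
    qed
    finally have "P s \<le> C * s powr \<mu>" by (simp add: C_def algebra_simps)
    then show False using lower s1[OF s(4)] by (simp add: s_def)
  qed
  then show ?thesis by (intro exI[of _ "max 2 (2 * s1)"]) auto
qed

lemma superlinear_profile_exists:
  fixes n k :: nat and p :: real
  assumes n: "1 \<le> n" and k: "1 \<le> k" and p: "real k < p"
    and subcritical: "real n * (p - real k) < real k * (p + 1)"
  shows "\<exists>S \<psi>. profile n k p S \<psi>"
proof -
  obtain S where S: "1 \<le> S" "\<And>\<psi>. \<psi> 0 = 1 \<Longrightarrow> (\<forall>s\<in>{0..S}. 0 < \<psi> s \<and> \<psi> s \<le> 1 \<and>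
    (\<psi> has_real_derivative - (avg n (\<lambda>x. \<psi> x powr p) s powr (1 / k))) (at s within {0..S})) \<Longrightarrow> False"
    using positive_solution_interval_bounded[OF assms] by blast
  have p1: "1 \<le> p" using p k by simp
  obtain \<psi> where \<psi>: "\<psi> 0 = 1" and H: "\<And>s. s \<in> {0..S} \<Longrightarrow> \<psi> s \<le> 1"
    "\<And>s. s \<in> {0..S} \<Longrightarrow> 0 < avg n (\<lambda>x. max 0 (\<psi> x) powr p) s"
    "\<And>s. s \<in> {0..S} \<Longrightarrow> (\<psi> has_real_derivative - (avg n (\<lambda>x. max 0 (\<psi> x) powr p) s powr (1 / k))) (at s within {0..S})"
    using initial_value_problem_solvable[OF n k p1 S(1)] by blast
  have \<psi>c: "continuous_on {0..S} \<psi>" using H(3) by (rule DERIV_continuous_on)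
  have avg_eq: "avg n (\<lambda>x. max 0 (\<psi> x) powr p) s = avg n (\<lambda>x. \<psi> x powr p) s"
    if "0 \<le> s" "\<And>x. x \<in> {0..s} \<Longrightarrow> 0 \<le> \<psi> x" for s
    using that by (intro avg_cong) auto
  have "\<exists>s\<in>{0..S}. \<psi> s \<le> 0"
  proof (rule ccontr)
    assume "\<not> ?thesis"
    then have pos: "0 < \<psi> s" if "s \<in> {0..S}" for s using that by force
    have "(\<psi> has_real_derivative - (avg n (\<lambda>x. \<psi> x powr p) s powr (1 / k))) (at s within {0..S})" if s: "s \<in> {0..S}" for s
    proof -
      have "0 \<le> \<psi> x" if "x \<in> {0..s}" for x using pos[of x] that s by auto
      then show ?thesis using H(3)[OF s] avg_eq[of s] s by simp
    qed
    then show False using S(2)[of \<psi>, OF \<psi>] pos H(1) by blast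
  qed
  then obtain s2 where s2: "s2 \<in> {0..S}" "\<psi> s2 \<le> 0" by blast
  obtain s0 where s0: "0 \<le> s0" "s0 \<le> s2" "\<psi> s0 = 0"
    using IVT2'[of \<psi> s2 0 0] s2 \<psi> continuous_on_subset[OF \<psi>c, of "{0..s2}"] by auto
  have "s0 \<noteq> 0" using s0 \<psi> by auto
  then have s0S: "0 < s0" "s0 \<le> S" using s0 s2 by auto
  \<comment> \<open>The mean in the slope stays positive, so \<psi> is strictly decreasing and the
    zero already found is the first one.\<close>
  have pos: "0 < \<psi> s" if s: "s \<in> {0..<s0}" for s
  proof -
    have "\<psi> s0 < \<psi> s"
    proof (rule DERIV_neg_imp_decreasing_open[where f = \<psi>])
      show "continuous_on {s..s0} \<psi>" by (rule continuous_on_subset[OF \<psi>c]) (use s s0S in auto)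
      fix x assume x: "s < x" "x < s0"
      then have "at x within {0..S} = at x" using s s0S by (intro at_within_interior) auto
      then show "\<exists>l. (\<psi> has_real_derivative l) (at x) \<and> l < 0"
        using H(2,3)[of x] x s s0S by (intro exI[of _ "- (avg n (\<lambda>x. max 0 (\<psi> x) powr p) x powr (1 / k))"]) auto
    qed (use s in auto)
    then show ?thesis using s0 by simp
  qed
  have "profile n k p s0 \<psi>"
    unfolding profile_def
  proof (intro conjI ballI s0S(1) s0(3) pos)
    fix s assume s: "s \<in> {0..s0}"
    have "0 \<le> \<psi> x" if "x \<in> {0..s}" for x using pos[of x] s0(3) that s by (cases "x = s0") auto
    then have "avg n (\<lambda>x. max 0 (\<psi> x) powr p) s = avg n (\<lambda>x. \<psi> x powr p) s" using s by (intro avg_eq) auto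
    then have "(\<psi> has_real_derivative - (avg n (\<lambda>x. \<psi> x powr p) s powr (1 / k))) (at s within {0..S})"
      using H(3)[of s] s s0S by simp
    then show "(\<psi> has_real_derivative - (avg n (\<lambda>x. \<psi> x powr p) s powr (1 / k))) (at s within {0..s0})"
      by (rule has_field_derivative_subset) (use s0S in auto)
  qed
  then show ?thesis by blast
qed

section \<open>Radial solutions\<close>

text \<open>Twice differentiability of \<psi> amounts to differentiability of the mean
  \<open>y\<close>, with a derivative continuous up to both ends. Near 0 the quotient formula is
  singular and integration by parts replaces it; near \<open>S\<close> the factor \<psi>^(p-1) blows
  up when p < 1, so there the quotient formula is kept.\<close>

lemma profile_regularity:
  fixes n k :: nat and p S :: real
  assumes n: "1 \<le> n" and k: "1 \<le> k" and p: "0 < p" and prof: "profile n k p S \<psi>"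
  obtains w w' where
    "\<And>s. s \<in> {0..S} \<Longrightarrow> (\<psi> has_real_derivative - w s) (at s within {0..S})"
    "\<And>s. s \<in> {0..S} \<Longrightarrow> (w has_real_derivative w' s) (at s within {0..S})"
    "continuous_on {0..S} w'"
    "\<And>s. s \<in> {0..S} \<Longrightarrow> real n * w s ^ k + real k * s * w s ^ (k - 1) * w' s = real n * \<psi> s powr p"
proof -
  define h where "h = (\<lambda>x. \<psi> x powr p)"
  define y where "y = avg n h"
  define w where "w = (\<lambda>s. y s powr (1 / k))"
  have S: "0 < S" and \<psi>S: "\<psi> S = 0" and pos: "\<And>s. s \<in> {0..<S} \<Longrightarrow> 0 < \<psi> s"
    and d: "\<And>s. s \<in> {0..S} \<Longrightarrow> (\<psi> has_real_derivative - w s) (at s within {0..S})"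
    using prof by (auto simp: profile_def w_def y_def h_def)
  have k0: "0 < real k" using k by simp
  have nonneg: "0 \<le> \<psi> s" if "s \<in> {0..S}" for s using pos[of s] \<psi>S that by (cases "s = S") auto
  have w0: "0 \<le> w s" for s by (simp add: w_def)
  have \<psi>c: "continuous_on {0..S} \<psi>" using d by (rule DERIV_continuous_on)
  have hc: "continuous_on {0..S} h" unfolding h_def by (rule continuous_on_powr_nonneg[OF \<psi>c nonneg p])
  have hcs: "continuous_on {0..s} h" if "s \<le> S" for s
    by (rule continuous_on_subset[OF hc]) (use that in auto)
  have yc: "continuous_on {0..S} y" unfolding y_def by (rule avg_continuous[OF hc n])
  have dec: "\<psi> t \<le> \<psi> s" if "0 \<le> s" "s \<le> t" "t \<le> S" for s t
  proof (rule DERIV_nonpos_imp_decreasing_open[where f = \<psi>])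
    show "continuous_on {s..t} \<psi>" by (rule continuous_on_subset[OF \<psi>c]) (use that in auto)
    fix x assume x: "s < x" "x < t"
    then have "at x within {0..S} = at x" using that by (intro at_within_interior) auto
    then show "\<exists>l. (\<psi> has_real_derivative l) (at x) \<and> l \<le> 0"
      using d[of x] x that w0 by (intro exI[of _ "- w x"]) auto
  qed (use that in auto)
  have ypos: "0 < y s" if s: "s \<in> {0..S}" for s
  proof -
    have *: "0 < y s" if "s \<in> {0..<S}" for s
    proof -
      have "\<psi> s powr p \<le> y s"
        unfolding y_def using that dec nonneg p by (intro avg_ge n hcs) (auto simp: h_def intro!: powr_mono2)
      moreover have "0 < \<psi> s powr p" using pos[OF that] by simp
      ultimately show ?thesis by linarith
    qed
    show ?thesis
    proof (cases "s = S")
      case True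
      \<comment> \<open>At the end point \<psi> itself vanishes, so positivity of the mean comes
        from the moment at \<open>S / 2\<close>.\<close>
      have "0 < (S / 2) ^ n * y (S / 2)" using *[of "S / 2"] S by (intro mult_pos_pos) auto
      also have "\<dots> \<le> S ^ n * y S"
        unfolding y_def using S by (intro avg_moment_mono hc) (auto simp: h_def)
      finally show ?thesis using True S by (simp add: zero_less_mult_iff)
    qed (use * s in auto)
  qed
  have wc: "continuous_on {0..S} w" unfolding w_def
    by (rule continuous_on_powr_nonneg[OF yc]) (use ypos k0 in \<open>auto intro: less_imp_le\<close>)
  define h' where "h' = (\<lambda>x. p * \<psi> x powr (p - 1) * (- w x))"
  have h'd: "(h has_real_derivative h' x) (at x within {0..S})" if "x \<in> {0..<S}" for x
    unfolding h_def h'_def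
    by (rule DERIV_chain2[OF has_real_derivative_powr[OF pos[OF that]] d]) (use that in auto)
  have h'c: "continuous_on {0..S / 2} h'"
    unfolding h'_def
  proof (intro continuous_on_mult continuous_on_const continuous_on_minus)
    show "continuous_on {0..S / 2} (\<lambda>x. \<psi> x powr (p - 1))"
      using pos S by (intro continuous_on_powr continuous_on_subset[OF \<psi>c] continuous_on_const)
        (auto simp: less_imp_neq[symmetric])
    show "continuous_on {0..S / 2} w" by (rule continuous_on_subset[OF wc]) (use S in auto)
  qed
  \<comment> \<open>The value at 0 is the limit supplied by \<open>avg_by_parts\<close>.\<close>
  define D where "D = (\<lambda>s. if s = 0 then real n / (real n + 1) * h' 0 else real n * (h s - y s) / s)"
  have D_eq: "D s = real n / (real n + 1) * avg (n + 1) h' s" if s: "s \<in> {0..S / 2}" for s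
  proof (cases "s = 0")
    case False
    have "real n * (h s - avg n h s) / s = real n / (real n + 1) * avg (n + 1) h' s"
    proof (rule avg_by_parts[OF n])
      show "continuous_on {0..s} h'" by (rule continuous_on_subset[OF h'c]) (use s in auto)
      fix x assume x: "x \<in> {0..s}"
      show "(h has_real_derivative h' x) (at x within {0..s})"
        by (rule has_field_derivative_subset[OF h'd]) (use x s S in auto)
    qed (use s False in auto)
    then show ?thesis using False by (simp add: D_def y_def)
  qed (simp add: D_def avg_def)
  have Dc: "continuous_on {0..S} D"
  proof -
    have "continuous_on {0..S / 2} (\<lambda>s. real n / (real n + 1) * avg (n + 1) h' s)"
      by (intro continuous_on_mult continuous_on_const avg_continuous h'c) simp
    moreover have "continuous_on {0..S / 2} D \<longleftrightarrow> continuous_on {0..S / 2} (\<lambda>s. real n / (real n + 1) * avg (n + 1) h' s)"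
      by (rule continuous_on_cong[OF refl]) (rule D_eq)
    ultimately have 1: "continuous_on {0..S / 2} D" by blast
    have "continuous_on {S / 2..S} (\<lambda>s. real n * (h s - y s) / s)"
      using S by (intro continuous_on_divide continuous_on_mult continuous_on_diff continuous_on_const continuous_on_id
          continuous_on_subset[OF hc] continuous_on_subset[OF yc]) auto
    moreover have "continuous_on {S / 2..S} D \<longleftrightarrow> continuous_on {S / 2..S} (\<lambda>s. real n * (h s - y s) / s)"
      by (rule continuous_on_cong[OF refl]) (use S in \<open>simp add: D_def\<close>)
    ultimately have 2: "continuous_on {S / 2..S} D" by blast
    have "continuous_on ({0..S / 2} \<union> {S / 2..S}) D"
      by (intro continuous_on_closed_Un closed_atLeastAtMost 1 2)
    moreover have "{0..S / 2} \<union> {S / 2..S} = {0..S}" using S by auto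
    ultimately show ?thesis by simp
  qed
  have yd: "(y has_real_derivative D s) (at s within {0..S})" if s: "s \<in> {0..S}" for s
  proof -
    have y_eq: "y 0 + integral {0..t} D = y t" if t: "t \<in> {0..S}" for t
    proof -
      have "(D has_integral (y t - y 0)) {0..t}"
      proof (rule fundamental_theorem_of_calculus_interior)
        show "continuous_on {0..t} y" by (rule continuous_on_subset[OF yc]) (use t in auto)
        fix x assume x: "x \<in> {0<..<t}"
        then have "at x within {0..S} = at x" using t by (intro at_within_interior) auto
        then have "(y has_real_derivative D x) (at x)"
          using avg_derivative[OF hc, of x n] x t n by (simp add: D_def y_def)
        then show "(y has_vector_derivative D x) (at x)"
          by (simp add: has_real_derivative_iff_has_vector_derivative)
      qed (use t in auto)
      then show ?thesis by (simp add: integral_unique)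
    qed
    have "((\<lambda>t. y 0 + integral {0..t} D) has_real_derivative 0 + D s) (at s within {0..S})"
      by (intro DERIV_add DERIV_const integral_has_real_derivative Dc s)
    then have "((\<lambda>t. y 0 + integral {0..t} D) has_real_derivative D s) (at s within {0..S})" by simp
    then show ?thesis
      by (rule has_field_derivative_transform_within[where d = 1]) (use s y_eq in auto)
  qed
  define w' where "w' = (\<lambda>s. 1 / k * y s powr (1 / k - 1) * D s)"
  show ?thesis
  proof (rule that[of w w'])
    show "(w has_real_derivative w' s) (at s within {0..S})" if "s \<in> {0..S}" for s
      unfolding w_def w'_def by (rule DERIV_chain2[OF has_real_derivative_powr[OF ypos[OF that]] yd[OF that]])
    show "continuous_on {0..S} w'"
      unfolding w'_def using ypos
      by (intro continuous_on_mult continuous_on_const continuous_on_powr yc Dc) (auto simp: less_imp_neq[symmetric])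
    \<comment> \<open>This is (s^n w^k)' = n s^(n-1) \<psi>^p divided by s^(n-1), a form that
      remains meaningful at 0.\<close>
    show "real n * w s ^ k + real k * s * w s ^ (k - 1) * w' s = real n * \<psi> s powr p" if s: "s \<in> {0..S}" for s
    proof -
      have wk: "w s ^ k = y s" using ypos[OF s] k0 by (simp add: w_def powr_power)
      have "w s ^ (k - 1) * y s powr (1 / k - 1) = 1"
      proof -
        have "w s ^ (k - 1) = y s powr (1 / k * real (k - 1))"
          unfolding w_def using ypos[OF s] by (simp add: powr_power mult.commute)
        then show ?thesis using k ypos[OF s] by (simp add: powr_add[symmetric] of_nat_diff field_simps)
      qed
      then have "real k * s * w s ^ (k - 1) * w' s = s * D s"
        using k0 by (simp add: w'_def mult.left_commute mult.assoc)
      also have "\<dots> = real n * (h s - y s)" by (simp add: D_def y_def avg_def)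
      finally show ?thesis unfolding wk by (simp add: h_def algebra_simps)
    qed
  qed (rule d)
qed

section \<open>From profiles on an interval to smooth radial functions on the whole space\<close>

lemma antiderivative_agreeing_on_interval:
  fixes f f' :: "real \<Rightarrow> real"
  assumes S: "0 \<le> S" and g: "\<And>x. isCont g x" and fg: "\<And>x. x \<in> {0..S} \<Longrightarrow> f' x = g x"
    and f: "\<And>x. x \<in> {0..S} \<Longrightarrow> (f has_real_derivative f' x) (at x within {0..S})"
  obtains F where "\<And>x. (F has_real_derivative g x) (at x)" "\<And>x. x \<in> {0..S} \<Longrightarrow> F x = f x"
proof -
  obtain G where "\<And>x. (G has_vector_derivative g x) (at x)"
    using einterval_antiderivative[of "-\<infinity>" "\<infinity>" g] g by auto
  then have G: "(G has_real_derivative g x) (at x)" for x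
    by (simp add: has_real_derivative_iff_has_vector_derivative)
  have "\<exists>c. \<forall>x\<in>{0..S}. G x - f x = c"
  proof (rule has_field_derivative_zero_constant)
    fix x assume x: "x \<in> {0..S}"
    show "((\<lambda>x. G x - f x) has_real_derivative 0) (at x within {0..S})"
      using DERIV_diff[OF has_field_derivative_at_within[OF G] f[OF x]] fg[OF x] by simp
  qed simp
  then obtain c where c: "\<And>x. x \<in> {0..S} \<Longrightarrow> G x - f x = c" by blast
  show ?thesis
  proof (rule that[of "\<lambda>x. G x - c"])
    show "((\<lambda>x. G x - c) has_real_derivative g x) (at x)" for x
      using DERIV_diff[OF G DERIV_const] by simp
  qed (use c in force)
qed

text \<open>Extend \<open>f''\<close> by constants and integrate twice. With a profile on the whole
  line the radial function is C^2 on the whole space, and the continuity of its derivatives up to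
  the sphere is immediate.\<close>

lemma C2_extension:
  fixes f f' f'' :: "real \<Rightarrow> real"
  assumes S: "0 \<le> S"
    and f: "\<And>x. x \<in> {0..S} \<Longrightarrow> (f has_real_derivative f' x) (at x within {0..S})"
    and f': "\<And>x. x \<in> {0..S} \<Longrightarrow> (f' has_real_derivative f'' x) (at x within {0..S})"
    and f'': "continuous_on {0..S} f''"
  obtains F F' F'' where "\<And>x. (F has_real_derivative F' x) (at x)" "\<And>x. (F' has_real_derivative F'' x) (at x)"
    "continuous_on UNIV F''" "\<And>x. x \<in> {0..S} \<Longrightarrow> F x = f x \<and> F' x = f' x \<and> F'' x = f'' x"
proof -
  define F'' where "F'' = (\<lambda>x. f'' (max 0 (min S x)))"
  have c: "continuous_on UNIV F''" unfolding F''_def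
    by (rule continuous_on_compose2[OF f'']) (use S in \<open>auto intro!: continuous_intros\<close>)
  have eq: "F'' x = f'' x" if "x \<in> {0..S}" for x using that by (simp add: F''_def)
  obtain F' where F': "\<And>x. (F' has_real_derivative F'' x) (at x)" "\<And>x. x \<in> {0..S} \<Longrightarrow> F' x = f' x"
    using antiderivative_agreeing_on_interval[OF S _ _ f', of F''] eq c
    by (metis UNIV_I continuous_on_eq_continuous_at open_UNIV)
  obtain F where "\<And>x. (F has_real_derivative F' x) (at x)" "\<And>x. x \<in> {0..S} \<Longrightarrow> F x = f x"
    using antiderivative_agreeing_on_interval[OF S _ _ f, of F'] F' DERIV_isCont by metis
  then show ?thesis using that[of F F' F''] F' c eq by blast
qed

lemma C_closure_UNIV:
  assumes "C_on m UNIV f"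
  shows "C_closure m S f"
proof -
  have *: "continuous_on X (iter_partial bs f)" if "set bs \<subseteq> Basis" "length bs \<le> m" for bs X
    using assms that continuous_on_subset[OF _ subset_UNIV] unfolding C_on_def by metis
  have "C_on m S f" using assms * unfolding C_on_def by auto
  moreover have "continuous_on (closure S) f" using *[of "[]"] by (simp add: iter_partial_def)
  ultimately show ?thesis using * unfolding C_closure_def by blast
qed

lemma C_on_2_radial:
  fixes F F' F'' :: "real \<Rightarrow> real"
  assumes F: "\<And>x. (F has_real_derivative F' x) (at x)" "\<And>x. (F' has_real_derivative F'' x) (at x)"
    "continuous_on UNIV F''" and S: "open S"
  shows "C_on 2 S (\<lambda>z::'a::euclidean_space. F (z \<bullet> z))"
proof -
  have p: "partial b (\<lambda>z::'a. F (z \<bullet> z)) = (\<lambda>z. F' (z \<bullet> z) * (2 * (z \<bullet> b)))" for b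
    by (rule ext) (rule partial_radial(1)[OF F(1)])
  have "continuous_on UNIV F" using F(1) by (intro DERIV_continuous_on) auto
  then have c: "continuous_on S (\<lambda>z::'a. F (z \<bullet> z))"
    by (rule continuous_on_compose2) (auto intro!: continuous_intros)
  have "bounded_linear (\<lambda>z::'a. 2 * (z \<bullet> b))" for b
    by (intro bounded_linear_const_mult bounded_linear_inner_left)
  then have C1: "C_on 1 S (\<lambda>z::'a. F' (z \<bullet> z) * (2 * (z \<bullet> b)))" for b
    by (intro C_on_mult S C_on_1_real_compose[OF S C_on_inner_self F(2,3)] C_on_linear)
  have "C_on (Suc 1) S (\<lambda>z::'a. F (z \<bullet> z))"
    unfolding C_on_Suc by (intro conjI ballI c partial_radial(2)[OF F(1)]) (simp only: p C1)
  then show ?thesis by (simp add: numeral_2_eq_2)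
qed

lemma hess_radial:
  fixes F F' F'' :: "real \<Rightarrow> real"
  assumes F: "\<And>x. (F has_real_derivative F' x) (at x)" "\<And>x. (F' has_real_derivative F'' x) (at x)"
    "continuous_on UNIV F''"
  shows "hess (\<lambda>z. complex_of_real (F (z \<bullet> z))) z i j
    = of_real (F' (z \<bullet> z)) * (if i = j then 1 else 0) + of_real (F'' (z \<bullet> z)) * (cnj (z $ i) * z $ j)"
proof -
  have l: "bounded_linear (\<lambda>z::complex ^ 'a. z $ j)" by (rule bounded_linear_vec_nth)
  have w: "wirt (-\<i>) i (\<lambda>z. z $ j) z = (if i = j then 1 else 0)"
    by (simp add: wirt_def partial_linear(1)[OF l] axis_def)
  have C1: "C_on 1 UNIV (\<lambda>z::complex ^ 'a. complex_of_real (F' (z \<bullet> z)))"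
    by (intro C_on_bounded_linear[OF open_UNIV bounded_linear_of_real] C_on_1_real_compose[OF open_UNIV C_on_inner_self F(2,3)])
  have "wirt \<i> j (\<lambda>z. complex_of_real (F (z \<bullet> z))) = (\<lambda>z. of_real (F' (z \<bullet> z)) * z $ j)"
    by (rule ext) (rule wirt_radial(1)[OF F(1)])
  then have "hess (\<lambda>z. complex_of_real (F (z \<bullet> z))) z i j = wirt (-\<i>) i (\<lambda>z. of_real (F' (z \<bullet> z)) * z $ j) z"
    by (simp only: hess_def)
  also have "\<dots> = of_real (F'' (z \<bullet> z)) * cnj (z $ i) * z $ j + of_real (F' (z \<bullet> z)) * (if i = j then 1 else 0)"
    by (simp only: wirt_mult[OF C1 C_on_linear[OF l] UNIV_I] wirt_radial(2)[OF F(2)] w)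
  finally show ?thesis by simp
qed

lemma sum_cnj_mult_self: "(\<Sum>i\<in>UNIV. cnj (z $ i) * z $ i) = of_real (z \<bullet> z)" for z :: "complex ^ 'n::finite"
proof -
  have "(\<Sum>i\<in>UNIV. cnj (z $ i) * z $ i) = (\<Sum>i\<in>UNIV. of_real (z $ i \<bullet> z $ i))"
    by (intro sum.cong refl) (simp add: complex_eq_iff inner_complex_def)
  then show ?thesis by (simp add: inner_vec_def)
qed

theorem radial_solution_exists:
  fixes R p :: real and k :: nat
  assumes k: "1 \<le> k" "k \<le> CARD('n::finite)" and R: "0 < R" and p: "0 < p" "p \<noteq> real k"
    and subcritical: "real CARD('n) * (p - real k) < real k * (p + 1)"
  shows "\<exists>u :: complex ^ 'n \<Rightarrow> real. C_closure 2 (ball 0 R) u \<and> solves_Dirichlet k p R u \<and>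
    (\<forall>z\<in>ball 0 R. u z < 0) \<and> radially_symmetric_on (cball 0 R) u"
proof -
  define n where "n = CARD('n)"
  have n: "1 \<le> n" by (simp add: n_def Suc_leI)
  have "\<exists>S \<psi>. profile n k p S \<psi>"
  proof (cases "p < k")
    case True
    then show ?thesis using sublinear_profile_exists[OF n k(1) p(1)] by blast
  next
    case False
    then show ?thesis using superlinear_profile_exists[OF n k(1)] p subcritical by (simp add: n_def)
  qed
  then obtain S \<psi> where prof: "profile n k p S \<psi>" by blast
  then have S: "0 < S" and \<psi>S: "\<psi> S = 0" and pos: "\<And>s. s \<in> {0..<S} \<Longrightarrow> 0 < \<psi> s"
    by (auto simp: profile_def)
  obtain w w' where w: "\<And>s. s \<in> {0..S} \<Longrightarrow> (\<psi> has_real_derivative - w s) (at s within {0..S})"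
    "\<And>s. s \<in> {0..S} \<Longrightarrow> (w has_real_derivative w' s) (at s within {0..S})" "continuous_on {0..S} w'"
    "\<And>s. s \<in> {0..S} \<Longrightarrow> real n * w s ^ k + real k * s * w s ^ (k - 1) * w' s = real n * \<psi> s powr p"
    using profile_regularity[OF n k(1) p(1) prof] by blast
  have "((\<lambda>x. - \<psi> x) has_real_derivative w s) (at s within {0..S})" if "s \<in> {0..S}" for s
    using DERIV_minus[OF w(1)[OF that]] by simp
  then obtain G G' G'' where G: "\<And>x. (G has_real_derivative G' x) (at x)" "\<And>x. (G' has_real_derivative G'' x) (at x)"
    "continuous_on UNIV G''" and G_eq: "\<And>x. x \<in> {0..S} \<Longrightarrow> G x = - \<psi> x \<and> G' x = w x \<and> G'' x = w' x"
    using C2_extension[OF less_imp_le[OF S], of "\<lambda>x. - \<psi> x" w w'] w(2,3) by blast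
  obtain c where c: "c > 0" "\<And>B :: 'n \<Rightarrow> 'n \<Rightarrow> complex.
    polar_S k B (\<lambda>i j. if i = j then 1 else 0) = of_real c * (\<Sum>i\<in>UNIV. B i i)"
    using polar_S_mat1[OF k] by blast
  \<comment> \<open>Maps the range of |z|^2 over the ball onto the interval of the profile.\<close>
  define l where "l = S / R\<^sup>2"
  have l: "0 < l" using S R by (simp add: l_def)
  \<comment> \<open>Collects the constants from comparing the two sides for the dilated profile: k!
    from the normalization, \<open>c\<close> and \<open>n\<close> from the identity matrix,
    \<open>l ^ k\<close> from the dilation.\<close>
  define q where "q = fact k / (c * n * l ^ k)"
  have q: "0 < q" using c l n by (simp add: q_def)
  \<comment> \<open>The amplitude must satisfy A^(k-p) = q, as the two sides of the equation scale
    like A^k and A^p; this is solvable because p differs from k.\<close>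
  define A where "A = q powr (1 / (k - p))"
  have A: "0 < A" using q by (simp add: A_def)
  have Aq: "A ^ k = A powr p * q"
  proof -
    have "A powr (k - p) = q" using p q by (simp add: A_def powr_powr)
    moreover have "A ^ k = A powr real k" using A by (simp only: powr_realpow)
    then have "A ^ k = A powr p * A powr (k - p)" by (simp add: powr_add[symmetric])
    ultimately show ?thesis by simp
  qed
  define F where "F = (\<lambda>s. A * G (l * s))"
  define F' where "F' = (\<lambda>s. A * l * G' (l * s))"
  define F'' where "F'' = (\<lambda>s. A * l\<^sup>2 * G'' (l * s))"
  have lx: "((*) l has_real_derivative l) (at x)" for x by (rule DERIV_cmult_Id)
  have F: "(F has_real_derivative F' x) (at x)" "(F' has_real_derivative F'' x) (at x)" for x
    using DERIV_cmult[OF DERIV_chain2[OF G(1) lx], of A x] DERIV_cmult[OF DERIV_chain2[OF G(2) lx], of "A * l" x]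
    by (simp_all add: F_def F'_def F''_def power2_eq_square mult_ac)
  have Fc: "continuous_on UNIV F''"
    unfolding F''_def
    by (intro continuous_on_mult continuous_on_const continuous_on_compose2[OF G(3)] continuous_on_id) auto
  define u where "u = (\<lambda>z::complex ^ 'n. F (z \<bullet> z))"
  have in_S: "l * (z \<bullet> z) \<in> {0..<S}" if "z \<in> ball 0 R" for z :: "complex ^ 'n"
  proof -
    have "(norm z)\<^sup>2 < R\<^sup>2" using that by (intro power_strict_mono) auto
    then have "z \<bullet> z < R\<^sup>2" by (simp add: power2_norm_eq_inner)
    then have "S * (z \<bullet> z) < S * R\<^sup>2" using S by simp
    then show ?thesis using l S R by (simp add: l_def divide_less_eq)
  qed
  have u_eq: "u z = - (A * \<psi> (l * (z \<bullet> z)))" if "z \<in> ball 0 R" for z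
    using in_S[OF that] G_eq[of "l * (z \<bullet> z)"] by (simp add: u_def F_def)
  have "S_op k (complex_Hessian u z) = complex_of_real ((- u z) powr p)" if z: "z \<in> ball 0 R" for z
  proof -
    define s where "s = l * (z \<bullet> z)"
    have s: "s \<in> {0..<S}" "s \<in> {0..S}" using in_S[OF z] by (auto simp: s_def)
    let ?a = "F' (z \<bullet> z)" and ?b = "F'' (z \<bullet> z)"
    have "(\<lambda>i j. complex_Hessian u z $ i $ j)
      = (\<lambda>i j. of_real ?a * (if i = j then 1 else 0) + of_real ?b * (cnj (z $ i) * z $ j))"
      unfolding complex_Hessian_eq_hess u_def by (intro ext hess_radial F Fc)
    then have "S_op k (complex_Hessian u z) = of_real c * (of_nat CARD('n) * of_real ?a ^ k
        + of_nat k * of_real ?a ^ (k - 1) * of_real ?b * (\<Sum>i\<in>UNIV. cnj (z $ i) * z $ i)) / fact k"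
      unfolding S_op_eq_polar_S[OF k(1)] using polar_S_identity_plus_rank_one[OF k(1) c(2)] by simp
    also have "\<dots> = of_real (c * (real n * ?a ^ k + real k * ?a ^ (k - 1) * ?b * (z \<bullet> z)) / fact k)"
      by (simp add: sum_cnj_mult_self n_def)
    also have "real n * ?a ^ k + real k * ?a ^ (k - 1) * ?b * (z \<bullet> z)
      = (A * l) ^ k * (real n * w s ^ k + real k * s * w s ^ (k - 1) * w' s)"
    proof -
      have a: "?a = A * l * w s" "?b = A * l\<^sup>2 * w' s"
        using G_eq[OF s(2)] by (simp_all add: F'_def F''_def s_def)
      have "(A * l) ^ k = (A * l) ^ (k - 1) * (A * l)" using k(1) by (cases k) auto
      then show ?thesis
        unfolding a by (simp add: power_mult_distrib s_def power2_eq_square algebra_simps)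
    qed
    also have "\<dots> = (A * l) ^ k * (real n * \<psi> s powr p)" using w(4)[OF s(2)] by simp
    also have "c * ((A * l) ^ k * (real n * \<psi> s powr p)) / fact k = (A * \<psi> s) powr p"
      using c l n A pos[OF s(1)] by (simp add: power_mult_distrib Aq q_def powr_mult)
    also have "A * \<psi> s = - u z" using u_eq[OF z] by (simp add: s_def)
    finally show ?thesis .
  qed
  moreover have "u z = 0" if "z \<in> sphere 0 R" for z
  proof -
    have "z \<bullet> z = R\<^sup>2" using that by (simp add: power2_norm_eq_inner[symmetric])
    then have "l * (z \<bullet> z) = S" using R by (simp add: l_def)
    then show ?thesis using G_eq[of S] S \<psi>S by (simp add: u_def F_def)
  qed
  ultimately have "solves_Dirichlet k p R u" by (simp add: solves_Dirichlet_def)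
  moreover have "C_closure 2 (ball 0 R) u"
    unfolding u_def by (intro C_closure_UNIV C_on_2_radial[where F' = F' and F'' = F''] F Fc open_UNIV)
  moreover have "u z < 0" if "z \<in> ball 0 R" for z
    using u_eq[OF that] pos[OF in_S[OF that]] A by simp
  moreover have "radially_symmetric_on (cball 0 R) u"
    by (simp add: radially_symmetric_on_def u_def norm_eq_sqrt_inner)
  ultimately show ?thesis by blast
qed

theorem theorem2:
  fixes k :: nat and R p :: real
  assumes "1 \<le> k" and "k \<le> CARD('n::finite)" and "R > 0" and "p > 0"
  shows "(crit_exp k CARD('n) \<le> ereal p \<longrightarrow>
            \<not> (\<exists>u :: complex ^ 'n \<Rightarrow> real.
                  C_closure 2 (ball 0 R) u \<and> C_on 4 (ball 0 R) u \<and>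
                  (\<forall>z\<in>cball 0 R. u z \<le> 0) \<and> (\<exists>z\<in>cball 0 R. u z \<noteq> 0) \<and>
                  solves_Dirichlet k p R u)) \<and>
         (ereal p < crit_exp k CARD('n) \<and> p \<noteq> real k \<longrightarrow>
            (\<exists>u :: complex ^ 'n \<Rightarrow> real.
                  C_closure 2 (ball 0 R) u \<and>
                  solves_Dirichlet k p R u \<and>
                  (\<forall>z\<in>ball 0 R. u z < 0) \<and>
                  radially_symmetric_on (cball 0 R) u))"
proof (intro conjI impI)
  let ?n = "CARD('n)"
  assume crit: "crit_exp k ?n \<le> ereal p"
  then have kn: "k < ?n" by (auto simp: crit_exp_def split: if_splits)
  then have "(real ?n + 1) * real k / (real ?n - real k) \<le> p" using crit by (simp add: crit_exp_def)
  then have le: "(real ?n + 1) * real k \<le> p * (real ?n - real k)" using kn by (simp add: divide_le_eq)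
  \<comment> \<open>The critical exponent exceeds 1, because (n + 1) k is at least n + 1, which is
    larger than n - k.\<close>
  have "1 < p"
  proof (rule ccontr)
    assume "\<not> 1 < p"
    then have "p * (real ?n - real k) \<le> 1 * (real ?n - real k)" using kn by (intro mult_right_mono) auto
    moreover have "(real ?n + 1) * 1 \<le> (real ?n + 1) * real k" using assms(1) by (intro mult_left_mono) auto
    ultimately show False using le of_nat_0_le_iff[of k, where 'a = real] by (simp only: algebra_simps)
  qed
  moreover have "real k * (p + 1) \<le> real ?n * (p - real k)" using le by (simp add: algebra_simps)
  moreover have "polar_S k (hess (\<lambda>z. of_real (u z)) z) (hess (\<lambda>z. of_real (u z)) z) = fact k * of_real ((- u z) powr p)"
    if "solves_Dirichlet k p R u" "z \<in> ball 0 R" for u :: "complex ^ 'n \<Rightarrow> real" and z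
  proof -
    have "(\<lambda>i j. complex_Hessian u z $ i $ j) = hess (\<lambda>z. of_real (u z)) z"
      by (simp add: fun_eq_iff complex_Hessian_eq_hess)
    then show ?thesis
      using that S_op_eq_polar_S[OF assms(1), of "complex_Hessian u z"]
      by (auto simp: solves_Dirichlet_def field_simps)
  qed
  ultimately show "\<not> (\<exists>u :: complex ^ 'n \<Rightarrow> real.
                  C_closure 2 (ball 0 R) u \<and> C_on 4 (ball 0 R) u \<and>
                  (\<forall>z\<in>cball 0 R. u z \<le> 0) \<and> (\<exists>z\<in>cball 0 R. u z \<noteq> 0) \<and>
                  solves_Dirichlet k p R u)"
    using no_nonpositive_solution[OF assms(1,2,3)] unfolding solves_Dirichlet_def by blast
next
  let ?n = "CARD('n)"
  assume sub: "ereal p < crit_exp k ?n \<and> p \<noteq> real k"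
  have "real ?n * (p - real k) < real k * (p + 1)"
  proof (cases "k < ?n")
    case True
    then have "p < (real ?n + 1) * real k / (real ?n - real k)" using sub by (simp add: crit_exp_def)
    then have "p * (real ?n - real k) < (real ?n + 1) * real k" using True by (simp add: less_divide_eq)
    then show ?thesis by (simp add: algebra_simps)
  next
    case False
    \<comment> \<open>Here the inequality reads n (p - n) < n (p + 1), which holds for every
      p.\<close>
    then have "k = ?n" using assms(2) by simp
    then show ?thesis using assms(1) by simp
  qed
  then show "\<exists>u :: complex ^ 'n \<Rightarrow> real. C_closure 2 (ball 0 R) u \<and> solves_Dirichlet k p R u \<and>
                  (\<forall>z\<in>ball 0 R. u z < 0) \<and> radially_symmetric_on (cball 0 R) u"
    using radial_solution_exists[OF assms(1,2,3,4)] sub by blast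
qed

end
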